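(* Assume the standing conditions on $F$ and $\sigma$ written out in the context. Define $\overline{\mathcal{A}}=\{\overline{\mathcal{A}}(\omega^-)\}_{\omega^-\in\mathcal{B}}$ by $\overline{\mathcal{A}}(\omega^-):=\mathrm{supp}(\mu_{\omega^-})$ if $\omega^-\in\tilde{\mathcal{B}}$ and $\overline{\mathcal{A}}(\omega^-):=\{0\}$ otherwise. Then for every $\epsilon>0$ and $x_0\in\mathbb{R}^d$, $$\lim_{t\to\infty}\frac1t\int_0^t\mathbf{P}\Big(d\big(\varphi^s_{\omega^-}(x_0),\overline{\mathcal{A}}(\omega^-)\big)\ge\epsilon\Big)\,ds=0.$$
   Context: **Noise.** Fix $d\ge1$, $H\in(0,1)$. For $h\in(0,1)$ let $\mathcal{B}_h$ be the closure of $C_0^\infty(\mathbb{R}^-,\mathbb{R}^d)$ (smooth compactly supported $\omega:\mathbb{R}^-=(-\infty,0]\to\mathbb{R}^d$ with $\omega(0)=0$) under $\|\omega\|_{\mathcal{B}_h}:=\sup_{s,t\in\mathbb{R}^-}\frac{|\omega(t)-\omega(s)|}{\sqrt{1+|t|+|s|}\,|t-s|^{(1-h)/2}}$ (a separable Banach space), and write $\mathcal{B}:=\mathcal{B}_H$. $\mathbf{P}$ is the Gaussian measure on $\mathcal{B}$ under which the canonical process is a time-reversed Brownian motion. $\mathcal{D}_H:\mathcal{B}_H\to\mathcal{B}_{1-H}$ is the continuous extension of $\mathcal{D}_H\omega(t)=\frac1{\alpha_H}\int_{-\infty}^0(-r)^{H-1/2}(\dot\omega(t+r)-\dot\omega(r))\,dr$,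 where $\alpha_H$ is the normalizing constant for which the canonical process under $(\mathcal{D}_H)_*\mathbf{P}$ is a time-reversed fractional Brownian motion with Hurst parameter $H$. For $t\ge0$ put $\vartheta_t\omega(s):=\omega(s-t)-\omega(-t)$ ($s\le0$) and $P_t(\omega^-,\omega^+)(s):=\omega^+(-s-t)-\omega^+(-t)$ for $-t\le s\le0$, $:=\omega^-(s+t)-\omega^+(-t)$ for $s\le-t$. Let $\Omega:=\mathcal{B}\times\mathcal{B}$, $\mathbb{P}:=\mathbf{P}\times\mathbf{P}$, $\theta_t(\omega^-,\omega^+):=(P_t(\omega^-,\omega^+),\vartheta_t\omega^+)$ for $t\ge0$ and $\theta_t(\omega^-,\omega^+):=(\vartheta_{-t}\omega^-,P_{-t}(\omega^+,\omega^-))$ for $t<0$. Then $B^H_t(\omega):=-(\mathcal{D}_HP_t(\omega^-,\omega^+))(-t)$, $t\ge0$, is a fractional Brownian motion under $\mathbb{P}$. **SDE and standing conditions.** Consider $dY_t=F(Y_t)\,dt+\sigma\,dB^H_t$, $Y_0=x\in\mathbb{R}^d$, with: (1) $\sigma$ an invertible $d\times d$ matrix; (2) for some $C_1^F,C_2^F,C_3^F>0$ and all $\xi_1,\xi_2\in\mathbb{R}^d$, $\langle F(\xi_2)-F(\xi_1),\xi_2-\xi_1\rangle\le\min\{C_1^F-C_2^F|\xi_2-\xi_1|^2,\;C_3^F|\xi_2-\xi_1|^2\}$; (3) $F$ is differentiable and for some $C_F>0$, $N\ge1$: $|F(\xi)|\le C_F(1+|\xi|)^N$ and $|D_\xi F|\le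 C_F(1+|\xi|)^N$ for all $\xi$; (4) if $H>1/2$, the derivative of $F$ is globally bounded. Let $\Phi^t_\omega(x)$ be the solution: $\Phi^t_\omega(x)=x+\int_0^tF(\Phi^s_\omega(x))\,ds+\sigma B^H_t(\omega)$. Set $\varphi^t_{\omega^-}(x):=\Phi^t_{\theta_{-t}(\omega^-,\omega^+)}(x)$, which depends only on $\omega^-$; then $\Phi^t_{(\omega^-,\omega^+)}(x)=\varphi^t_{P_t(\omega^-,\omega^+)}(x)$. **Invariant measure.** $\mu$ is the (known to exist and be) unique probability measure on $\mathbb{R}^d\times\mathcal{B}$ with $\mathcal{B}$-marginal $\mathbf{P}$ that is invariant under the Feller transition semigroup $\mathcal{Q}_t((x,\omega^-);\Gamma):=\int_{\mathcal{B}}\chi_\Gamma\big(\varphi^t_{P_t(\omega^-,\omega^+)}(x),P_t(\omega^-,\omega^+)\big)\mathbf{P}(d\omega^+)$. **Disintegration.** Fix a measurable $\tilde{\mathcal{B}}\subseteq\mathcal{B}$ with $\mathbf{P}(\tilde{\mathcal{B}})=1$ and probability measures $\{\mu_{\omega^-}\}$ on $\mathbb{R}^d$ (known to exist) such that $\omega^-\mapsto\mu_{\omega^-}(A)$ is measurable and $\mu(A\times D)=\int_D\mu_{\omega^-}(A)\,\mathbf{P}(d\omega^-)$ for Borel $A,D$, and such that for all $(\omega^-,\omega^+)\in\tilde{\mathcal{B}}\times\mathcal{B}$, $t\ge0$: $P_t(\omega^-,\omega^+)\in\tilde{\mathcal{B}}$ and $(\Phi^t_{(\omega^-,\omega^+)})_*\mu_{\omega^-}=\mu_{P_t(\omega^-,\omega^+)}$.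 *)

theory Defs
  imports "HOL-Probability.Probability"
begin

section \<open>Paths on the negative half-line\<close>

text \<open>
  A path \<open>\<omega> : (-\<infinity>, 0] \<rightarrow> \<real>\<^sup>d\<close> is represented by a total function; since all paths considered satisfy
  \<open>\<omega> 0 = 0\<close>, the representative is fixed by requiring \<open>\<omega> t = 0\<close> for all \<open>t \<ge> 0\<close>.
\<close>

type_synonym 'd hpath = "real \<Rightarrow> real ^ 'd"

text \<open>Smoothness is smoothness up to the end point 0, with one-sided derivatives there; the support
  is a compact subset of the closed half-line and may contain 0.\<close>

definition C0_inf :: "('d::finite) hpath set" where
  "C0_inf = {\<omega>. (\<forall>t\<ge>0. \<omega> t = 0) \<and>
      (\<exists>T. \<forall>t\<le>T. \<omega> t = 0) \<and>
      (\<exists>g :: nat \<Rightarrow> real \<Rightarrow> real ^ 'd. (\<forall>t\<le>0. g 0 t = \<omega> t) \<and>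
         (\<forall>n. \<forall>t\<le>0. (g n has_vector_derivative g (Suc n) t) (at t within {..0})))}"

text \<open>For \<open>s = t\<close> the quotient below is \<open>0 / 0 = 0\<close>, so the diagonal does not contribute.\<close>

definition holder_quot :: "real \<Rightarrow> ('d::finite) hpath \<Rightarrow> real \<times> real \<Rightarrow> real" where
  "holder_quot h \<omega> = (\<lambda>(s, t). norm (\<omega> t - \<omega> s) /
      (sqrt (1 + \<bar>t\<bar> + \<bar>s\<bar>) * \<bar>t - s\<bar> powr ((1 - h) / 2)))"

definition holder_norm :: "real \<Rightarrow> ('d::finite) hpath \<Rightarrow> ennreal" where
  "holder_norm h \<omega> = (SUP p \<in> {..0} \<times> {..0}. ennreal (holder_quot h \<omega> p))"

definition holder_dist :: "real \<Rightarrow> ('d::finite) hpath \<Rightarrow> 'd hpath \<Rightarrow> real" where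
  "holder_dist h \<omega> \<eta> = enn2real (holder_norm h (\<lambda>t. \<omega> t - \<eta> t))"

text \<open>The space \<open>\<B>\<^sub>h\<close>: the closure of \<open>C0_inf\<close> among the paths of finite norm.\<close>

definition BH :: "real \<Rightarrow> ('d::finite) hpath set" where
  "BH h = {\<omega>. (\<forall>t\<ge>0. \<omega> t = 0) \<and> holder_norm h \<omega> < \<infinity> \<and>
      (\<forall>e>0. \<exists>f\<in>C0_inf. holder_norm h (\<lambda>t. \<omega> t - f t) < e)}"

definition BH_top :: "real \<Rightarrow> ('d::finite) hpath topology" where
  "BH_top h = Metric_space.mtopology (BH h) (holder_dist h)"

text \<open>As \<open>\<B>\<^sub>h\<close> is separable, the Borel sets of \<open>\<real>\<^sup>d \<times> \<B>\<^sub>h\<close> are the sets of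
  \<open>borel \<Otimes>\<^sub>M BH_borel h\<close>.\<close>

definition BH_borel :: "real \<Rightarrow> ('d::finite) hpath measure" where
  "BH_borel h = sigma (BH h) {U. openin (BH_top h) U}"

lemma holder_quot_nonneg: "0 \<le> holder_quot h \<omega> p"
  by (cases p) (simp add: holder_quot_def)

lemma holder_norm_triangle:
  "holder_norm h (\<lambda>t. \<omega> t + \<eta> t) \<le> holder_norm h \<omega> + holder_norm h \<eta>"
  unfolding holder_norm_def
proof (rule SUP_least)
  fix p :: "real \<times> real" assume p: "p \<in> {..0} \<times> {..0}"
  obtain s t where st: "p = (s, t)" by (cases p)
  have "norm ((\<omega> t + \<eta> t) - (\<omega> s + \<eta> s)) \<le> norm (\<omega> t - \<omega> s) + norm (\<eta> t - \<eta> s)"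
    using norm_triangle_ineq[of "\<omega> t - \<omega> s" "\<eta> t - \<eta> s"] by (simp add: algebra_simps)
  then have "holder_quot h (\<lambda>t. \<omega> t + \<eta> t) p \<le> holder_quot h \<omega> p + holder_quot h \<eta> p"
    unfolding st holder_quot_def by (simp add: add_divide_distrib[symmetric] divide_right_mono)
  then have "ennreal (holder_quot h (\<lambda>t. \<omega> t + \<eta> t) p)
      \<le> ennreal (holder_quot h \<omega> p) + ennreal (holder_quot h \<eta> p)"
    by (metis ennreal_leI ennreal_plus holder_quot_nonneg)
  also have "\<dots> \<le> (SUP p \<in> {..0} \<times> {..0}. ennreal (holder_quot h \<omega> p)) +
      (SUP p \<in> {..0} \<times> {..0}. ennreal (holder_quot h \<eta> p))"
    using p by (intro add_mono SUP_upper)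
  finally show "ennreal (holder_quot h (\<lambda>t. \<omega> t + \<eta> t) p) \<le> \<dots>" .
qed

lemma holder_norm_minus: "holder_norm h (\<lambda>t. - \<omega> t) = holder_norm h \<omega>"
  unfolding holder_norm_def holder_quot_def
  by (intro SUP_cong refl) (auto simp: norm_minus_commute)

lemma Metric_space_BH: "Metric_space (BH h :: ('d::finite) hpath set) (holder_dist h)"
proof
  fix x y :: "'d hpath"
  show "holder_dist h x y = holder_dist h y x"
    using holder_norm_minus[of h "\<lambda>t. x t - y t"] by (simp add: holder_dist_def)
  show "0 \<le> holder_dist h x y"
    by (simp add: holder_dist_def)
next
  have fin: "holder_norm h (\<lambda>t. x t - y t) < \<infinity>" if "x \<in> BH h" "y \<in> BH h" for x y :: "'d hpath"
    using holder_norm_triangle[of h x "\<lambda>t. - y t"] that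
    by (auto simp: holder_norm_minus BH_def intro: le_less_trans)
  {
    fix x y :: "'d hpath" assume xy: "x \<in> BH h" "y \<in> BH h"
    show "(holder_dist h x y = 0) = (x = y)"
    proof
      assume "holder_dist h x y = 0"
      with fin[OF xy] have z: "holder_norm h (\<lambda>t. x t - y t) = 0"
        by (auto simp: holder_dist_def enn2real_eq_0_iff)
      show "x = y"
      proof
        fix t
        have 0: "x t = 0 \<and> y t = 0" if "t \<ge> 0" for t
          using xy that by (auto simp: BH_def)
        show "x t = y t"
        proof (cases "t \<ge> 0")
          case False
          then have "ennreal (holder_quot h (\<lambda>t. x t - y t) (0, t)) \<le> 0"
            unfolding z[symmetric] holder_norm_def by (intro SUP_upper) auto
          then have "holder_quot h (\<lambda>t. x t - y t) (0, t) \<le> 0"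
            by (metis ennreal_eq_0_iff le_zero_eq)
          then show ?thesis using False 0[of 0]
            by (auto simp: holder_quot_def divide_le_0_iff mult_le_0_iff)
        qed (use 0 in auto)
      qed
    qed (simp add: holder_dist_def holder_norm_def holder_quot_def case_prod_beta zero_ennreal_def[symmetric])
  }
  fix x y z :: "'d hpath" assume "x \<in> BH h" "y \<in> BH h" "z \<in> BH h"
  then show "holder_dist h x z \<le> holder_dist h x y + holder_dist h y z"
    using holder_norm_triangle[of h "\<lambda>t. x t - y t" "\<lambda>t. y t - z t"] fin[of x y] fin[of y z]
    by (simp add: holder_dist_def enn2real_plus[symmetric] enn2real_mono ennreal_add_less_top)
qed

section \<open>Brownian motion and fractional Brownian motion\<close>

definition gaussian_law :: "real measure \<Rightarrow> bool" where
  "gaussian_law N \<longleftrightarrow> (\<exists>m. N = return borel m) \<or>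
      (\<exists>m s. s > 0 \<and> N = density lborel (\<lambda>x. ennreal (normal_density m s x)))"

text \<open>A centred \<open>\<real>\<^sup>d\<close>-valued Gaussian process with independent, identically distributed components
  of covariance function \<open>R\<close>.\<close>

definition centered_gaussian_process ::
    "'w measure \<Rightarrow> real set \<Rightarrow> (real \<Rightarrow> real \<Rightarrow> real) \<Rightarrow> (real \<Rightarrow> 'w \<Rightarrow> real ^ ('d::finite)) \<Rightarrow> bool" where
  "centered_gaussian_process M T R X \<longleftrightarrow> prob_space M \<and>
     (\<forall>t\<in>T. X t \<in> borel_measurable M) \<and>
     (\<forall>S c. finite S \<and> S \<subseteq> T \<longrightarrow>
        gaussian_law (distr M borel (\<lambda>w. \<Sum>t\<in>S. c t \<bullet> X t w))) \<and>
     (\<forall>t\<in>T. \<forall>i. (LINT w|M. X t w $ i) = 0) \<and>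
     (\<forall>s\<in>T. \<forall>t\<in>T. \<forall>i j. (LINT w|M. X s w $ i * X t w $ j) = (if i = j then R s t else 0))"

definition brownian_motion :: "'w measure \<Rightarrow> (real \<Rightarrow> 'w \<Rightarrow> real ^ ('d::finite)) \<Rightarrow> bool" where
  "brownian_motion M X \<longleftrightarrow> centered_gaussian_process M {0..} min X"

definition fractional_brownian_motion ::
    "real \<Rightarrow> 'w measure \<Rightarrow> (real \<Rightarrow> 'w \<Rightarrow> real ^ ('d::finite)) \<Rightarrow> bool" where
  "fractional_brownian_motion H M X \<longleftrightarrow> centered_gaussian_process M {0..}
     (\<lambda>s t. (s powr (2 * H) + t powr (2 * H) - \<bar>t - s\<bar> powr (2 * H)) / 2) X"

text \<open>Path continuity is not part of these definitions; for the processes below it holds because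
  the elements of \<open>\<B>\<^sub>h\<close> are continuous. Time-reversed means that \<open>t \<mapsto> \<omega> (- t)\<close>, \<open>t \<ge> 0\<close>, is a
  (fractional) Brownian motion.\<close>

definition wiener_measure :: "real \<Rightarrow> ('d::finite) hpath measure \<Rightarrow> bool" where
  "wiener_measure H P \<longleftrightarrow> sets P = sets (BH_borel H) \<and> brownian_motion P (\<lambda>t \<omega>. \<omega> (- t))"

definition path_deriv :: "('d::finite) hpath \<Rightarrow> real \<Rightarrow> real ^ 'd" where
  "path_deriv \<omega> t = vector_derivative \<omega> (at t within {..0})"

text \<open>\<open>frac_operator H P \<alpha> D\<close>: \<open>D\<close> is the operator \<open>\<D>\<^sub>H\<close> and \<open>\<alpha>\<close> its (positive) normalizing
  constant \<open>\<alpha>\<^sub>H\<close>.\<close>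

definition frac_operator ::
    "real \<Rightarrow> ('d::finite) hpath measure \<Rightarrow> real \<Rightarrow> ('d hpath \<Rightarrow> 'd hpath) \<Rightarrow> bool" where
  "frac_operator H P \<alpha> D \<longleftrightarrow> \<alpha> > 0 \<and>
     continuous_map (BH_top H) (BH_top (1 - H)) D \<and>
     (\<forall>\<omega>\<in>C0_inf. \<forall>t\<le>0. D \<omega> t =
        (1 / \<alpha>) *\<^sub>R (LINT r:{..0}|lborel.
           ((- r) powr (H - 1 / 2)) *\<^sub>R (path_deriv \<omega> (t + r) - path_deriv \<omega> r))) \<and>
     fractional_brownian_motion H (distr P (BH_borel (1 - H)) D) (\<lambda>t \<omega>. \<omega> (- t))"

section \<open>Shifts\<close>

definition shift :: "real \<Rightarrow> ('d::finite) hpath \<Rightarrow> 'd hpath" where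
  "shift t \<omega> = (\<lambda>s. if s \<le> 0 then \<omega> (s - t) - \<omega> (- t) else 0)"

definition concat_path :: "real \<Rightarrow> ('d::finite) hpath \<times> 'd hpath \<Rightarrow> 'd hpath" where
  "concat_path t = (\<lambda>(\<omega>m, \<omega>p) s.
     if s > 0 then 0
     else if - t \<le> s then \<omega>p (- s - t) - \<omega>p (- t)
     else \<omega>m (s + t) - \<omega>p (- t))"

definition theta :: "real \<Rightarrow> ('d::finite) hpath \<times> 'd hpath \<Rightarrow> 'd hpath \<times> 'd hpath" where
  "theta t = (\<lambda>(\<omega>m, \<omega>p).
     if t \<ge> 0 then (concat_path t (\<omega>m, \<omega>p), shift t \<omega>p)
     else (shift (- t) \<omega>m, concat_path (- t) (\<omega>p, \<omega>m)))"

definition fbm_path ::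
    "('d hpath \<Rightarrow> 'd hpath) \<Rightarrow> real \<Rightarrow> ('d::finite) hpath \<times> 'd hpath \<Rightarrow> real ^ 'd" where
  "fbm_path D t \<omega> = - D (concat_path t \<omega>) (- t)"

section \<open>The equation\<close>

definition drift_conditions :: "real \<Rightarrow> (real ^ 'd \<Rightarrow> real ^ ('d::finite)) \<Rightarrow> bool" where
  "drift_conditions H F \<longleftrightarrow>
     (\<exists>C1>0. \<exists>C2>0. \<exists>C3>0. \<forall>x y.
        (F y - F x) \<bullet> (y - x) \<le> min (C1 - C2 * (norm (y - x))\<^sup>2) (C3 * (norm (y - x))\<^sup>2)) \<and>
     (\<forall>x. F differentiable (at x)) \<and>
     (\<exists>C>0. \<exists>N\<ge>1. \<forall>x. norm (F x) \<le> C * (1 + norm x) powr N \<and>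
        onorm (frechet_derivative F (at x)) \<le> C * (1 + norm x) powr N) \<and>
     (H > 1 / 2 \<longrightarrow> (\<exists>K. \<forall>x. onorm (frechet_derivative F (at x)) \<le> K))"

text \<open>\<open>\<Phi> t \<omega> x\<close> is the solution at time \<open>t\<close>, driven by \<open>\<omega> = (\<omega>\<^sup>-, \<omega>\<^sup>+)\<close> and started at \<open>x\<close>.\<close>

definition sde_solution ::
    "real \<Rightarrow> ('d hpath \<Rightarrow> 'd hpath) \<Rightarrow> (real ^ 'd \<Rightarrow> real ^ 'd) \<Rightarrow> real ^ 'd ^ 'd \<Rightarrow>
     (real \<Rightarrow> 'd hpath \<times> 'd hpath \<Rightarrow> real ^ 'd \<Rightarrow> real ^ ('d::finite)) \<Rightarrow> bool" where
  "sde_solution H D F \<sigma> \<Phi> \<longleftrightarrow> (\<forall>\<omega> \<in> BH H \<times> BH H. \<forall>x.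
     continuous_on {0..} (\<lambda>t. \<Phi> t \<omega> x) \<and>
     (\<forall>t\<ge>0. \<Phi> t \<omega> x = x + integral {0..t} (\<lambda>s. F (\<Phi> s \<omega> x)) + \<sigma> *v fbm_path D t \<omega>))"

text \<open>\<open>\<phi>\<^sup>t\<close> does not depend on the \<open>\<omega>\<^sup>+\<close> component; it is evaluated at the zero path.\<close>

definition cocycle ::
    "(real \<Rightarrow> 'd hpath \<times> 'd hpath \<Rightarrow> real ^ 'd \<Rightarrow> real ^ 'd) \<Rightarrow>
     real \<Rightarrow> ('d::finite) hpath \<Rightarrow> real ^ 'd \<Rightarrow> real ^ 'd" where
  "cocycle \<Phi> t \<omega>m x = \<Phi> t (theta (- t) (\<omega>m, \<lambda>_. 0)) x"

section \<open>Invariant measure and disintegration\<close>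

definition transition ::
    "('d::finite) hpath measure \<Rightarrow> (real \<Rightarrow> 'd hpath \<times> 'd hpath \<Rightarrow> real ^ 'd \<Rightarrow> real ^ 'd) \<Rightarrow>
     real \<Rightarrow> (real ^ 'd) \<times> 'd hpath \<Rightarrow> ((real ^ 'd) \<times> 'd hpath) set \<Rightarrow> ennreal" where
  "transition P \<Phi> t = (\<lambda>(x, \<omega>m) \<Gamma>.
     \<integral>\<^sup>+ \<omega>p. indicator \<Gamma> (cocycle \<Phi> t (concat_path t (\<omega>m, \<omega>p)) x, concat_path t (\<omega>m, \<omega>p)) \<partial>P)"

definition invariant_measure ::
    "real \<Rightarrow> ('d::finite) hpath measure \<Rightarrow>
     (real \<Rightarrow> 'd hpath \<times> 'd hpath \<Rightarrow> real ^ 'd \<Rightarrow> real ^ 'd) \<Rightarrow>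
     ((real ^ 'd) \<times> 'd hpath) measure \<Rightarrow> bool" where
  "invariant_measure H P \<Phi> \<mu> \<longleftrightarrow> prob_space \<mu> \<and>
     sets \<mu> = sets (borel \<Otimes>\<^sub>M BH_borel H) \<and>
     distr \<mu> (BH_borel H) snd = P \<and>
     (\<forall>t\<ge>0. \<forall>\<Gamma>\<in>sets \<mu>. emeasure \<mu> \<Gamma> = (\<integral>\<^sup>+ z. transition P \<Phi> t z \<Gamma> \<partial>\<mu>))"

definition disintegration ::
    "real \<Rightarrow> ('d::finite) hpath measure \<Rightarrow>
     (real \<Rightarrow> 'd hpath \<times> 'd hpath \<Rightarrow> real ^ 'd \<Rightarrow> real ^ 'd) \<Rightarrow>
     ((real ^ 'd) \<times> 'd hpath) measure \<Rightarrow> 'd hpath set \<Rightarrow> ('d hpath \<Rightarrow> (real ^ 'd) measure) \<Rightarrow> bool" where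
  "disintegration H P \<Phi> \<mu> Bt \<nu> \<longleftrightarrow>
     Bt \<in> sets P \<and> emeasure P Bt = 1 \<and>
     (\<forall>\<omega>m\<in>BH H. prob_space (\<nu> \<omega>m) \<and> sets (\<nu> \<omega>m) = sets borel) \<and>
     (\<forall>A\<in>sets borel. (\<lambda>\<omega>m. emeasure (\<nu> \<omega>m) A) \<in> borel_measurable P) \<and>
     (\<forall>A\<in>sets borel. \<forall>E\<in>sets P. emeasure \<mu> (A \<times> E) = (\<integral>\<^sup>+ \<omega>m\<in>E. emeasure (\<nu> \<omega>m) A \<partial>P)) \<and>
     (\<forall>\<omega>m\<in>Bt. \<forall>\<omega>p\<in>BH H. \<forall>t\<ge>0. concat_path t (\<omega>m, \<omega>p) \<in> Bt \<and>
        distr (\<nu> \<omega>m) borel (\<Phi> t (\<omega>m, \<omega>p)) = \<nu> (concat_path t (\<omega>m, \<omega>p)))"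

definition measure_supp :: "('a::topological_space) measure \<Rightarrow> 'a set" where
  "measure_supp M = {x. \<forall>U. open U \<and> x \<in> U \<longrightarrow> emeasure M U > 0}"

definition attractor ::
    "('d::finite) hpath set \<Rightarrow> ('d hpath \<Rightarrow> (real ^ 'd) measure) \<Rightarrow> 'd hpath \<Rightarrow> (real ^ 'd) set" where
  "attractor Bt \<nu> \<omega>m = (if \<omega>m \<in> Bt then measure_supp (\<nu> \<omega>m) else {0})"

end

theory Submission
  imports Defs "HOL-Real_Asymp.Real_Asymp"
begin

text \<open>
  The laws of \<open>(\<phi>\<^sup>s x\<^sub>0, \<omega>\<^sup>-)\<close>, averaged over \<open>s \<in> [0, T]\<close>, all have \<open>\<B>\<close>-marginal \<open>P\<close>. By dissipativity
  a trajectory from \<open>x\<^sub>0\<close> stays within bounded distance of one whose starting point has the law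
  \<open>\<mu>\<^bsub>\<omega>\<^sup>-\<^esub>\<close>; the latter is stationary, so the averages are tight. A Prokhorov theorem for measures
  with a fixed marginal yields limit points, tested against functions that are Lipschitz in \<open>x\<close> and only
  measurable in \<open>\<omega>\<^sup>-\<close>. As the equation depends Lipschitz-continuously on \<open>x\<close>, limit points are
  invariant, hence equal to \<open>\<mu>\<close>. The function \<open>min 1 (d(x, A(\<omega>\<^sup>-)) / \<epsilon>)\<close> is admissible
  and vanishes \<open>\<mu>\<close>-almost everywhere, and it bounds the indicator of \<open>d(x, A(\<omega>\<^sup>-)) \<ge> \<epsilon>\<close>.

  The Markov property of the averages needs no Gaussian computation. That \<open>P\<close> is invariant under gluing
  two independent paths follows from the invariance of \<open>\<mu>\<close>, because gluing is the concatenation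
  with time reversal applied twice.
\<close>

section \<open>Young measures\<close>

text \<open>The obstacle is that \<open>attractor Bt \<nu> \<omega>\<close> depends on
  \<open>\<omega>\<close> only measurably, so weak convergence in both variables says nothing about
  the distance function. A fixed marginal removes the obstacle: no compactness on the path space is
  required, since decreasing families of sections are controlled by the countable additivity of one
  fixed law. The price is a limit over uncountably many sets at once; convergent subsequences are
  therefore replaced by finer filters throughout. The flow property rests on the identity
  \<open>D (shift u \<zeta>) t = D \<zeta> (t - u) - D \<zeta> (- u)\<close>, which is proved on
  smooth paths and extended by continuity. The invariance of \<open>Bt\<close> under
  \<open>concat_path\<close> has a second use besides stationarity: it is the source of every
  statement that a concatenated path belongs to \<open>BH H\<close>. For this reason the past is
  always taken from \<open>Bt\<close> itself, and identities of paths hold there without exceptional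
  sets.\<close>

lemma tendsto_uniform_approx:
  fixes a :: "'i \<Rightarrow> real"
  assumes "\<And>e. e > 0 \<Longrightarrow> \<exists>b m. (b \<longlongrightarrow> m) G \<and> (\<forall>i. \<bar>a i - b i\<bar> \<le> e) \<and> \<bar>l - m\<bar> \<le> e"
  shows "(a \<longlongrightarrow> l) G"
proof (rule tendstoI)
  fix e :: real assume "e > 0"
  then obtain b m where b: "(b \<longlongrightarrow> m) G" "\<forall>i. \<bar>a i - b i\<bar> \<le> e / 3" "\<bar>l - m\<bar> \<le> e / 3"
    using assms[of "e / 3"] by auto
  have "eventually (\<lambda>i. dist (b i) m < e / 3) G"
    using b(1) \<open>e > 0\<close> by (intro tendstoD) auto
  then show "eventually (\<lambda>i. dist (a i) l < e) G"
  proof eventually_elim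
    case (elim i)
    then show ?case using spec[OF b(2), of i] b(3) unfolding dist_real_def by linarith
  qed
qed

text \<open>A bounded function is uniformly within \<open>1 / k\<close> of one with finitely many
  values, for which the integral is a finite sum of measures of sets. Setwise convergence thus
  reaches all bounded measurable functions and not only continuous ones.\<close>

lemma setwise_limit_integral:
  fixes m :: "'i \<Rightarrow> 'a measure" and f :: "'a \<Rightarrow> real"
  assumes m: "\<And>i. prob_space (m i)" "\<And>i. sets (m i) = sets M" and M: "prob_space M"
    and lim: "\<And>A. A \<in> sets M \<Longrightarrow> ((\<lambda>i. measure (m i) A) \<longlongrightarrow> measure M A) G"
    and f: "f \<in> borel_measurable M" and B: "\<And>x. x \<in> space M \<Longrightarrow> \<bar>f x\<bar> \<le> B"
  shows "((\<lambda>i. \<integral>x. f x \<partial>m i) \<longlongrightarrow> (\<integral>x. f x \<partial>M)) G"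
proof (rule tendsto_uniform_approx)
  fix e :: real assume "e > 0"
  obtain k :: nat where k: "k > 0" "1 / real k < e"
    using \<open>e > 0\<close> reals_Archimedean2[of "1/e"] 
    by (metis (no_types) divide_inverse ex_inverse_of_nat_less mult_1)
  \<comment> \<open>Boundedness of \<open>f\<close> makes this range of
    \<open>\<lfloor>f x * k\<rfloor>\<close> finite; rounding down to multiples of
    \<open>1 / k\<close> costs at most \<open>1 / k < e\<close>.\<close>
  define J where "J = {\<lfloor>- B * k\<rfloor> .. \<lfloor>B * k\<rfloor>}"
  define A where "A j = {x \<in> space M. \<lfloor>f x * k\<rfloor> = j}" for j
  note f [measurable]
  have A [measurable]: "A j \<in> sets M" for j unfolding A_def floor_eq_iff by measurable
  define s where "s x = (\<Sum>j\<in>J. (of_int j / real k) * indicator (A j) x)" for x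
  have s: "\<bar>f x - s x\<bar> \<le> e" if "x \<in> space M" for x
  proof -
    have "\<lfloor>f x * k\<rfloor> \<in> J"
    proof -
      have "f x * k \<le> B * k" "- B * k \<le> f x * k"
        using B[OF that] by (intro mult_right_mono; linarith)+
      then show ?thesis unfolding J_def by (simp add: floor_mono)
    qed
    then have "s x = of_int \<lfloor>f x * k\<rfloor> / real k"
      unfolding s_def using that
      by (subst sum.mono_neutral_right[of J "{\<lfloor>f x * k\<rfloor>}"]) (auto simp: J_def A_def indicator_def)
    moreover have "\<bar>f x * k - of_int \<lfloor>f x * k\<rfloor>\<bar> \<le> 1" by linarith
    then have "\<bar>(f x * k - of_int \<lfloor>f x * k\<rfloor>) / k\<bar> \<le> 1 / k"
      using k by (simp add: divide_right_mono)
    ultimately show ?thesis using k by (simp add: diff_divide_distrib)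
  qed
  have key: "\<bar>(\<integral>x. f x \<partial>\<mu>) - (\<Sum>j\<in>J. (of_int j / real k) * measure \<mu> (A j))\<bar> \<le> e"
    if "prob_space \<mu>" and S: "sets \<mu> = sets M" for \<mu>
  proof -
    interpret prob_space \<mu> by fact
    have sp: "space \<mu> = space M" using S by (rule sets_eq_imp_space_eq)
    have [measurable]: "f \<in> borel_measurable \<mu>" using f S by (simp cong: measurable_cong_sets)
    have A' [measurable]: "A j \<in> sets \<mu>" for j using A S by simp
    have i1: "integrable \<mu> f"
      by (rule integrable_const_bound[of _ B]) (auto simp: sp B)
    have i2: "integrable \<mu> s" unfolding s_def by (intro Bochner_Integration.integrable_sum integrable_mult_right integrable_real_indicator)
      (auto simp: emeasure_eq_measure)
    have "(\<integral>x. s x \<partial>\<mu>) = (\<Sum>j\<in>J. (of_int j / real k) * measure \<mu> (A j))"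
      unfolding s_def using sets.sets_into_space[OF A']
      by (subst Bochner_Integration.integral_sum)
        (auto intro!: sum.cong integrable_divide integrable_mult_right integrable_real_indicator simp: Int_absorb1 emeasure_eq_measure)
    moreover have "\<bar>(\<integral>x. f x \<partial>\<mu>) - (\<integral>x. s x \<partial>\<mu>)\<bar> \<le> e"
    proof -
      have "\<bar>(\<integral>x. f x - s x \<partial>\<mu>)\<bar> \<le> (\<integral>x. \<bar>f x - s x\<bar> \<partial>\<mu>)" by (rule integral_abs_bound)
      also have "\<dots> \<le> (\<integral>x. e \<partial>\<mu>)"
        using i1 i2 s by (intro integral_mono) (auto simp: sp)
      finally show ?thesis using i1 i2 by (simp add: prob_space)
    qed
    ultimately show ?thesis by simp
  qed
  show "\<exists>b l. (b \<longlongrightarrow> l) G \<and> (\<forall>i. \<bar>(\<integral>x. f x \<partial>m i) - b i\<bar> \<le> e) \<and> \<bar>(\<integral>x. f x \<partial>M) - l\<bar> \<le> e"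
    by (rule exI[of _ "\<lambda>i. \<Sum>j\<in>J. (of_int j / real k) * measure (m i) (A j)"],
        rule exI[of _ "\<Sum>j\<in>J. (of_int j / real k) * measure M (A j)"])
      (intro conjI allI tendsto_sum tendsto_mult tendsto_const lim key m M A refl)
qed

text \<open>Tychonoff makes the box compact for an index type of any size. For uncountably many
  indices it need not be sequentially compact, so a finer filter takes the place of a
  subsequence.\<close>

lemma pointwise_convergent_subfilter:
  fixes u :: "'i \<Rightarrow> 'k \<Rightarrow> real"
  assumes F: "F \<noteq> bot" and u: "\<And>i k. u i k \<in> {0..1}"
  obtains G l where "G \<le> F" "G \<noteq> bot" "\<And>k. ((\<lambda>i. u i k) \<longlongrightarrow> l k) G"
proof -
  have "compactin (product_topology (\<lambda>_. euclidean) UNIV) (PiE UNIV (\<lambda>_::'k. {0..1::real}))"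
    by (subst compactin_PiE) auto
  then have "compact (PiE UNIV (\<lambda>_::'k. {0..1::real}))"
    by (metis euclidean_product_topology compactin_euclidean_iff)
  moreover have "eventually (\<lambda>x. x \<in> PiE UNIV (\<lambda>_::'k. {0..1::real})) (filtermap u F)"
    using u by (auto simp: eventually_filtermap PiE_def extensional_def)
  moreover have "filtermap u F \<noteq> bot" using F by (simp add: filtermap_bot_iff)
  ultimately obtain l where l: "inf (nhds l) (filtermap u F) \<noteq> bot"
    unfolding compact_filter by blast
  \<comment> \<open>Intersecting \<open>F\<close> with the preimages of the neighbourhoods of
    \<open>l\<close> forces convergence to \<open>l\<close>. The filter stays proper exactly because
    \<open>l\<close> is a cluster point.\<close>
  define G where "G = inf F (filtercomap u (nhds l))"
  have "G \<noteq> bot"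
  proof
    assume "G = bot"
    then have "eventually (\<lambda>_. False) G" by simp
    then obtain Q R where QR: "eventually Q F" "eventually R (filtercomap u (nhds l))" "\<And>x. Q x \<Longrightarrow> R x \<Longrightarrow> False"
      unfolding G_def eventually_inf by auto
    then obtain S where S: "eventually S (nhds l)" "\<And>x. S (u x) \<Longrightarrow> R x"
      by (auto simp: eventually_filtercomap)
    have "eventually (\<lambda>y. \<not> S y) (filtermap u F)"
      unfolding eventually_filtermap using QR(1) by eventually_elim (use QR S in blast)
    then have "eventually (\<lambda>_. False) (inf (nhds l) (filtermap u F))"
      unfolding eventually_inf using S(1) by blast
    with l show False by (simp add: trivial_limit_def)
  qed
  have ev: "continuous_on UNIV (\<lambda>f::'k \<Rightarrow> real. f k)" for k
    by (rule continuous_on_product_coordinates)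
  have "filterlim u (nhds l) G"
    unfolding G_def filterlim_def
    by (meson filtermap_filtercomap filtermap_inf le_infI2 order_trans filtermap_mono inf.cobounded2)
  then have "((\<lambda>i. u i k) \<longlongrightarrow> l k) G" for k
    by (rule continuous_on_tendsto_compose[OF ev]) auto
  then show ?thesis using that[of G l] \<open>G \<noteq> bot\<close> by (simp add: G_def)
qed

section \<open>Dyadic rounding and the inverse limit of the dyadic grids\<close>

definition dyadic_floor :: "nat \<Rightarrow> 'a::euclidean_space \<Rightarrow> 'a" where
  "dyadic_floor n x = (\<Sum>b\<in>Basis. (of_int \<lfloor>2 ^ n * (x \<bullet> b)\<rfloor> / 2 ^ n) *\<^sub>R b)"

lemma dyadic_floor_inner: "b \<in> Basis \<Longrightarrow> dyadic_floor n x \<bullet> b = of_int \<lfloor>2 ^ n * (x \<bullet> b)\<rfloor> / 2 ^ n"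
  unfolding dyadic_floor_def by simp

text \<open>Each half-open cell of the finer grid lies in a single cell of the coarser one. Rounding
  to the nearest grid point would not be compatible between levels.\<close>

lemma dyadic_floor_dyadic_floor_Suc: "dyadic_floor n (dyadic_floor (Suc n) x) = dyadic_floor n x"
proof -
  have "\<lfloor>2 ^ n * (real_of_int \<lfloor>2 * 2 ^ n * t\<rfloor> / (2 * 2 ^ n))\<rfloor> = \<lfloor>2 ^ n * t\<rfloor>" for t :: real
  proof -
    have "2 ^ n * (of_int \<lfloor>2 * 2 ^ n * t\<rfloor> / (2 * 2 ^ n)) = real_of_int \<lfloor>2 * (2 ^ n * t)\<rfloor> / 2"
      by (simp add: mult.assoc)
    moreover have "\<lfloor>real_of_int \<lfloor>2 * (2 ^ n * t)\<rfloor> / 2\<rfloor> = \<lfloor>2 ^ n * t\<rfloor>"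
    proof -
      define s where "s = 2 ^ n * t"
      have "2 * \<lfloor>s\<rfloor> \<le> \<lfloor>2 * s\<rfloor>" "\<lfloor>2 * s\<rfloor> < 2 * \<lfloor>s\<rfloor> + 2" by linarith+
      then show ?thesis unfolding s_def[symmetric] by (intro floor_unique) linarith+
    qed
    ultimately show ?thesis by (simp only:)
  qed
  note fl = this
  show ?thesis
    by (rule euclidean_eqI) (simp only: dyadic_floor_inner power_Suc fl)
qed

lemma norm_diff_dyadic_floor: "norm (x - dyadic_floor n x) \<le> DIM('a) / 2 ^ n" for x :: "'a::euclidean_space"
proof -
  have "norm (x - dyadic_floor n x) \<le> (\<Sum>b\<in>Basis. \<bar>(x - dyadic_floor n x) \<bullet> b\<bar>)" by (rule norm_le_l1)
  also have "\<dots> \<le> (\<Sum>b\<in>(Basis::'a set). 1 / 2 ^ n)"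
  proof (rule sum_mono)
    fix b :: 'a assume b: "b \<in> Basis"
    have "\<bar>2 ^ n * (x \<bullet> b) - of_int \<lfloor>2 ^ n * (x \<bullet> b)\<rfloor>\<bar> \<le> 1" by linarith
    then have "\<bar>(2 ^ n * (x \<bullet> b) - of_int \<lfloor>2 ^ n * (x \<bullet> b)\<rfloor>) / 2 ^ n\<bar> \<le> 1 / 2 ^ n"
      by (simp add: divide_right_mono)
    then show "\<bar>(x - dyadic_floor n x) \<bullet> b\<bar> \<le> 1 / 2 ^ n"
      using b by (simp add: inner_diff_left dyadic_floor_inner diff_divide_distrib)
  qed
  finally show ?thesis by simp
qed

lemma measurable_dyadic_floor [measurable]: "dyadic_floor n \<in> borel_measurable borel"
  unfolding dyadic_floor_def[abs_def] by measurable

lemma countable_range_dyadic_floor: "countable (range (dyadic_floor n :: 'a::euclidean_space \<Rightarrow> 'a))"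
proof -
  have "range (dyadic_floor n :: 'a \<Rightarrow> 'a) \<subseteq>
      (\<lambda>f. \<Sum>b\<in>Basis. (of_int (f b) / 2 ^ n) *\<^sub>R b) ` (PiE Basis (\<lambda>_. UNIV :: int set))"
  proof safe
    fix x :: 'a
    show "dyadic_floor n x \<in> (\<lambda>f. \<Sum>b\<in>Basis. (of_int (f b) / 2 ^ n) *\<^sub>R b) ` (PiE Basis (\<lambda>_. UNIV :: int set))"
      by (rule image_eqI[where x="restrict (\<lambda>b. \<lfloor>2 ^ n * (x \<bullet> b)\<rfloor>) Basis"]) (auto simp: dyadic_floor_def)
  qed
  then show ?thesis
    by (rule countable_subset) (intro countable_image countable_PiE, auto)
qed

lemma finite_dyadic_floor_cball: "finite (dyadic_floor n ` cball (0::'a::euclidean_space) R)"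
proof -
  define J where "J = {\<lfloor>- (2 ^ n * R)\<rfloor>..\<lfloor>2 ^ n * R\<rfloor>}"
  have "dyadic_floor n ` cball (0::'a) R \<subseteq>
      (\<lambda>f. \<Sum>b\<in>Basis. (of_int (f b) / 2 ^ n) *\<^sub>R b) ` (PiE Basis (\<lambda>_. J))"
  proof safe
    fix x :: 'a assume x: "x \<in> cball 0 R"
    have "\<lfloor>2 ^ n * (x \<bullet> b)\<rfloor> \<in> J" if "b \<in> Basis" for b
    proof -
      have "\<bar>x \<bullet> b\<bar> \<le> R" using Basis_le_norm[OF that, of x] x by simp
      then show ?thesis unfolding J_def
      proof -
        have "2 ^ n * (x \<bullet> b) \<le> 2 ^ n * R" "2 ^ n * (- R) \<le> 2 ^ n * (x \<bullet> b)"
          using \<open>\<bar>x \<bullet> b\<bar> \<le> R\<close> by (intro mult_left_mono; simp add: abs_le_iff; linarith)+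
        then show "\<lfloor>2 ^ n * (x \<bullet> b)\<rfloor> \<in> {\<lfloor>- (2 ^ n * R)\<rfloor>..\<lfloor>2 ^ n * R\<rfloor>}" by (simp add: floor_mono)
      qed
    qed
    then show "dyadic_floor n x \<in> (\<lambda>f. \<Sum>b\<in>Basis. (of_int (f b) / 2 ^ n) *\<^sub>R b) ` (PiE Basis (\<lambda>_. J))"
      by (intro image_eqI[where x="restrict (\<lambda>b. \<lfloor>2 ^ n * (x \<bullet> b)\<rfloor>) Basis"]) (auto simp: dyadic_floor_def)
  qed
  then show ?thesis
    by (rule finite_subset) (intro finite_imageI finite_PiE, auto simp: J_def)
qed

lemma dyadic_floor_tendsto: "(\<lambda>n. dyadic_floor n x) \<longlonglongrightarrow> x" for x :: "'a::euclidean_space"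
proof -
  have "(\<lambda>n. dyadic_floor n x - x) \<longlonglongrightarrow> 0"
  proof (rule Lim_null_comparison)
    show "\<forall>\<^sub>F n in sequentially. norm (dyadic_floor n x - x) \<le> DIM('a) * (1 / 2) ^ n"
      using norm_diff_dyadic_floor[of x] by (simp add: norm_minus_commute power_divide)
    show "(\<lambda>n. DIM('a) * (1 / 2 :: real) ^ n) \<longlonglongrightarrow> 0"
      by (intro tendsto_mult_right_zero LIMSEQ_realpow_zero) auto
  qed
  then show ?thesis by (simp add: LIM_zero_iff)
qed

text \<open>Replacing \<open>x\<close> by \<open>dyadic_floor n x\<close> leaves countably many
  values of the first argument, and measurability in \<open>w\<close> is assumed for each of them.
  Continuity in \<open>x\<close> carries the result to the limit.\<close>

lemma caratheodory_measurable:
  fixes g :: "'a::euclidean_space \<Rightarrow> 'b \<Rightarrow> 'c::metric_space"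
  assumes meas: "\<And>x. g x \<in> borel_measurable N"
    and cont: "\<And>w. w \<in> space N \<Longrightarrow> continuous_on UNIV (\<lambda>x. g x w)"
  shows "(\<lambda>(x, w). g x w) \<in> borel_measurable (borel \<Otimes>\<^sub>M N)"
proof (rule borel_measurable_LIMSEQ_metric[where f="\<lambda>n (x, w). g (dyadic_floor n x) w"])
  fix n
  have "(\<lambda>p. g (dyadic_floor n (fst p)) (snd p)) \<in> borel_measurable (borel \<Otimes>\<^sub>M N)"
  proof (rule measurable_compose_countable'[where f="\<lambda>y p. g y (snd p)" and g="\<lambda>p. dyadic_floor n (fst p)" and I="range (dyadic_floor n)"])
    show "(\<lambda>p. g i (snd p)) \<in> borel_measurable (borel \<Otimes>\<^sub>M N)" for i
      using meas[of i] by measurable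
    show "(\<lambda>p. dyadic_floor n (fst p)) \<in> borel \<Otimes>\<^sub>M N \<rightarrow>\<^sub>M count_space (range (dyadic_floor n :: 'a \<Rightarrow> 'a))"
    proof (subst measurable_count_space_eq_countable[OF countable_range_dyadic_floor], safe)
      fix a :: 'a
      show "(\<lambda>p. dyadic_floor n (fst p)) -` {dyadic_floor n a} \<inter> space (borel \<Otimes>\<^sub>M N) \<in> sets (borel \<Otimes>\<^sub>M N)"
        by measurable
    qed auto
  qed (rule countable_range_dyadic_floor)
  then show "(\<lambda>(x, w). g (dyadic_floor n x) w) \<in> borel_measurable (borel \<Otimes>\<^sub>M N)"
    by (simp add: case_prod_beta)
next
  fix p :: "'a \<times> 'b" assume p: "p \<in> space (borel \<Otimes>\<^sub>M N)"
  obtain x w where xw: "p = (x, w)" by (cases p)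
  have "isCont (\<lambda>x. g x w) x"
    using cont[of w] p by (auto simp: xw space_pair_measure continuous_on_eq_continuous_at)
  then have "(\<lambda>n. g (dyadic_floor n x) w) \<longlonglongrightarrow> g x w"
    using dyadic_floor_tendsto by (rule isCont_tendsto_compose)
  then show "(\<lambda>n. case p of (x, w) \<Rightarrow> g (dyadic_floor n x) w) \<longlonglongrightarrow> (case p of (x, w) \<Rightarrow> g x w)"
    by (simp add: xw)
qed

text \<open>The inverse limit of the dyadic grids. Besides the codes
  \<open>\<lambda>n. dyadic_floor n x\<close> of points it contains, for example on the line,
  sequences that approach a dyadic point strictly from below, such as \<open>- 1 / 2 ^ n\<close>
  with limit 0. These additional elements make its bounded parts compact.\<close>

definition dyadic_seq :: "(nat \<Rightarrow> 'a::euclidean_space) set" where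
  "dyadic_seq = {z. \<forall>n. z n = dyadic_floor n (z (Suc n))}"

lemma dyadic_seqD: "z \<in> dyadic_seq \<Longrightarrow> dyadic_floor n (z (Suc n)) = z n"
  unfolding dyadic_seq_def by (drule CollectD, drule spec, erule sym)

lemma dyadic_floor_in_dyadic_seq: "(\<lambda>n. dyadic_floor n x) \<in> dyadic_seq"
  by (simp add: dyadic_seq_def dyadic_floor_dyadic_floor_Suc)

text \<open>Consecutive terms differ by at most \<open>DIM('a) / 2 ^ n\<close>. The factor
  \<open>1 - 1 / 2 ^ k\<close> keeps the partial geometric sum, without which the induction would
  not close.\<close>

lemma dyadic_seq_dist:
  fixes z :: "nat \<Rightarrow> 'a::euclidean_space"
  assumes "z \<in> dyadic_seq"
  shows "dist (z n) (z (n + k)) \<le> 2 * DIM('a) / 2 ^ n * (1 - 1 / 2 ^ k)"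
proof (induction k)
  case (Suc k)
  have "dist (z (n + k)) (z (n + Suc k)) \<le> DIM('a) / 2 ^ (n + k)"
    using norm_diff_dyadic_floor[of "z (n + Suc k)" "n + k"] dyadic_seqD[OF assms, of "n + k"]
    by (simp add: dist_norm norm_minus_commute)
  then have "dist (z n) (z (n + Suc k)) \<le> 2 * DIM('a) / 2 ^ n * (1 - 1 / 2 ^ k) + DIM('a) / 2 ^ (n + k)"
    using Suc.IH dist_triangle[of "z n" "z (n + Suc k)" "z (n + k)"] by linarith
  also have "\<dots> = 2 * DIM('a) / 2 ^ n * (1 - 1 / 2 ^ Suc k)"
    by (simp add: field_simps power_add)
  finally show ?case .
qed simp

lemma dyadic_seq_dist_le:
  fixes z :: "nat \<Rightarrow> 'a::euclidean_space"
  assumes "z \<in> dyadic_seq" "n \<le> k"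
  shows "dist (z n) (z k) \<le> 2 * DIM('a) / 2 ^ n"
proof -
  have "dist (z n) (z k) \<le> 2 * DIM('a) / 2 ^ n * (1 - 1 / 2 ^ (k - n))"
    using dyadic_seq_dist[OF assms(1), of n "k - n"] assms(2) by simp
  also have "\<dots> \<le> 2 * DIM('a) / 2 ^ n * 1" by (intro mult_left_mono) auto
  finally show ?thesis by simp
qed

lemma dyadic_seq_limit:
  fixes z :: "nat \<Rightarrow> 'a::euclidean_space"
  assumes z: "z \<in> dyadic_seq"
  shows "convergent z" "norm (lim z - z n) \<le> 2 * DIM('a) / 2 ^ n"
proof -
  have "Cauchy z"
  proof (rule metric_CauchyI)
    fix e :: real assume "e > 0"
    have "(\<lambda>n. 4 * DIM('a) * (1 / 2 :: real) ^ n) \<longlonglongrightarrow> 0"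
      by (intro tendsto_mult_right_zero LIMSEQ_realpow_zero) auto
    then have "eventually (\<lambda>n. 4 * DIM('a) * (1 / 2 :: real) ^ n < e) sequentially"
      using \<open>e > 0\<close> by (rule order_tendstoD)
    then obtain M where M: "4 * DIM('a) * (1 / 2 :: real) ^ M < e"
      by (auto simp: eventually_sequentially)
    have "dist (z m) (z n) < e" if "m \<ge> M" "n \<ge> M" for m n
      using dyadic_seq_dist_le[OF z that(1)] dyadic_seq_dist_le[OF z that(2)] M
        dist_triangle3[of "z m" "z n" "z M"] by (simp add: power_divide)
    then show "\<exists>M. \<forall>m\<ge>M. \<forall>n\<ge>M. dist (z m) (z n) < e" by blast
  qed
  then show c: "convergent z" by (simp add: Cauchy_convergent_iff)
  have "(\<lambda>k. norm (z k - z n)) \<longlonglongrightarrow> norm (lim z - z n)"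
    using c by (intro tendsto_intros) (simp add: convergent_LIMSEQ_iff)
  then show "norm (lim z - z n) \<le> 2 * DIM('a) / 2 ^ n"
    by (rule tendsto_upperbound)
      (use dyadic_seq_dist_le[OF z, of n] in \<open>auto simp: eventually_sequentially dist_norm norm_minus_commute intro!: exI[of _ n]\<close>)
qed

text \<open>A bounded family takes finitely many values at each level, so a limit along a
  subsequence is attained in each coordinate from some index on. Conditions on single coordinates
  therefore survive the limit, with the sets \<open>V j\<close> completely arbitrary.\<close>

lemma dyadic_seq_compact:
  fixes V :: "nat \<Rightarrow> 'a::euclidean_space set" and n :: "nat \<Rightarrow> nat"
  assumes ne: "\<And>k. \<exists>z\<in>dyadic_seq. norm (z 0) \<le> R \<and> (\<forall>j\<le>k. z (n j) \<in> V j)"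
  shows "\<exists>z\<in>dyadic_seq. \<forall>j. z (n j) \<in> V j"
proof -
  obtain z where z: "\<And>k. z k \<in> dyadic_seq" "\<And>k. norm (z k 0) \<le> R" "\<And>k j. j \<le> k \<Longrightarrow> z k (n j) \<in> V j"
    using ne by metis
  \<comment> \<open>The radius allows for the total drift of at most \<open>2 * DIM('a)\<close>
    between level 0 and any later level.\<close>
  define S where "S i = dyadic_floor i ` cball (0::'a) (R + 2 * DIM('a))" for i
  have S: "z k i \<in> S i" for k i
  proof -
    have "dist (z k 0) (z k (Suc i)) \<le> 2 * DIM('a)"
      using dyadic_seq_dist_le[OF z(1), of 0 "Suc i" k] by simp
    then have "norm (z k (Suc i)) \<le> R + 2 * DIM('a)"
      using z(2)[of k] norm_triangle_ineq2[of "z k (Suc i)" "z k 0"]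
      by (simp add: dist_norm norm_minus_commute)
    moreover have "z k i = dyadic_floor i (z k (Suc i))" using dyadic_seqD[OF z(1)[of k], of i] by (rule sym)
    ultimately show ?thesis unfolding S_def by auto
  qed
  have fin: "finite (S i)" for i unfolding S_def by (rule finite_dyadic_floor_cball)
  have "compactin (product_topology (\<lambda>_. euclidean) UNIV) (PiE UNIV S)"
    using fin by (subst compactin_PiE) (auto intro: finite_imp_compact)
  then have "compact (PiE UNIV S)"
    by (metis euclidean_product_topology compactin_euclidean_iff)
  then have "seq_compact (PiE UNIV S)" by (rule compact_imp_seq_compact)
  moreover have "\<forall>k. z k \<in> PiE UNIV S" using S by (auto simp: PiE_def extensional_def)
  ultimately obtain l r where l: "strict_mono r" "(z \<circ> r) \<longlonglongrightarrow> l"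
    unfolding seq_compact_def by metis
  have ev0: "isCont (\<lambda>f::nat \<Rightarrow> 'a. f i) l" for i
    using continuous_on_product_coordinates[of i, where 'b='a]
    unfolding continuous_on_eq_continuous_at[OF open_UNIV] by blast
  \<comment> \<open>Points of the finite set \<open>S i\<close> are isolated, so a convergent
    coordinate is eventually equal to its limit.\<close>
  have ev: "eventually (\<lambda>k. z (r k) i = l i) sequentially" for i
  proof -
    have "(\<lambda>k. z (r k) i) \<longlonglongrightarrow> l i"
      using isCont_tendsto_compose[OF ev0[of i] l(2)] by (simp add: o_def)
    moreover have "open (- (S i - {l i}))" "l i \<in> - (S i - {l i})"
      using fin[of i] by (auto simp del: Compl_Diff_eq intro!: open_Compl finite_imp_closed)
    ultimately have "eventually (\<lambda>k. z (r k) i \<in> - (S i - {l i})) sequentially"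
      by (metis topological_tendstoD)
    then show ?thesis by eventually_elim (use S in auto)
  qed
  have "l \<in> dyadic_seq"
  proof (unfold dyadic_seq_def, safe)
    fix i
    have "eventually (\<lambda>k. l i = dyadic_floor i (l (Suc i))) sequentially"
      using ev[of i] ev[of "Suc i"]
    proof eventually_elim
      case (elim k)
      then show ?case using dyadic_seqD[OF z(1)[of "r k"], of i] by simp
    qed
    then show "l i = dyadic_floor i (l (Suc i))" by simp
  qed
  moreover have "l (n j) \<in> V j" for j
  proof -
    have "eventually (\<lambda>k. l (n j) \<in> V j) sequentially"
      using ev[of "n j"] eventually_ge_at_top[of j]
    proof eventually_elim
      case (elim k)
      have "j \<le> r k" using elim(2) seq_suble[OF l(1), of k] by simp
      from z(3)[OF this] elim show ?case by simp
    qed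
    then show ?thesis by simp
  qed
  ultimately show ?thesis by blast
qed

text \<open>Limits of the measures of half-open cubes need not be countably additive. Encoding points by the
  sequence of their dyadic approximations turns cubes into cylinder sets with compact sections, where
  countable additivity is automatic.\<close>

lemma young_measure_compactness:
  fixes N :: "'b measure" and m :: "'i \<Rightarrow> ('a::euclidean_space \<times> 'b) measure"
  assumes F: "F \<noteq> bot" and N: "prob_space N"
    and m: "\<And>i. prob_space (m i)" "\<And>i. sets (m i) = sets (borel \<Otimes>\<^sub>M N)"
    and marg: "\<And>i. distr (m i) N snd = N"
    and tight: "\<And>e. e > 0 \<Longrightarrow> \<exists>R. \<forall>i. measure (m i) ({x. norm x > R} \<times> space N) \<le> e"
  obtains G \<mu> where "G \<le> F" "G \<noteq> bot" "prob_space \<mu>" "sets \<mu> = sets (borel \<Otimes>\<^sub>M N)"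
    "distr \<mu> N snd = N"
    "\<And>g B L. g \<in> borel_measurable (borel \<Otimes>\<^sub>M N) \<Longrightarrow>
       (\<And>x w. w \<in> space N \<Longrightarrow> \<bar>g (x, w)\<bar> \<le> B) \<Longrightarrow>
       (\<And>x y w. w \<in> space N \<Longrightarrow> \<bar>g (x, w) - g (y, w)\<bar> \<le> L * norm (x - y)) \<Longrightarrow>
       ((\<lambda>i. \<integral>p. g p \<partial>m i) \<longlongrightarrow> (\<integral>p. g p \<partial>\<mu>)) G"
proof -
  let ?S = "borel \<Otimes>\<^sub>M N :: ('a \<times> 'b) measure"
  interpret N: prob_space N by fact
  interpret m: prob_space "m i" for i by (rule m)
  have spS: "space ?S = UNIV \<times> space N" by (simp add: space_pair_measure)
  have spm: "space (m i) = UNIV \<times> space N" for i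
    using sets_eq_imp_space_eq[OF m(2)] spS by simp
  \<comment> \<open>The limit \<open>l\<close> is taken on all sets simultaneously. On measurable
    sets it inherits monotonicity and finite additivity, but in general not countable
    additivity.\<close>
  obtain G l where G: "G \<le> F" "G \<noteq> bot" and l: "\<And>A. ((\<lambda>i. measure (m i) A) \<longlongrightarrow> l A) G"
    using pointwise_convergent_subfilter[OF F, of "\<lambda>i. measure (m i)"] m.prob_le_1 by auto
  have l_nonneg: "0 \<le> l A" for A
    by (rule tendsto_lowerbound[OF l _ G(2)]) auto
  have l_mono: "l A \<le> l B" if "A \<subseteq> B" "B \<in> sets ?S" for A B
    by (rule tendsto_le[OF G(2) l l]) (use that m(2) in \<open>auto intro!: always_eventually m.finite_measure_mono\<close>)
  have l_eq: "l A = c" if "\<And>i. measure (m i) A = c" for A c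
    using l[of A] that G(2) by (simp add: tendsto_const_iff)
  have l_Un: "l (A \<union> B) = l A + l B" if "A \<inter> B = {}" "A \<in> sets ?S" "B \<in> sets ?S" for A B
  proof -
    have "((\<lambda>i. measure (m i) (A \<union> B)) \<longlongrightarrow> l A + l B) G"
      using tendsto_add[OF l[of A] l[of B]] that m(2) by (simp add: m.finite_measure_Union)
    then show ?thesis using l[of "A \<union> B"] G(2) tendsto_unique by blast
  qed
  \<comment> \<open>In the path variable nothing is lost in the limit: the common marginal makes
    \<open>l\<close> countably additive on these sets.\<close>
  have l_snd: "l (UNIV \<times> E) = measure N E" if E: "E \<in> sets N" for E
  proof (rule l_eq)
    fix i
    have "measure N E = measure (distr (m i) N snd) E" by (simp add: marg)
    also have "\<dots> = measure (m i) (snd -` E \<inter> space (m i))"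
      using E m(2)[of i] by (intro measure_distr) (auto cong: measurable_cong_sets)
    also have "snd -` E \<inter> space (m i) = UNIV \<times> E"
      using sets.sets_into_space[OF E] by (auto simp: spm)
    finally show "measure (m i) (UNIV \<times> E) = measure N E" by simp
  qed
  define \<Omega> where "\<Omega> = (dyadic_seq :: (nat \<Rightarrow> 'a) set) \<times> space N"
  \<comment> \<open>Cylinder sets: membership depends on one coordinate of the sequence and on the
    path variable. Below, \<open>e\<close> encodes a point by its approximations and
    \<open>pb\<close> pulls a set back along \<open>e\<close>.\<close>
  define C where "C n \<Gamma> = {p \<in> \<Omega>. (fst p n, snd p) \<in> \<Gamma>}" for n and \<Gamma> :: "('a \<times> 'b) set"
  define \<A> where "\<A> = {C n \<Gamma> | n \<Gamma>. \<Gamma> \<in> sets ?S}"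
  define e :: "'a \<times> 'b \<Rightarrow> (nat \<Rightarrow> 'a) \<times> 'b" where "e p = (\<lambda>n. dyadic_floor n (fst p), snd p)" for p
  define T where "T n = (\<lambda>p. (dyadic_floor n (fst p), snd p) :: 'a \<times> 'b)" for n
  have T [measurable]: "T n \<in> ?S \<rightarrow>\<^sub>M ?S" for n unfolding T_def by measurable
  define pb where "pb X = e -` X \<inter> space ?S" for X
  have pb_C: "pb (C n \<Gamma>) = T n -` \<Gamma> \<inter> space ?S" for n \<Gamma>
    by (auto simp: pb_def C_def e_def T_def \<Omega>_def dyadic_floor_in_dyadic_seq space_pair_measure)
  have pb_sets: "pb X \<in> sets ?S" if "X \<in> \<A>" for X
    using that T by (auto simp: \<A>_def pb_C intro!: measurable_sets)
  \<comment> \<open>A condition at level \<open>n\<close> is also one at level \<open>Suc n\<close>.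
    Two cylinders can therefore be written at a common level, which makes \<open>\<A>\<close> an
    algebra.\<close>
  have C_Suc: "C n \<Gamma> = C (Suc n) (T n -` \<Gamma> \<inter> space ?S)" for n \<Gamma>
    unfolding C_def T_def \<Omega>_def by (auto simp: space_pair_measure dyadic_seqD)
  have C_mono: "\<exists>\<Gamma>'\<in>sets ?S. C n \<Gamma> = C (n + k) \<Gamma>'" if "\<Gamma> \<in> sets ?S" for n k \<Gamma>
  proof (induction k)
    case (Suc k)
    then obtain \<Gamma>' where "\<Gamma>' \<in> sets ?S" "C n \<Gamma> = C (n + k) \<Gamma>'" by auto
    then show ?case using C_Suc[of "n + k" \<Gamma>'] T[of "n + k"] by (auto intro!: bexI[of _ "T (n + k) -` \<Gamma>' \<inter> space ?S"] measurable_sets)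
  qed (use that in auto)
  have two: "\<exists>n \<Gamma> \<Gamma>'. \<Gamma> \<in> sets ?S \<and> \<Gamma>' \<in> sets ?S \<and> X = C n \<Gamma> \<and> Y = C n \<Gamma>'"
    if XY: "X \<in> \<A>" "Y \<in> \<A>" for X Y
  proof -
    obtain i \<Gamma> j \<Gamma>' where X: "X = C i \<Gamma>" "\<Gamma> \<in> sets ?S" and Y: "Y = C j \<Gamma>'" "\<Gamma>' \<in> sets ?S"
      using XY unfolding \<A>_def by auto
    obtain \<Gamma>1 where 1: "\<Gamma>1 \<in> sets ?S" "X = C (i + j) \<Gamma>1" using C_mono[OF X(2), of i j] X(1) by auto
    obtain \<Gamma>2 where 2: "\<Gamma>2 \<in> sets ?S" "Y = C (i + j) \<Gamma>2"
      using C_mono[OF Y(2), of j i] Y(1) by (auto simp: add.commute)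
    show ?thesis using 1 2 by blast
  qed
  have alg: "algebra \<Omega> \<A>"
  proof (unfold algebra_iff_Un, intro conjI ballI)
    show "\<A> \<subseteq> Pow \<Omega>" by (auto simp: \<A>_def C_def)
    show "{} \<in> \<A>" unfolding \<A>_def by (auto intro!: exI[of _ "{}"] simp: C_def)
  next
    fix X assume "X \<in> \<A>"
    then obtain i \<Gamma> where X: "X = C i \<Gamma>" "\<Gamma> \<in> sets ?S" by (auto simp: \<A>_def)
    have "\<Omega> - X = C i (space ?S - \<Gamma>)" by (auto simp: X C_def \<Omega>_def space_pair_measure)
    then show "\<Omega> - X \<in> \<A>" unfolding \<A>_def using X(2) by blast
  next
    fix X Y assume "X \<in> \<A>" "Y \<in> \<A>"
    then obtain n \<Gamma> \<Gamma>' where *: "\<Gamma> \<in> sets ?S" "\<Gamma>' \<in> sets ?S" "X = C n \<Gamma>" "Y = C n \<Gamma>'"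
      using two by blast
    then have "X \<union> Y = C n (\<Gamma> \<union> \<Gamma>')" by (auto simp: C_def)
    then show "X \<union> Y \<in> \<A>" unfolding \<A>_def using * by blast
  qed
  interpret alg: algebra \<Omega> \<A> by (rule alg)
  have ring: "ring_of_sets \<Omega> \<A>" by unfold_locales
  define f where "f X = ennreal (l (pb X))" for X
  have "\<exists>\<rho>. (\<forall>X\<in>\<A>. \<rho> X = f X) \<and> measure_space \<Omega> (sigma_sets \<Omega> \<A>) \<rho>"
  proof (rule ring_of_sets.caratheodory_empty_continuous[OF ring])
    have "l {} = 0" by (rule l_eq) simp
    then show "positive \<A> f" by (simp add: positive_def f_def pb_def)
    show "additive \<A> f"
    proof (unfold additive_def, intro ballI impI)
      fix X Y assume XY: "X \<in> \<A>" "Y \<in> \<A>" "X \<inter> Y = {}"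
      have "pb (X \<union> Y) = pb X \<union> pb Y" "pb X \<inter> pb Y = {}"
        using XY(3) by (auto simp: pb_def)
      then show "f (X \<union> Y) = f X + f Y"
        using XY l_Un[of "pb X" "pb Y"] pb_sets l_nonneg by (simp add: f_def)
    qed
    show "f X \<noteq> \<infinity>" for X by (simp add: f_def)
    fix A :: "nat \<Rightarrow> ((nat \<Rightarrow> 'a) \<times> 'b) set"
    assume A: "range A \<subseteq> \<A>" "decseq A" "(\<Inter>i. A i) = {}"
    then have "\<forall>k. \<exists>n \<Gamma>. \<Gamma> \<in> sets ?S \<and> A k = C n \<Gamma>" unfolding \<A>_def by blast
    then obtain n \<Gamma> where \<Gamma>: "\<And>k. \<Gamma> k \<in> sets ?S" and AC: "\<And>k. A k = C (n k) (\<Gamma> k)"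
      by metis
    \<comment> \<open>Continuity at the empty set, the only missing condition for a finite additive
      set function to extend. Tightness disposes of mass \<open>r / 2\<close> outside a ball, and
      the path marginal of the remaining part shrinks to 0.\<close>
    have small: "\<exists>K. \<forall>k\<ge>K. l (pb (A k)) \<le> r" if "r > 0" for r :: real
    proof -
      obtain R where R: "\<And>i. measure (m i) ({x. norm x > R} \<times> space N) \<le> r / 2"
        using tight[of "r / 2"] \<open>r > 0\<close> by auto
      \<comment> \<open>The margin \<open>DIM('a)\<close> covers the rounding at level 0. The set
        \<open>E k\<close> below is the projection of the bounded part of \<open>A k\<close> to the
        paths; it is measurable without a projection theorem because coordinate \<open>n k\<close>
        takes countably many values only.\<close>
      define Z where "Z = {z \<in> dyadic_seq. norm (z 0 :: 'a) \<le> R + DIM('a)}"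
      define E where "E k = {w \<in> space N. \<exists>z\<in>Z. (z (n k), w) \<in> \<Gamma> k}" for k
      have E_eq: "E k = {w \<in> space N. \<exists>v\<in>{z (n k) | z. z \<in> Z}. (v, w) \<in> \<Gamma> k}" for k
        unfolding E_def by blast
      have cnt: "countable {z (n k) | z. z \<in> Z}" for k
        by (rule countable_subset[OF _ countable_range_dyadic_floor[of "n k"]]) (auto simp: Z_def dest!: dyadic_seqD[of _ "n k", symmetric])
      have E [measurable]: "E k \<in> sets N" for k
      proof -
        have "E k = (\<Union>v\<in>{z (n k) | z. z \<in> Z}. Pair v -` \<Gamma> k)"
          unfolding E_eq using sets.sets_into_space[OF \<Gamma>[of k]] by (auto simp: space_pair_measure)
        then show ?thesis using cnt[of k] sets_Pair1[OF \<Gamma>[of k]] by auto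
      qed
      have EA: "E k = {w \<in> space N. \<exists>z\<in>Z. (z, w) \<in> A k}" for k
        unfolding E_def AC C_def \<Omega>_def Z_def by auto
      have "decseq E"
        using A(2) unfolding decseq_def EA by blast
      \<comment> \<open>Over a path in all \<open>E k\<close> every \<open>A k\<close> contains a
        bounded sequence. Compactness of the sections would produce one sequence common to all
        \<open>A k\<close>, whose intersection is empty.\<close>
      moreover have "(\<Inter>k. E k) = {}"
      proof (rule ccontr)
        assume "(\<Inter>k. E k) \<noteq> {}"
        then obtain w where w: "w \<in> space N" "\<And>k. \<exists>z\<in>Z. (z, w) \<in> A k" by (auto simp: EA)
        have "\<exists>z\<in>dyadic_seq. \<forall>j. z (n j) \<in> {v. (v, w) \<in> \<Gamma> j}"
        proof (rule dyadic_seq_compact)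
          fix k
          obtain z where z: "z \<in> Z" "(z, w) \<in> A k" using w by blast
          have "(z, w) \<in> A j" if "j \<le> k" for j
            using A(2) z(2) that unfolding decseq_def by blast
          then show "\<exists>z\<in>dyadic_seq. norm (z 0) \<le> R + DIM('a) \<and> (\<forall>j\<le>k. z (n j) \<in> {v. (v, w) \<in> \<Gamma> j})"
            using z(1) unfolding Z_def AC C_def by auto
        qed
        then obtain z where "z \<in> dyadic_seq" "\<And>j. (z (n j), w) \<in> \<Gamma> j" by auto
        then have "(z, w) \<in> (\<Inter>i. A i)" using w(1) by (auto simp: AC C_def \<Omega>_def)
        with A(3) show False by simp
      qed
      ultimately have "(\<lambda>k. measure N (E k)) \<longlonglongrightarrow> measure N {}"
        using E by (metis N.finite_Lim_measure_decseq image_subsetI)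
      then have "eventually (\<lambda>k. measure N (E k) < r / 2) sequentially"
        using \<open>r > 0\<close> by (intro order_tendstoD) auto
      then obtain K where K: "\<And>k. k \<ge> K \<Longrightarrow> measure N (E k) < r / 2"
        by (auto simp: eventually_sequentially)
      have "l (pb (A k)) \<le> r" if "k \<ge> K" for k
      proof -
        have big: "{x::'a. norm x > R} \<times> space N \<in> sets ?S" by (intro pair_measureI) auto
        have lR: "l ({x. norm x > R} \<times> space N) \<le> r / 2"
          by (rule tendsto_upperbound[OF l _ G(2)]) (use R in auto)
        have "pb (A k) \<subseteq> {x. norm x > R} \<times> space N \<union> UNIV \<times> E k"
        proof
          fix p assume p: "p \<in> pb (A k)"
          obtain x w where xw: "p = (x, w)" by (cases p)
          have w: "w \<in> space N" and eA: "((\<lambda>n. dyadic_floor n x), w) \<in> A k"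
            using p by (auto simp: pb_def xw e_def space_pair_measure)
          show "p \<in> {x. norm x > R} \<times> space N \<union> UNIV \<times> E k"
          proof (cases "norm x > R")
            case False
            have "norm (dyadic_floor 0 x) \<le> R + DIM('a)"
              using False norm_diff_dyadic_floor[of x 0] norm_triangle_ineq2[of "dyadic_floor 0 x" x]
              by (simp add: norm_minus_commute)
            then have "(\<lambda>n. dyadic_floor n x) \<in> Z" by (simp add: Z_def dyadic_floor_in_dyadic_seq)
            then show ?thesis using w eA by (auto simp: xw EA)
          qed (use w xw in auto)
        qed
        then have "l (pb (A k)) \<le> l ({x. norm x > R} \<times> space N \<union> UNIV \<times> E k)"
          using big by (intro l_mono) auto
        also have "\<dots> = l ({x. norm x > R} \<times> space N - UNIV \<times> E k \<union> UNIV \<times> E k)"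
          by (rule arg_cong[where f=l]) auto
        also have "\<dots> = l ({x. norm x > R} \<times> space N - UNIV \<times> E k) + l (UNIV \<times> E k)"
          using big by (intro l_Un) auto
        also have "\<dots> \<le> l ({x. norm x > R} \<times> space N) + l (UNIV \<times> E k)"
          using big by (intro add_right_mono l_mono) auto
        also have "\<dots> \<le> r" using lR K[OF that] l_snd[OF E, of k] by simp
        finally show ?thesis .
      qed
      then show ?thesis by blast
    qed
    have "(\<lambda>k. l (pb (A k))) \<longlonglongrightarrow> 0"
    proof (rule LIMSEQ_I)
      fix r :: real assume "r > 0"
      then obtain K where "\<And>k. k \<ge> K \<Longrightarrow> l (pb (A k)) \<le> r / 2" using small[of "r / 2"] by auto
      then show "\<exists>K. \<forall>k\<ge>K. norm (l (pb (A k)) - 0) < r"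
        using \<open>r > 0\<close> l_nonneg by (intro exI[of _ K]) (force simp: abs_of_nonneg)
    qed
    then show "(\<lambda>i. f (A i)) \<longlonglongrightarrow> 0"
      unfolding f_def using tendsto_ennrealI[of _ 0] by fastforce
  qed
  then obtain \<rho>0 where \<rho>0: "\<And>X. X \<in> \<A> \<Longrightarrow> \<rho>0 X = f X" "measure_space \<Omega> (sigma_sets \<Omega> \<A>) \<rho>0" by blast
  define \<rho> where "\<rho> = measure_of \<Omega> \<A> \<rho>0"
  have Apow: "\<A> \<subseteq> Pow \<Omega>" by (auto simp: \<A>_def C_def)
  have sp\<rho>: "space \<rho> = \<Omega>" and sets\<rho>: "sets \<rho> = sigma_sets \<Omega> \<A>"
    unfolding \<rho>_def using Apow by auto
  have \<rho>: "emeasure \<rho> (C n \<Gamma>) = ennreal (l (T n -` \<Gamma> \<inter> space ?S))" if "\<Gamma> \<in> sets ?S" for n \<Gamma>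
  proof -
    have CA: "C n \<Gamma> \<in> \<A>" using that by (auto simp: \<A>_def)
    have "emeasure \<rho> (C n \<Gamma>) = \<rho>0 (C n \<Gamma>)"
      unfolding \<rho>_def using CA Apow \<rho>0(2) by (intro emeasure_measure_of) (auto simp: measure_space_def)
    then show ?thesis using \<rho>0(1)[OF CA] by (simp add: f_def pb_C)
  qed
  have C_sets: "C n \<Gamma> \<in> sets \<rho>" if "\<Gamma> \<in> sets ?S" for n \<Gamma>
    unfolding sets\<rho> using that by (auto simp: \<A>_def)
  define \<pi> where "\<pi> n = (\<lambda>p. (fst p n, snd p) :: 'a \<times> 'b)" for n :: nat
  have \<pi> [measurable]: "\<pi> n \<in> \<rho> \<rightarrow>\<^sub>M ?S" for n
  proof (rule measurableI)
    fix p assume "p \<in> space \<rho>" then show "\<pi> n p \<in> space ?S"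
      by (auto simp: sp\<rho> \<Omega>_def \<pi>_def space_pair_measure)
  next
    fix \<Gamma> assume "\<Gamma> \<in> sets ?S"
    then show "\<pi> n -` \<Gamma> \<inter> space \<rho> \<in> sets \<rho>"
      using C_sets[of \<Gamma> n] by (simp add: C_def \<pi>_def sp\<rho> vimage_def Int_def conj_commute)
  qed
  have "emeasure \<rho> \<Omega> = 1"
  proof -
    have "\<Omega> = C 0 (space ?S)" by (auto simp: C_def \<Omega>_def space_pair_measure)
    then have "emeasure \<rho> \<Omega> = ennreal (l (T 0 -` space ?S \<inter> space ?S))" using \<rho>[of "space ?S" 0] by simp
    also have "T 0 -` space ?S \<inter> space ?S = UNIV \<times> space N" by (auto simp: T_def space_pair_measure)
    also have "l \<dots> = 1" using l_snd[of "space N"] by (simp add: N.prob_space)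
    finally show ?thesis by simp
  qed
  then interpret \<rho>: prob_space \<rho> by (intro prob_spaceI) (simp add: sp\<rho>)
  \<comment> \<open>Decoding sends a sequence to its limit and identifies the additional elements of
    \<open>dyadic_seq\<close> with ordinary points. Sets can lose their limits under this
    identification, functions that are Lipschitz in \<open>x\<close> cannot.\<close>
  define dec where "dec p = (lim (fst p), snd p :: 'b)" for p :: "(nat \<Rightarrow> 'a) \<times> 'b"
  have snd_\<rho> [measurable]: "snd \<in> \<rho> \<rightarrow>\<^sub>M N"
    using measurable_compose[OF \<pi>[of 0] measurable_snd] by (simp add: \<pi>_def)
  have [measurable]: "(\<lambda>p. fst p n) \<in> borel_measurable \<rho>" for n
    using measurable_compose[OF \<pi>[of n] measurable_fst] by (simp add: \<pi>_def)
  have [measurable]: "(\<lambda>p. lim (fst p)) \<in> borel_measurable \<rho>"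
    by (rule borel_measurable_LIMSEQ_metric[where f="\<lambda>n p. fst p n"])
      (auto simp: sp\<rho> \<Omega>_def convergent_LIMSEQ_iff[symmetric] intro: dyadic_seq_limit(1))
  have dec [measurable]: "dec \<in> \<rho> \<rightarrow>\<^sub>M ?S" unfolding dec_def by measurable
  define \<mu> where "\<mu> = distr \<rho> ?S dec"
  have dec_dist: "norm (lim (fst p) - fst p n) \<le> 2 * DIM('a) / 2 ^ n" if "p \<in> space \<rho>" for p n
    using that dyadic_seq_limit(2)[of "fst p" n] by (auto simp: sp\<rho> \<Omega>_def)
  have "distr \<mu> N snd = distr \<rho> N snd"
    unfolding \<mu>_def by (subst distr_distr) (auto simp: comp_def dec_def)
  also have "\<dots> = N"
  proof (rule measure_eqI)
    fix E assume "E \<in> sets (distr \<rho> N snd)"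
    then have E: "E \<in> sets N" by simp
    then have UE: "UNIV \<times> E \<in> sets ?S" by auto
    have "emeasure (distr \<rho> N snd) E = emeasure \<rho> (snd -` E \<inter> space \<rho>)"
      using E by (intro emeasure_distr) auto
    also have "snd -` E \<inter> space \<rho> = C 0 (UNIV \<times> E)" by (auto simp: C_def sp\<rho>)
    also have "emeasure \<rho> \<dots> = ennreal (l (T 0 -` (UNIV \<times> E) \<inter> space ?S))" by (rule \<rho>[OF UE])
    also have "T 0 -` (UNIV \<times> E) \<inter> space ?S = UNIV \<times> E"
      using sets.sets_into_space[OF E] by (auto simp: T_def space_pair_measure)
    finally show "emeasure (distr \<rho> N snd) E = emeasure N E"
      using l_snd[OF E] by (simp add: N.emeasure_eq_measure)
  qed simp
  finally have marg_\<mu>: "distr \<mu> N snd = N" .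
  have conv: "((\<lambda>i. \<integral>p. g p \<partial>m i) \<longlongrightarrow> (\<integral>p. g p \<partial>\<mu>)) G"
    if g [measurable]: "g \<in> borel_measurable ?S" and B: "\<And>x w. w \<in> space N \<Longrightarrow> \<bar>g (x, w)\<bar> \<le> B"
      and L: "\<And>x y w. w \<in> space N \<Longrightarrow> \<bar>g (x, w) - g (y, w)\<bar> \<le> L * norm (x - y)" for g B L
  proof (rule tendsto_uniform_approx)
    fix r :: real assume "r > 0"
    have "(\<lambda>n. \<bar>L\<bar> * (2 * DIM('a)) * (1 / 2 :: real) ^ n) \<longlonglongrightarrow> 0"
      by (intro tendsto_mult_right_zero LIMSEQ_realpow_zero) auto
    then have "eventually (\<lambda>n. \<bar>L\<bar> * (2 * DIM('a)) * (1 / 2 :: real) ^ n < r) sequentially"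
      using \<open>r > 0\<close> by (rule order_tendstoD)
    then obtain n where n: "\<bar>L\<bar> * (2 * DIM('a)) * (1 / 2 :: real) ^ n < r"
      by (auto simp: eventually_sequentially)
    \<comment> \<open>Rounding a point and truncating a decoded sequence at level \<open>n\<close>
      both move it by at most \<open>2 * DIM('a) / 2 ^ n\<close>, so one bound serves for
      \<open>m i\<close> and for \<open>\<mu>\<close>.\<close>
    have close: "\<bar>g (x, w) - g (y, w)\<bar> \<le> r" if "w \<in> space N" "norm (x - y) \<le> 2 * DIM('a) / 2 ^ n" for x y w
    proof -
      have "\<bar>g (x, w) - g (y, w)\<bar> \<le> L * norm (x - y)" by (rule L[OF that(1)])
      also have "\<dots> \<le> \<bar>L\<bar> * norm (x - y)" by (intro mult_right_mono) auto
      also have "\<dots> \<le> \<bar>L\<bar> * (2 * DIM('a) / 2 ^ n)" by (intro mult_left_mono that) auto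
      also have "\<dots> \<le> r" using n by (simp add: power_divide)
      finally show ?thesis .
    qed
    have int: "integrable M h" if "prob_space M" "h \<in> borel_measurable M" "\<And>p. p \<in> space M \<Longrightarrow> \<bar>h p\<bar> \<le> B"
      for h :: "'z \<Rightarrow> real" and M
    proof -
      from that(1) interpret prob_space M .
      show ?thesis by (rule integrable_const_bound[of _ B]) (use that in auto)
    qed
    have diff: "\<bar>(\<integral>p. h p \<partial>M) - (\<integral>p. k p \<partial>M)\<bar> \<le> r"
      if "prob_space M" "integrable M h" "integrable M k" "\<And>p. p \<in> space M \<Longrightarrow> \<bar>h p - k p\<bar> \<le> r"
      for h k :: "'z \<Rightarrow> real" and M
    proof -
      from that(1) interpret prob_space M .
      have "\<bar>(\<integral>p. h p - k p \<partial>M)\<bar> \<le> (\<integral>p. \<bar>h p - k p\<bar> \<partial>M)" by (rule integral_abs_bound)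
      also have "\<dots> \<le> (\<integral>p. r \<partial>M)" using that by (intro integral_mono) auto
      finally show ?thesis using that by (simp add: prob_space)
    qed
    define \<mu>n where "\<mu>n = distr \<rho> ?S (\<pi> n)"
    have mm: "measurable (m i) X = measurable ?S X" for i and X :: "'z measure"
      by (rule measurable_cong_sets[OF m(2) refl])
    have Tm [measurable]: "T n \<in> m i \<rightarrow>\<^sub>M ?S" and gm [measurable]: "g \<in> borel_measurable (m i)" for i
      using T g unfolding mm by auto
    have gT: "(\<lambda>p. g (T n p)) \<in> borel_measurable (m i)" for i by measurable
    have g\<rho>: "(\<lambda>p. g (\<pi> n p)) \<in> borel_measurable \<rho>" "(\<lambda>p. g (dec p)) \<in> borel_measurable \<rho>"
      by measurable
    \<comment> \<open>At a fixed level \<open>n\<close> the construction of \<open>\<rho>\<close>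
      gives convergence on every measurable set, so no regularity of \<open>g\<close> in the path
      variable enters here.\<close>
    have "((\<lambda>i. \<integral>p. g p \<partial>distr (m i) ?S (T n)) \<longlongrightarrow> (\<integral>p. g p \<partial>\<mu>n)) G"
    proof (rule setwise_limit_integral[where M=\<mu>n and B=B])
      show "prob_space (distr (m i) ?S (T n))" for i by (intro m.prob_space_distr) measurable
      show "sets (distr (m i) ?S (T n)) = sets \<mu>n" for i by (simp add: \<mu>n_def)
      show "prob_space \<mu>n" unfolding \<mu>n_def by (intro \<rho>.prob_space_distr) measurable
      show "g \<in> borel_measurable \<mu>n" by (simp add: \<mu>n_def)
      show "\<bar>g p\<bar> \<le> B" if "p \<in> space \<mu>n" for p
        using that B by (auto simp: \<mu>n_def space_pair_measure)
      fix A assume "A \<in> sets \<mu>n"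
      then have A: "A \<in> sets ?S" by (simp add: \<mu>n_def)
      have "measure \<mu>n A = measure \<rho> (C n A)"
        unfolding \<mu>n_def using A
        by (subst measure_distr) (auto simp: C_def \<pi>_def sp\<rho> intro!: arg_cong[where f="measure \<rho>"])
      also have "\<dots> = l (T n -` A \<inter> space ?S)"
        using \<rho>[OF A, of n] l_nonneg by (simp add: measure_def)
      finally show "((\<lambda>i. measure (distr (m i) ?S (T n)) A) \<longlongrightarrow> measure \<mu>n A) G"
        using l[of "T n -` A \<inter> space ?S"] A by (simp add: measure_distr spm spS)
    qed
    moreover have "(\<integral>p. g p \<partial>distr (m i) ?S (T n)) = (\<integral>p. g (T n p) \<partial>m i)" for i
      by (rule integral_distr) auto
    moreover have "(\<integral>p. g p \<partial>\<mu>n) = (\<integral>p. g (\<pi> n p) \<partial>\<rho>)"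
      unfolding \<mu>n_def by (rule integral_distr) auto
    moreover have "(\<integral>p. g p \<partial>\<mu>) = (\<integral>p. g (dec p) \<partial>\<rho>)"
      unfolding \<mu>_def by (rule integral_distr) auto
    moreover have "\<bar>(\<integral>p. g p \<partial>m i) - (\<integral>p. g (T n p) \<partial>m i)\<bar> \<le> r" for i
    proof (intro diff int m)
      fix p assume p: "p \<in> space (m i)"
      obtain x w where xw: "p = (x, w)" by (cases p)
      have "norm (x - dyadic_floor n x) \<le> 2 * DIM('a) / 2 ^ n"
        using norm_diff_dyadic_floor[of x n] by (rule order_trans) (simp add: divide_right_mono)
      then show "\<bar>g p - g (T n p)\<bar> \<le> r" using p close[of w x "dyadic_floor n x"] by (auto simp: xw T_def spm)
    qed (use B gT in \<open>auto simp: spm T_def\<close>)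
    moreover have "\<bar>(\<integral>p. g (dec p) \<partial>\<rho>) - (\<integral>p. g (\<pi> n p) \<partial>\<rho>)\<bar> \<le> r"
    proof (intro diff int \<rho>.prob_space_axioms)
      fix p assume p: "p \<in> space \<rho>"
      then show "\<bar>g (dec p) - g (\<pi> n p)\<bar> \<le> r"
        using close[OF _ dec_dist[OF p, of n], of "snd p"] by (auto simp: dec_def \<pi>_def sp\<rho> \<Omega>_def)
    qed (use B g\<rho> in \<open>auto simp: sp\<rho> \<Omega>_def dec_def \<pi>_def\<close>)
    ultimately show "\<exists>b l'. (b \<longlongrightarrow> l') G \<and> (\<forall>i. \<bar>(\<integral>p. g p \<partial>m i) - b i\<bar> \<le> r) \<and> \<bar>(\<integral>p. g p \<partial>\<mu>) - l'\<bar> \<le> r"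
      by (intro exI[of _ "\<lambda>i. \<integral>p. g (T n p) \<partial>m i"] exI[of _ "\<integral>p. g (\<pi> n p) \<partial>\<rho>"]) simp
  qed
  show ?thesis
  proof (rule that[OF G])
    show "prob_space \<mu>" unfolding \<mu>_def by (intro \<rho>.prob_space_distr) measurable
    show "sets \<mu> = sets ?S" by (simp add: \<mu>_def)
  qed (fact marg_\<mu>, fact conv)
qed

section \<open>Occupation measures of a random flow\<close>

lemma (in prob_space) integrable_bounded_function:
  fixes f :: "'a \<Rightarrow> real"
  assumes "f \<in> borel_measurable M" "\<And>x. x \<in> space M \<Longrightarrow> \<bar>f x\<bar> \<le> B"
  shows "integrable M f"
  by (rule integrable_const_bound[of _ B]) (use assms in auto)

lemma (in prob_space) abs_integral_le_bound:
  fixes f :: "'a \<Rightarrow> real"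
  assumes "f \<in> borel_measurable M" "\<And>x. x \<in> space M \<Longrightarrow> \<bar>f x\<bar> \<le> B"
  shows "\<bar>\<integral>x. f x \<partial>M\<bar> \<le> B"
proof -
  have "\<bar>\<integral>x. f x \<partial>M\<bar> \<le> (\<integral>x. \<bar>f x\<bar> \<partial>M)" by (rule integral_abs_bound)
  also have "\<dots> \<le> (\<integral>x. B \<partial>M)"
    using integrable_bounded_function[OF assms] assms(2) by (intro integral_mono) auto
  finally show ?thesis by (simp add: prob_space)
qed

text \<open>Indicators of closed sets are limits of Lipschitz functions, closed sets generate the
  Borel sets, and rectangles generate the product. The test functions of
  \<open>young_measure_compactness\<close> thus determine a measure.\<close>

lemma measure_eqI_lipschitz_rectangles:
  fixes \<mu> \<nu> :: "('a::euclidean_space \<times> 'b) measure"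
  assumes \<mu>: "prob_space \<mu>" "sets \<mu> = sets (borel \<Otimes>\<^sub>M N)"
    and \<nu>: "prob_space \<nu>" "sets \<nu> = sets (borel \<Otimes>\<^sub>M N)"
    and eq: "\<And>f E L. E \<in> sets N \<Longrightarrow> (\<And>x. 0 \<le> f x \<and> f x \<le> 1) \<Longrightarrow> (\<And>x y. \<bar>f x - f y\<bar> \<le> L * norm (x - y)) \<Longrightarrow>
       (\<integral>(x, w). f x * indicator E w \<partial>\<mu>) = (\<integral>(x, w). f x * indicator E w \<partial>\<nu>)"
  shows "\<mu> = \<nu>"
proof -
  interpret \<mu>: prob_space \<mu> by fact
  interpret \<nu>: prob_space \<nu> by fact
  let ?S = "borel \<Otimes>\<^sub>M N :: ('a \<times> 'b) measure"
  have sp: "space \<mu> = UNIV \<times> space N" "space \<nu> = UNIV \<times> space N"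
    using sets_eq_imp_space_eq[OF \<mu>(2)] sets_eq_imp_space_eq[OF \<nu>(2)] by (auto simp: space_pair_measure)
  have closed: "measure \<mu> (A \<times> E) = measure \<nu> (A \<times> E)" if A: "closed A" and E [measurable]: "E \<in> sets N" for A E
  proof (cases "A = {}")
    case False
    \<comment> \<open>Ramps of slope \<open>k\<close>, decreasing to the indicator of
      \<open>A\<close> because the distance to a closed set is positive off the set. The empty set
      is treated apart since \<open>infdist x {}\<close> is 0.\<close>
    define f where "f k x = max 0 (1 - real k * infdist x A)" for k x
    have fb: "0 \<le> f k x \<and> f k x \<le> 1" for k x by (auto simp: f_def infdist_nonneg)
    have fl: "\<bar>f k x - f k y\<bar> \<le> real k * norm (x - y)" for k x y
    proof -
      have "\<bar>infdist x A - infdist y A\<bar> \<le> dist x y"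
        using infdist_triangle[of x A y] infdist_triangle[of y A x] by (simp add: dist_commute abs_le_iff)
      then have "\<bar>real k * infdist x A - real k * infdist y A\<bar> \<le> real k * norm (x - y)"
        by (metis abs_mult abs_of_nat dist_norm mult_left_mono of_nat_0_le_iff right_diff_distrib)
      then show ?thesis unfolding f_def by linarith
    qed
    have [measurable]: "f k \<in> borel_measurable borel" for k
      unfolding f_def[abs_def] by (intro borel_measurable_continuous_onI continuous_intros)
    have lim: "(\<lambda>k. \<integral>(x, w). f k x * indicator E w \<partial>M) \<longlonglongrightarrow> measure M (A \<times> E)"
      if "prob_space M" and S: "sets M = sets ?S" for M
    proof -
      from that(1) interpret M: prob_space M .
      have spM: "space M = UNIV \<times> space N" using sets_eq_imp_space_eq[OF S] by (simp add: space_pair_measure)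
      have mM: "measurable M X = measurable ?S X" for X :: "real measure"
        by (rule measurable_cong_sets[OF S refl])
      have AE: "A \<times> E \<in> sets M" using A S by auto
      have "(\<lambda>k. \<integral>p. (case p of (x, w) \<Rightarrow> f k x * indicator E w) \<partial>M) \<longlonglongrightarrow> (\<integral>p. indicator (A \<times> E) p \<partial>M)"
      proof (rule integral_dominated_convergence[where w="\<lambda>_. 1"])
        show "(\<lambda>p. case p of (x, w) \<Rightarrow> f k x * indicator E w) \<in> borel_measurable M" for k
          unfolding mM by measurable
        show "(\<lambda>p. indicator (A \<times> E) p :: real) \<in> borel_measurable M" using AE by simp
        show "AE p in M. (\<lambda>k. case p of (x, w) \<Rightarrow> f k x * indicator E w) \<longlonglongrightarrow> indicator (A \<times> E) p"
        proof (rule AE_I2)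
          fix p :: "'a \<times> 'b"
          obtain x w where p: "p = (x, w)" by (cases p)
          have "(\<lambda>k. f k x) \<longlonglongrightarrow> indicator A x"
          proof (cases "x \<in> A")
            case True
            then show ?thesis by (simp add: f_def)
          next
            case nA: False
            then have pos: "infdist x A > 0"
              using in_closed_iff_infdist_zero[OF A False] infdist_nonneg[of x A] by (metis less_eq_real_def)
            obtain K :: nat where K: "real K * infdist x A > 1" using reals_Archimedean3[OF pos] by blast
            have "f k x = 0" if "k \<ge> K" for k
            proof -
              have "real K * infdist x A \<le> real k * infdist x A" using that pos by (intro mult_right_mono) auto
              then show ?thesis using K by (simp add: f_def)
            qed
            then have "eventually (\<lambda>k. f k x = 0) sequentially" by (auto simp: eventually_sequentially)
            then show ?thesis using nA by (simp add: tendsto_eventually)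
          qed
          from tendsto_mult_right[OF this, of "indicator E w"]
          show "(\<lambda>k. case p of (x, w) \<Rightarrow> f k x * indicator E w) \<longlonglongrightarrow> indicator (A \<times> E) p"
            by (simp add: p indicator_times)
        qed
        show "AE p in M. norm (case p of (x, w) \<Rightarrow> f k x * indicator E w) \<le> 1" for k
          using fb by (auto simp: abs_mult indicator_def)
      qed simp
      then show ?thesis using AE by simp
    qed
    have "(\<lambda>k. \<integral>(x, w). f k x * indicator E w \<partial>\<mu>) = (\<lambda>k. \<integral>(x, w). f k x * indicator E w \<partial>\<nu>)"
      using eq[OF E fb fl] by auto
    then show ?thesis using lim[OF \<mu>] lim[OF \<nu>] LIMSEQ_unique by metis
  qed simp
  have rect: "measure \<mu> (A \<times> E) = measure \<nu> (A \<times> E)" if A: "A \<in> sets borel" and E: "E \<in> sets N" for A E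
  proof -
    have A': "A \<in> sigma_sets UNIV {S. closed S}"
      using A by (simp add: borel_eq_closed)
    have st: "Int_stable {S::'a set. closed S}" "{S::'a set. closed S} \<subseteq> Pow UNIV"
      by (auto simp: Int_stable_def)
    from st A' show ?thesis
    proof (induction rule: sigma_sets_induct_disjoint)
      case (compl A)
      then have A: "A \<in> sets borel" by (simp add: borel_eq_closed)
      have U: "measure \<mu> (UNIV \<times> E) = measure \<nu> (UNIV \<times> E)" using closed[of UNIV E] E by simp
      have "(UNIV - A) \<times> E = UNIV \<times> E - A \<times> E" by auto
      moreover have "UNIV \<times> E \<in> sets ?S" "A \<times> E \<in> sets ?S" using A E by auto
      ultimately show ?case using compl(2) U \<mu>(2) \<nu>(2)
        by (simp add: \<mu>.finite_measure_Diff \<nu>.finite_measure_Diff Sigma_mono)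
    next
      case (union A)
      then have A: "A i \<in> sets borel" for i by (auto simp: borel_eq_closed)
      have s: "range (\<lambda>i. A i \<times> E) \<subseteq> sets ?S" using A E by auto
      have d: "disjoint_family (\<lambda>i. A i \<times> E)" using union(1) by (auto simp: disjoint_family_on_def)
      have "(\<lambda>i. measure \<mu> (A i \<times> E)) sums measure \<mu> (\<Union>i. A i \<times> E)"
        using s d \<mu>(2) by (intro \<mu>.finite_measure_UNION) auto
      moreover have "(\<lambda>i. measure \<nu> (A i \<times> E)) sums measure \<nu> (\<Union>i. A i \<times> E)"
        using s d \<nu>(2) by (intro \<nu>.finite_measure_UNION) auto
      moreover have "(\<Union>i. A i) \<times> E = (\<Union>i. A i \<times> E)" by auto
      ultimately show ?case using union(3) by (simp add: sums_unique2)
    qed (auto intro!: closed E simp: Int_stable_def)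
  qed
  show ?thesis
  proof (rule measure_eqI_generator_eq[OF Int_stable_pair_measure_generator[of borel N] pair_measure_closed])
    show "emeasure \<mu> X = emeasure \<nu> X" if "X \<in> {a \<times> b |a b. a \<in> sets borel \<and> b \<in> sets N}" for X
      using that rect by (auto simp: \<mu>.emeasure_eq_measure \<nu>.emeasure_eq_measure)
    show "sets \<mu> = sigma_sets (space borel \<times> space N) {a \<times> b |a b. a \<in> sets borel \<and> b \<in> sets N}"
      "sets \<nu> = sigma_sets (space borel \<times> space N) {a \<times> b |a b. a \<in> sets borel \<and> b \<in> sets N}"
      using \<mu>(2) \<nu>(2) by (auto simp: sets_pair_measure)
    show "range (\<lambda>_::nat. UNIV \<times> space N) \<subseteq> {a \<times> b |a b. a \<in> sets (borel::'a measure) \<and> b \<in> sets N}"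
      by (auto intro!: exI[of _ UNIV] exI[of _ "space N"])
  qed auto
qed

text \<open>The windows \<open>{t..T + t}\<close> and \<open>{0..T}\<close> differ at most on
  \<open>{0..t}\<close> and \<open>{T..T + t}\<close>, even if they are disjoint. Each of these has
  length \<open>t\<close>, whence the factor 2.\<close>

lemma integral_translate_bound:
  fixes a :: "real \<Rightarrow> real"
  assumes [measurable]: "a \<in> borel_measurable borel" and B: "\<And>s. \<bar>a s\<bar> \<le> B" and t: "0 \<le> t" and T: "0 \<le> T"
  shows "\<bar>(LINT s:{0..T}|lborel. a (s + t)) - (LINT s:{0..T}|lborel. a s)\<bar> \<le> 2 * t * B"
proof -
  have B0: "0 \<le> B" using B[of 0] by linarith
  have int: "integrable lborel (\<lambda>s. indicator {u..v} s * a s)" for u v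
  proof (rule Bochner_Integration.integrable_bound)
    show "integrable lborel (\<lambda>s. B * indicator {u..v} s)"
      by (intro integrable_mult_right integrable_real_indicator) (auto simp: emeasure_lborel_Icc_eq)
    show "AE s in lborel. norm (indicator {u..v} s * a s) \<le> norm (B * indicator {u..v} s)"
      using B B0 by (auto simp: indicator_def)
  qed measurable
  have "(LINT s:{0..T}|lborel. a (s + t)) = (\<integral>s. indicator {0..T} s * a (s + t) \<partial>lborel)"
    by (simp add: set_lebesgue_integral_def)
  also have "\<dots> = (\<integral>s. indicator {t..T + t} (t + s) * a (t + s) \<partial>lborel)"
    by (intro Bochner_Integration.integral_cong) (auto simp: indicator_def add.commute)
  also have "\<dots> = (\<integral>s. indicator {t..T + t} s * a s \<partial>lborel)"
    using lborel_integral_real_affine[of 1 "\<lambda>s. indicator {t..T + t} s * a s" t] by simp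
  finally have eq: "(LINT s:{0..T}|lborel. a (s + t)) - (LINT s:{0..T}|lborel. a s)
      = (\<integral>s. indicator {t..T + t} s * a s - indicator {0..T} s * a s \<partial>lborel)"
    using int by (simp add: set_lebesgue_integral_def)
  have "\<bar>(LINT s:{0..T}|lborel. a (s + t)) - (LINT s:{0..T}|lborel. a s)\<bar>
      \<le> (\<integral>s. \<bar>indicator {t..T + t} s * a s - indicator {0..T} s * a s\<bar> \<partial>lborel)"
    unfolding eq by (rule integral_abs_bound)
  also have "\<dots> \<le> (\<integral>s. B * indicator {0..t} s + B * indicator {T..T + t} s \<partial>lborel)"
  proof (rule integral_mono)
    show "integrable lborel (\<lambda>s. \<bar>indicator {t..T + t} s * a s - indicator {0..T} s * a s\<bar>)"
      by (rule integrable_abs[OF Bochner_Integration.integrable_diff[OF int int]])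
    show "integrable lborel (\<lambda>s. B * indicator {0..t} s + B * indicator {T..T + t} s)"
      by (intro Bochner_Integration.integrable_add integrable_mult_right integrable_real_indicator) (auto simp: emeasure_lborel_Icc_eq)
    show "\<bar>indicator {t..T + t} s * a s - indicator {0..T} s * a s\<bar>
        \<le> B * indicator {0..t} s + B * indicator {T..T + t} s" for s
    proof -
      have "indicator {t..T + t} s * a s - indicator {0..T} s * a s
          = (indicator {t..T + t} s - indicator {0..T} s) * a s" by (simp add: left_diff_distrib)
      also have "\<bar>\<dots>\<bar> \<le> \<bar>indicator {t..T + t} s - indicator {0..T} s\<bar> * B"
        by (subst abs_mult) (intro mult_left_mono B, simp)
      also have "\<bar>indicator {t..T + t} s - indicator {0..T} s :: real\<bar> \<le> indicator {0..t} s + indicator {T..T + t} s"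
        using t T by (auto simp: indicator_def)
      finally show ?thesis using B0 by (simp add: mult_right_mono algebra_simps)
    qed
  qed
  also have "\<dots> = 2 * t * B"
    using t T by (subst Bochner_Integration.integral_add) (auto intro!: integrable_mult_right integrable_real_indicator simp: emeasure_lborel_Icc_eq)
  finally show ?thesis .
qed

text \<open>A skew product over stationary noise: \<open>N\<close> is the law of the past,
  \<open>P\<close> that of fresh noise, \<open>\<kappa>\<close> updates the past and
  \<open>\<Phi>\<close> moves the state. The clamp \<open>max 0 t\<close> extends the dynamics to
  all real times, so that joint measurability can be stated over \<open>borel\<close>. The
  assumption \<open>markov\<close> merges the cocycle property and the independence of fresh noise
  into the one identity that the averaging argument uses.\<close>

locale random_flow = N: prob_space N + P: prob_space P
  for N :: "'b measure" and P :: "'c measure" +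
  fixes \<kappa> :: "real \<Rightarrow> 'b \<times> 'c \<Rightarrow> 'b" and \<Phi> :: "real \<Rightarrow> 'b \<times> 'c \<Rightarrow> 'a::euclidean_space \<Rightarrow> 'a" and x0 :: 'a
  assumes base_measurable: "(\<lambda>(t, \<omega>). \<kappa> (max 0 t) \<omega>) \<in> borel \<Otimes>\<^sub>M (N \<Otimes>\<^sub>M P) \<rightarrow>\<^sub>M N"
    and flow_measurable: "(\<lambda>(t, \<omega>, x). \<Phi> (max 0 t) \<omega> x) \<in> borel \<Otimes>\<^sub>M ((N \<Otimes>\<^sub>M P) \<Otimes>\<^sub>M borel) \<rightarrow>\<^sub>M borel"
    and base_stationary: "\<And>t. 0 \<le> t \<Longrightarrow> distr (N \<Otimes>\<^sub>M P) N (\<kappa> t) = N"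
    and flow_lipschitz: "\<And>t. 0 \<le> t \<Longrightarrow>
      \<exists>K. \<forall>\<omega>\<in>space (N \<Otimes>\<^sub>M P). \<forall>x y. norm (\<Phi> t \<omega> x - \<Phi> t \<omega> y) \<le> K * norm (x - y)"
    and markov: "\<And>s t f. 0 \<le> s \<Longrightarrow> 0 \<le> t \<Longrightarrow> f \<in> borel_measurable (borel \<Otimes>\<^sub>M N) \<Longrightarrow> (\<And>p. \<bar>f p\<bar> \<le> 1) \<Longrightarrow>
      (\<integral>\<omega>. (\<integral>\<eta>. f (\<Phi> t (\<kappa> s \<omega>, \<eta>) (\<Phi> s \<omega> x0), \<kappa> t (\<kappa> s \<omega>, \<eta>)) \<partial>P) \<partial>(N \<Otimes>\<^sub>M P))
        = (\<integral>\<omega>. f (\<Phi> (s + t) \<omega> x0, \<kappa> (s + t) \<omega>) \<partial>(N \<Otimes>\<^sub>M P) :: real)"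
    and flow_tight: "\<And>e. e > 0 \<Longrightarrow>
      \<exists>R. \<forall>s\<ge>0. measure (N \<Otimes>\<^sub>M P) {\<omega> \<in> space (N \<Otimes>\<^sub>M P). norm (\<Phi> s \<omega> x0) > R} \<le> e"
begin

sublocale NP: pair_prob_space N P ..

section \<open>Transition steps, orbits and time averages\<close>

lemma measurable_base: "0 \<le> t \<Longrightarrow> \<kappa> t \<in> N \<Otimes>\<^sub>M P \<rightarrow>\<^sub>M N"
  using measurable_compose[OF measurable_Pair1'[of t borel "N \<Otimes>\<^sub>M P"] base_measurable] by simp

lemma measurable_flow: "0 \<le> t \<Longrightarrow> (\<lambda>(\<omega>, x). \<Phi> t \<omega> x) \<in> (N \<Otimes>\<^sub>M P) \<Otimes>\<^sub>M borel \<rightarrow>\<^sub>M borel"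
  using measurable_compose[OF measurable_Pair1'[of t borel "(N \<Otimes>\<^sub>M P) \<Otimes>\<^sub>M borel"] flow_measurable]
  by (simp add: split_beta')

definition step :: "real \<Rightarrow> ('a \<times> 'b) \<times> 'c \<Rightarrow> 'a \<times> 'b" where
  "step t = (\<lambda>((x, w), \<eta>). (\<Phi> t (w, \<eta>) x, \<kappa> t (w, \<eta>)))"

lemma measurable_step:
  assumes "0 \<le> t" shows "step t \<in> (borel \<Otimes>\<^sub>M N) \<Otimes>\<^sub>M P \<rightarrow>\<^sub>M borel \<Otimes>\<^sub>M N"
proof -
  note [measurable] = measurable_base[OF assms] measurable_flow[OF assms]
  have "(\<lambda>p. (\<lambda>(\<omega>, x). \<Phi> t \<omega> x) ((snd (fst p), snd p), fst (fst p))) \<in> (borel \<Otimes>\<^sub>M N) \<Otimes>\<^sub>M P \<rightarrow>\<^sub>M borel"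
    by measurable
  moreover have "(\<lambda>p. \<kappa> t (snd (fst p), snd p)) \<in> (borel \<Otimes>\<^sub>M N) \<Otimes>\<^sub>M P \<rightarrow>\<^sub>M N"
    by measurable
  ultimately show ?thesis
    unfolding step_def split_beta' by (auto intro!: measurable_Pair)
qed

definition orbit :: "real \<times> 'b \<times> 'c \<Rightarrow> 'a \<times> 'b" where
  "orbit = (\<lambda>(s, \<omega>). (\<Phi> (max 0 s) \<omega> x0, \<kappa> (max 0 s) \<omega>))"

lemma measurable_orbit: "orbit \<in> borel \<Otimes>\<^sub>M (N \<Otimes>\<^sub>M P) \<rightarrow>\<^sub>M borel \<Otimes>\<^sub>M N"
proof -
  note [measurable] = base_measurable flow_measurable
  have "(\<lambda>p. (\<lambda>(t, \<omega>, x). \<Phi> (max 0 t) \<omega> x) (fst p, snd p, x0)) \<in> borel \<Otimes>\<^sub>M (N \<Otimes>\<^sub>M P) \<rightarrow>\<^sub>M borel"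
    by (rule measurable_compose[OF _ flow_measurable]) measurable
  then show ?thesis
    using base_measurable unfolding orbit_def split_beta' by (auto intro!: measurable_Pair)
qed

text \<open>The bound \<open>max 1 T\<close> keeps the time interval nondegenerate, so this is a
  probability measure for every real \<open>T\<close>. For \<open>T \<ge> 1\<close> it is the plain
  time average of the laws along the orbit.\<close>

definition occupation :: "real \<Rightarrow> ('a \<times> 'b) measure" where
  "occupation T = distr (uniform_measure lborel {0..max 1 T} \<Otimes>\<^sub>M (N \<Otimes>\<^sub>M P)) (borel \<Otimes>\<^sub>M N) orbit"

lemma prob_space_uniform: "prob_space (uniform_measure lborel {0..max 1 T::real})"
  by (rule prob_space_uniform_measure) auto

lemma measurable_orbit_uniform:
  "orbit \<in> uniform_measure lborel {0..max 1 T::real} \<Otimes>\<^sub>M (N \<Otimes>\<^sub>M P) \<rightarrow>\<^sub>M borel \<Otimes>\<^sub>M N"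
  using measurable_orbit by (simp cong: measurable_cong_sets sets_pair_measure_cong)

lemma prob_space_occupation: "prob_space (occupation T)"
proof -
  interpret U: prob_space "uniform_measure lborel {0..max 1 T::real}" by (rule prob_space_uniform)
  interpret UN: pair_prob_space "uniform_measure lborel {0..max 1 T::real}" "N \<Otimes>\<^sub>M P" ..
  show ?thesis unfolding occupation_def by (rule UN.prob_space_distr[OF measurable_orbit_uniform])
qed

lemma sets_occupation: "sets (occupation T) = sets (borel \<Otimes>\<^sub>M N)"
  by (simp add: occupation_def)

lemma integral_occupation:
  fixes h :: "'a \<times> 'b \<Rightarrow> real"
  assumes h: "h \<in> borel_measurable (borel \<Otimes>\<^sub>M N)" and B: "\<And>p. p \<in> space (borel \<Otimes>\<^sub>M N) \<Longrightarrow> \<bar>h p\<bar> \<le> B"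
  shows "(\<integral>p. h p \<partial>occupation T) =
      (1 / max 1 T) * (LINT s:{0..max 1 T}|lborel. (\<integral>\<omega>. h (orbit (s, \<omega>)) \<partial>(N \<Otimes>\<^sub>M P)))"
    and "(\<lambda>s. \<integral>\<omega>. h (orbit (s, \<omega>)) \<partial>(N \<Otimes>\<^sub>M P)) \<in> borel_measurable borel"
    and "\<bar>\<integral>\<omega>. h (orbit (s, \<omega>)) \<partial>(N \<Otimes>\<^sub>M P)\<bar> \<le> B"
proof -
  let ?U = "uniform_measure lborel {0..max 1 T::real}"
  interpret U: prob_space ?U by (rule prob_space_uniform)
  interpret UN: pair_prob_space ?U "N \<Otimes>\<^sub>M P" ..
  note [measurable] = measurable_orbit measurable_orbit_uniform h
  have sp: "orbit (s, \<omega>) \<in> space (borel \<Otimes>\<^sub>M N)" if "\<omega> \<in> space (N \<Otimes>\<^sub>M P)" for s \<omega>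
    using that measurable_space[OF measurable_orbit, of "(s, \<omega>)"] by (simp add: space_pair_measure)
  have hm: "(\<lambda>p. h (orbit p)) \<in> borel_measurable (?U \<Otimes>\<^sub>M (N \<Otimes>\<^sub>M P))"
    by measurable
  have int: "integrable (?U \<Otimes>\<^sub>M (N \<Otimes>\<^sub>M P)) (\<lambda>p. h (orbit p))"
    by (rule UN.integrable_bounded_function[OF hm, of B]) (auto simp: space_pair_measure[of ?U] intro!: B sp)
  show am: "(\<lambda>s. \<integral>\<omega>. h (orbit (s, \<omega>)) \<partial>(N \<Otimes>\<^sub>M P)) \<in> borel_measurable borel"
    by measurable
  show "\<bar>\<integral>\<omega>. h (orbit (s, \<omega>)) \<partial>(N \<Otimes>\<^sub>M P)\<bar> \<le> B" for s
  proof (rule NP.abs_integral_le_bound)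
    show "(\<lambda>\<omega>. h (orbit (s, \<omega>))) \<in> borel_measurable (N \<Otimes>\<^sub>M P)"
      by measurable
  qed (use B sp in blast)
  have "(\<integral>p. h p \<partial>occupation T) = (\<integral>p. h (orbit p) \<partial>(?U \<Otimes>\<^sub>M (N \<Otimes>\<^sub>M P)))"
    unfolding occupation_def by (rule integral_distr) measurable
  also have "\<dots> = (\<integral>s. (\<integral>\<omega>. h (orbit (s, \<omega>)) \<partial>(N \<Otimes>\<^sub>M P)) \<partial>?U)"
    by (rule UN.integral_fst'[OF int, symmetric])
  also have "\<dots> = (\<integral>s. (indicator {0..max 1 T} s / max 1 T) *\<^sub>R (\<integral>\<omega>. h (orbit (s, \<omega>)) \<partial>(N \<Otimes>\<^sub>M P)) \<partial>lborel)"
  proof -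
    have "?U = density lborel (\<lambda>s. ennreal (indicator {0..max 1 T} s / max 1 T))"
      unfolding uniform_measure_def
      by (intro density_cong AE_I2) (auto simp: indicator_def divide_ennreal[symmetric] ennreal_1[symmetric] simp del: ennreal_1)
    then show ?thesis
      using am by (simp only:) (subst integral_density, auto)
  qed
  also have "\<dots> = (1 / max 1 T) * (LINT s:{0..max 1 T}|lborel. (\<integral>\<omega>. h (orbit (s, \<omega>)) \<partial>(N \<Otimes>\<^sub>M P)))"
    unfolding set_lebesgue_integral_def
    by (subst integral_mult_right_zero[symmetric]) (auto intro!: Bochner_Integration.integral_cong)
  finally show "(\<integral>p. h p \<partial>occupation T) = \<dots>" .
qed

lemma measure_occupation_le:
  assumes A: "A \<in> sets (borel \<Otimes>\<^sub>M N)"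
    and e: "\<And>s. 0 \<le> s \<Longrightarrow> measure (N \<Otimes>\<^sub>M P) {\<omega> \<in> space (N \<Otimes>\<^sub>M P). (\<Phi> s \<omega> x0, \<kappa> s \<omega>) \<in> A} \<le> e"
  shows "measure (occupation T) A \<le> e"
proof -
  interpret O: prob_space "occupation T" by (rule prob_space_occupation)
  note [measurable] = measurable_orbit A
  have "measure (occupation T) A = (\<integral>p. indicat_real A p \<partial>occupation T)"
    using A by (simp add: sets_occupation)
  also have "\<dots> = (1 / max 1 T) * (LINT s:{0..max 1 T}|lborel. (\<integral>\<omega>. indicat_real A (orbit (s, \<omega>)) \<partial>(N \<Otimes>\<^sub>M P)))"
    by (rule integral_occupation(1)[of _ 1]) (use A in \<open>auto simp: indicator_def\<close>)
  also have "\<dots> \<le> (1 / max 1 T) * (LINT s:{0..max 1 T}|lborel. e)"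
  proof (intro mult_left_mono set_integral_mono)
    note * = integral_occupation(2,3)[of "indicat_real A" 1]
    show "set_integrable lborel {0..max 1 T} (\<lambda>s. \<integral>\<omega>. indicat_real A (orbit (s, \<omega>)) \<partial>(N \<Otimes>\<^sub>M P))"
      unfolding set_integrable_def
    proof (rule Bochner_Integration.integrable_bound)
      show "integrable lborel (indicat_real {0..max 1 T})"
        by (intro integrable_real_indicator) (auto simp: emeasure_lborel_Icc_eq)
      show "(\<lambda>s. indicat_real {0..max 1 T} s *\<^sub>R (\<integral>\<omega>. indicat_real A (orbit (s, \<omega>)) \<partial>(N \<Otimes>\<^sub>M P))) \<in> borel_measurable lborel"
        using *(1) A by auto
      show "AE s in lborel. norm (indicat_real {0..max 1 T} s *\<^sub>R (\<integral>\<omega>. indicat_real A (orbit (s, \<omega>)) \<partial>(N \<Otimes>\<^sub>M P)))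
          \<le> norm (indicat_real {0..max 1 T} s)"
        using *(2) A by (auto simp: indicator_def)
    qed
    show "set_integrable lborel {0..max 1 T} (\<lambda>s. e)"
      unfolding set_integrable_def by (intro integrable_scaleR_left integrable_real_indicator) (auto simp: emeasure_lborel_Icc_eq)
    fix s :: real assume s: "s \<in> {0..max 1 T}"
    have "(\<integral>\<omega>. indicat_real A (orbit (s, \<omega>)) \<partial>(N \<Otimes>\<^sub>M P))
        = (\<integral>\<omega>. indicator {\<omega> \<in> space (N \<Otimes>\<^sub>M P). (\<Phi> s \<omega> x0, \<kappa> s \<omega>) \<in> A} \<omega> \<partial>(N \<Otimes>\<^sub>M P) :: real)"
      using s by (intro Bochner_Integration.integral_cong) (auto simp: orbit_def indicator_def)
    also have "\<dots> = measure (N \<Otimes>\<^sub>M P) {\<omega> \<in> space (N \<Otimes>\<^sub>M P). (\<Phi> s \<omega> x0, \<kappa> s \<omega>) \<in> A}"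
    proof -
      have "{\<omega> \<in> space (N \<Otimes>\<^sub>M P). (\<Phi> s \<omega> x0, \<kappa> s \<omega>) \<in> A} \<subseteq> space (N \<Otimes>\<^sub>M P)" by auto
      then show ?thesis by (simp add: Int_absorb2)
    qed
    also have "\<dots> \<le> e" using e[of s] s by simp
    finally show "(\<integral>\<omega>. indicat_real A (orbit (s, \<omega>)) \<partial>(N \<Otimes>\<^sub>M P)) \<le> e" .
  qed auto
  also have "\<dots> = e" by (simp add: set_lebesgue_integral_def)
  finally show ?thesis .
qed


text \<open>The dual action of the transition semigroup on measures.\<close>

definition average :: "real \<Rightarrow> ('a \<times> 'b) measure \<Rightarrow> ('a \<times> 'b) measure" where
  "average t M = distr (M \<Otimes>\<^sub>M P) (borel \<Otimes>\<^sub>M N) (step t)"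

lemma average:
  fixes h :: "'a \<times> 'b \<Rightarrow> real"
  assumes t: "0 \<le> t" and M: "prob_space M" "sets M = sets (borel \<Otimes>\<^sub>M N)"
  shows "prob_space (average t M)" "sets (average t M) = sets (borel \<Otimes>\<^sub>M N)"
    and "h \<in> borel_measurable (borel \<Otimes>\<^sub>M N) \<Longrightarrow> (\<And>p. p \<in> space (borel \<Otimes>\<^sub>M N) \<Longrightarrow> \<bar>h p\<bar> \<le> B) \<Longrightarrow>
      (\<integral>p. h p \<partial>average t M) = (\<integral>p. (\<integral>\<eta>. h (step t (p, \<eta>)) \<partial>P) \<partial>M)"
    and "\<Gamma> \<in> sets (borel \<Otimes>\<^sub>M N) \<Longrightarrow>
      emeasure (average t M) \<Gamma> = (\<integral>\<^sup>+p. (\<integral>\<^sup>+\<eta>. indicator \<Gamma> (step t (p, \<eta>)) \<partial>P) \<partial>M)"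
proof -
  interpret M: prob_space M by fact
  interpret MP: pair_prob_space M P ..
  have [measurable]: "step t \<in> M \<Otimes>\<^sub>M P \<rightarrow>\<^sub>M borel \<Otimes>\<^sub>M N"
    using measurable_step[OF t] M(2) by (simp cong: measurable_cong_sets sets_pair_measure_cong)
  have sp: "step t p \<in> space (borel \<Otimes>\<^sub>M N)" if "p \<in> space (M \<Otimes>\<^sub>M P)" for p
    using that measurable_space[of "step t" "M \<Otimes>\<^sub>M P" "borel \<Otimes>\<^sub>M N" p] by simp
  show "prob_space (average t M)" unfolding average_def by (rule MP.prob_space_distr) measurable
  show "sets (average t M) = sets (borel \<Otimes>\<^sub>M N)" by (simp add: average_def)
  {
    assume [measurable]: "h \<in> borel_measurable (borel \<Otimes>\<^sub>M N)" and B: "\<And>p. p \<in> space (borel \<Otimes>\<^sub>M N) \<Longrightarrow> \<bar>h p\<bar> \<le> B"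
    have "(\<integral>p. h p \<partial>average t M) = (\<integral>p. h (step t p) \<partial>(M \<Otimes>\<^sub>M P))"
      unfolding average_def by (rule integral_distr) measurable
    also have "\<dots> = (\<integral>p. (\<integral>\<eta>. h (step t (p, \<eta>)) \<partial>P) \<partial>M)"
      by (rule MP.integral_fst'[symmetric]) (rule MP.integrable_bounded_function[of _ B], use B sp in auto)
    finally show "(\<integral>p. h p \<partial>average t M) = (\<integral>p. (\<integral>\<eta>. h (step t (p, \<eta>)) \<partial>P) \<partial>M)" .
  }
  {
    assume [measurable]: "\<Gamma> \<in> sets (borel \<Otimes>\<^sub>M N)"
    have "emeasure (average t M) \<Gamma> = (\<integral>\<^sup>+p. indicator \<Gamma> p \<partial>average t M)"
      by (simp add: average_def)
    also have "\<dots> = (\<integral>\<^sup>+p. indicator \<Gamma> (step t p) \<partial>(M \<Otimes>\<^sub>M P))"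
      unfolding average_def by (rule nn_integral_distr) measurable
    also have "\<dots> = (\<integral>\<^sup>+p. (\<integral>\<^sup>+\<eta>. indicator \<Gamma> (step t (p, \<eta>)) \<partial>P) \<partial>M)"
      by (rule P.nn_integral_fst[symmetric]) measurable
    finally show "emeasure (average t M) \<Gamma> = \<dots>" .
  }
qed

lemma marginal_occupation: "distr (occupation T) N snd = N"
proof (rule measure_eqI)
  let ?U = "uniform_measure lborel {0..max 1 T::real}"
  interpret U: prob_space ?U by (rule prob_space_uniform)
  fix E assume "E \<in> sets (distr (occupation T) N snd)"
  then have E [measurable]: "E \<in> sets N" by simp
  note [measurable] = measurable_orbit_uniform
  have S: "snd \<in> occupation T \<rightarrow>\<^sub>M N"
    using sets_occupation by (simp cong: measurable_cong_sets)
  have "emeasure (distr (occupation T) N snd) E = (\<integral>\<^sup>+w. indicator E w \<partial>distr (occupation T) N snd)"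
    by simp
  also have "\<dots> = (\<integral>\<^sup>+p. indicator E (snd p) \<partial>occupation T)"
    by (rule nn_integral_distr[OF S]) simp
  also have "\<dots> = (\<integral>\<^sup>+p. indicator E (snd (orbit p)) \<partial>(?U \<Otimes>\<^sub>M (N \<Otimes>\<^sub>M P)))"
    unfolding occupation_def by (rule nn_integral_distr) measurable
  also have "\<dots> = (\<integral>\<^sup>+s. (\<integral>\<^sup>+\<omega>. indicator E (snd (orbit (s, \<omega>))) \<partial>(N \<Otimes>\<^sub>M P)) \<partial>?U)"
    by (rule NP.nn_integral_fst[symmetric]) measurable
  also have "\<dots> = (\<integral>\<^sup>+s. emeasure N E \<partial>?U)"
  proof (rule nn_integral_cong)
    fix s
    have m: "\<kappa> (max 0 s) \<in> N \<Otimes>\<^sub>M P \<rightarrow>\<^sub>M N" by (rule measurable_base) simp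
    have "(\<integral>\<^sup>+\<omega>. indicator E (snd (orbit (s, \<omega>))) \<partial>(N \<Otimes>\<^sub>M P)) = (\<integral>\<^sup>+\<omega>. indicator E (\<kappa> (max 0 s) \<omega>) \<partial>(N \<Otimes>\<^sub>M P))"
      by (simp add: orbit_def)
    also have "\<dots> = (\<integral>\<^sup>+w. indicator E w \<partial>distr (N \<Otimes>\<^sub>M P) N (\<kappa> (max 0 s)))"
      using m by (subst nn_integral_distr) auto
    also have "\<dots> = emeasure N E" by (simp add: base_stationary)
    finally show "(\<integral>\<^sup>+\<omega>. indicator E (snd (orbit (s, \<omega>))) \<partial>(N \<Otimes>\<^sub>M P)) = emeasure N E" .
  qed
  also have "\<dots> = emeasure N E" by (simp add: U.emeasure_space_1)
  finally show "emeasure (distr (occupation T) N snd) E = emeasure N E" .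
qed simp

text \<open>The Krylov-Bogoliubov estimate: by \<open>markov\<close> a step of length
  \<open>t\<close> shifts the averaging window by \<open>t\<close>, and this changes the average
  only through the two ends of the window.\<close>

lemma average_occupation:
  fixes h :: "'a \<times> 'b \<Rightarrow> real"
  assumes t: "0 \<le> t" and h: "h \<in> borel_measurable (borel \<Otimes>\<^sub>M N)" and B: "\<And>p. \<bar>h p\<bar> \<le> 1"
  shows "\<bar>(\<integral>p. (\<integral>\<eta>. h (step t (p, \<eta>)) \<partial>P) \<partial>occupation T) - (\<integral>p. h p \<partial>occupation T)\<bar> \<le> 2 * t / max 1 T"
proof -
  define a where "a s = (\<integral>\<omega>. h (orbit (s, \<omega>)) \<partial>(N \<Otimes>\<^sub>M P))" for s
  note ha = integral_occupation[OF h B]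
  have am [measurable]: "a \<in> borel_measurable borel" and aB: "\<bar>a s\<bar> \<le> 1" for s
    using ha(2,3) unfolding a_def[abs_def] by auto
  define q where "q p = (\<integral>\<eta>. h (step t (p, \<eta>)) \<partial>P)" for p
  note [measurable] = measurable_step[OF t] h
  have qm: "q \<in> borel_measurable (borel \<Otimes>\<^sub>M N)" unfolding q_def by measurable
  have qB: "\<bar>q p\<bar> \<le> 1" if "p \<in> space (borel \<Otimes>\<^sub>M N)" for p
    unfolding q_def by (rule P.abs_integral_le_bound) (use that B in measurable)
  have q: "(\<integral>\<omega>. q (orbit (s, \<omega>)) \<partial>(N \<Otimes>\<^sub>M P)) = a (s + t)" if "s \<ge> 0" for s
    using markov[OF that t h B] that t by (simp add: q_def a_def orbit_def step_def)
  have "(\<integral>p. q p \<partial>occupation T) = (1 / max 1 T) * (LINT s:{0..max 1 T}|lborel. (\<integral>\<omega>. q (orbit (s, \<omega>)) \<partial>(N \<Otimes>\<^sub>M P)))"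
    by (rule integral_occupation(1)[OF qm qB])
  also have "(LINT s:{0..max 1 T}|lborel. (\<integral>\<omega>. q (orbit (s, \<omega>)) \<partial>(N \<Otimes>\<^sub>M P))) = (LINT s:{0..max 1 T}|lborel. a (s + t))"
    by (rule set_lebesgue_integral_cong) (auto simp: q)
  finally have eq: "(\<integral>p. q p \<partial>occupation T) - (\<integral>p. h p \<partial>occupation T)
      = (1 / max 1 T) * ((LINT s:{0..max 1 T}|lborel. a (s + t)) - (LINT s:{0..max 1 T}|lborel. a s))"
    using ha(1)[of T] by (simp add: a_def right_diff_distrib)
  have "\<bar>(\<integral>p. q p \<partial>occupation T) - (\<integral>p. h p \<partial>occupation T)\<bar> \<le> (1 / max 1 T) * (2 * t * 1)"
    unfolding eq
    using integral_translate_bound[OF am aB t, of "max 1 T"]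
    by (subst abs_mult) (intro mult_mono, auto)
  then show ?thesis unfolding q_def by simp
qed

text \<open>The Krylov-Bogoliubov argument requires that the semigroup preserves the class of test
  functions. In place of the Feller property, the Lipschitz dependence of the flow on
  \<open>x\<close> ensures that it maps functions Lipschitz in \<open>x\<close> and measurable in
  the path to functions of the same kind.\<close>

lemma occupation_limit_invariant:
  assumes F: "F \<noteq> bot" "F \<le> at_top"
  obtains G \<mu> where "G \<le> F" "G \<noteq> bot" "prob_space \<mu>" "sets \<mu> = sets (borel \<Otimes>\<^sub>M N)" "distr \<mu> N snd = N"
    "\<And>t. 0 \<le> t \<Longrightarrow> average t \<mu> = \<mu>"
    "\<And>g B L. g \<in> borel_measurable (borel \<Otimes>\<^sub>M N) \<Longrightarrow>
       (\<And>x w. w \<in> space N \<Longrightarrow> \<bar>g (x, w)\<bar> \<le> B) \<Longrightarrow>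
       (\<And>x y w. w \<in> space N \<Longrightarrow> \<bar>g (x, w) - g (y, w)\<bar> \<le> L * norm (x - y)) \<Longrightarrow>
       ((\<lambda>T. \<integral>p. g p \<partial>occupation T) \<longlongrightarrow> (\<integral>p. g p \<partial>\<mu>)) G"
proof -
  have tight: "\<exists>R. \<forall>T. measure (occupation T) ({x. norm x > R} \<times> space N) \<le> e" if "e > 0" for e
  proof -
    obtain R where R: "\<And>s. s \<ge> 0 \<Longrightarrow> measure (N \<Otimes>\<^sub>M P) {\<omega> \<in> space (N \<Otimes>\<^sub>M P). norm (\<Phi> s \<omega> x0) > R} \<le> e"
      using flow_tight[OF \<open>e > 0\<close>] by blast
    have "measure (occupation T) ({x. norm x > R} \<times> space N) \<le> e" for T
    proof (rule measure_occupation_le)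
      show "{x. norm x > R} \<times> space N \<in> sets (borel \<Otimes>\<^sub>M N)" by (intro pair_measureI) auto
      fix s :: real assume s: "s \<ge> 0"
      have "{\<omega> \<in> space (N \<Otimes>\<^sub>M P). (\<Phi> s \<omega> x0, \<kappa> s \<omega>) \<in> {x. norm x > R} \<times> space N}
          = {\<omega> \<in> space (N \<Otimes>\<^sub>M P). norm (\<Phi> s \<omega> x0) > R}"
        using measurable_space[OF measurable_base[OF s]] by auto
      then show "measure (N \<Otimes>\<^sub>M P) {\<omega> \<in> space (N \<Otimes>\<^sub>M P). (\<Phi> s \<omega> x0, \<kappa> s \<omega>) \<in> {x. norm x > R} \<times> space N} \<le> e"
        using R[OF s] by simp
    qed
    then show ?thesis by blast
  qed
  obtain G \<mu> where G: "G \<le> F" "G \<noteq> bot" and \<mu>: "prob_space \<mu>" "sets \<mu> = sets (borel \<Otimes>\<^sub>M N)" "distr \<mu> N snd = N"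
    and lim: "\<And>g B L. g \<in> borel_measurable (borel \<Otimes>\<^sub>M N) \<Longrightarrow>
       (\<And>x w. w \<in> space N \<Longrightarrow> \<bar>g (x, w)\<bar> \<le> B) \<Longrightarrow>
       (\<And>x y w. w \<in> space N \<Longrightarrow> \<bar>g (x, w) - g (y, w)\<bar> \<le> L * norm (x - y)) \<Longrightarrow>
       ((\<lambda>T. \<integral>p. g p \<partial>occupation T) \<longlongrightarrow> (\<integral>p. g p \<partial>\<mu>)) G"
  proof (rule young_measure_compactness[OF F(1) N.prob_space_axioms prob_space_occupation sets_occupation marginal_occupation tight], assumption, goal_cases)
    case (1 G \<mu>)
    show ?case by (rule 1(1)[OF 1(2-6) 1(7)])
  qed
  have Gtop: "G \<le> at_top" using G(1) F(2) by simp
  have inv: "average t \<mu> = \<mu>" if t: "0 \<le> t" for t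
  proof (rule measure_eqI_lipschitz_rectangles[OF average(1,2)[OF t \<mu>(1,2)] \<mu>(1,2)])
    fix f :: "'a \<Rightarrow> real" and E L
    assume E [measurable]: "E \<in> sets N" and f: "\<And>x. 0 \<le> f x \<and> f x \<le> 1"
      and L: "\<And>x y. \<bar>f x - f y\<bar> \<le> L * norm (x - y)"
    define h where "h p = f (fst p) * indicator E (snd p)" for p :: "'a \<times> 'b"
    have "continuous_on UNIV f"
    proof (rule continuous_at_imp_continuous_on, rule ballI, unfold continuous_at_eps_delta, intro allI impI)
      fix x and e :: real assume "e > 0"
      show "\<exists>d>0. \<forall>x'. dist x' x < d \<longrightarrow> dist (f x') (f x) < e"
      proof (intro exI[of _ "e / (\<bar>L\<bar> + 1)"] conjI allI impI)
        fix x' assume "dist x' x < e / (\<bar>L\<bar> + 1)"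
        then have "(\<bar>L\<bar> + 1) * norm (x' - x) < e" by (simp add: dist_norm field_simps)
        moreover have "L * norm (x' - x) \<le> (\<bar>L\<bar> + 1) * norm (x' - x)" by (intro mult_right_mono) auto
        ultimately show "dist (f x') (f x) < e" using L[of x' x] by (simp add: dist_real_def)
      qed (use \<open>e > 0\<close> in auto)
    qed
    then have [measurable]: "f \<in> borel_measurable borel" by (rule borel_measurable_continuous_onI)
    have h [measurable]: "h \<in> borel_measurable (borel \<Otimes>\<^sub>M N)" unfolding h_def by measurable
    have hB: "\<bar>h p\<bar> \<le> 1" for p using f[of "fst p"] by (auto simp: h_def indicator_def)
    \<comment> \<open>A Euclidean space contains two distinct points, so a Lipschitz constant cannot
      be negative.\<close>
    have L0: "0 \<le> L"
    proof -
      obtain b :: 'a where "b \<in> Basis" using nonempty_Basis by blast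
      then show ?thesis using L[of b 0] by simp
    qed
    have hL: "\<bar>h (x, w) - h (y, w)\<bar> \<le> L * norm (x - y)" for x y w
      using L[of x y] L0 by (auto simp: h_def indicator_def)
    define q where "q p = (\<integral>\<eta>. h (step t (p, \<eta>)) \<partial>P)" for p
    note [measurable] = measurable_step[OF t]
    have qm: "q \<in> borel_measurable (borel \<Otimes>\<^sub>M N)" unfolding q_def by measurable
    have hs: "(\<lambda>\<eta>. h (step t (p, \<eta>))) \<in> borel_measurable P" if "p \<in> space (borel \<Otimes>\<^sub>M N)" for p
      using that by measurable
    have qB: "\<bar>q p\<bar> \<le> 1" if "p \<in> space (borel \<Otimes>\<^sub>M N)" for p
      unfolding q_def by (rule P.abs_integral_le_bound[OF hs[OF that] hB])
    obtain K where K: "\<And>\<omega> x y. \<omega> \<in> space (N \<Otimes>\<^sub>M P) \<Longrightarrow> norm (\<Phi> t \<omega> x - \<Phi> t \<omega> y) \<le> K * norm (x - y)"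
      using flow_lipschitz[OF t] by blast
    \<comment> \<open>Both arguments share the past \<open>w\<close> and the noise
      \<open>\<eta>\<close>, so their updated pasts coincide and only the states differ.
      Measurability of \<open>h\<close> in the path variable therefore suffices.\<close>
    have qL: "\<bar>q (x, w) - q (y, w)\<bar> \<le> (L * K) * norm (x - y)" if w: "w \<in> space N" for x y w
    proof -
      have sp: "(x, w) \<in> space (borel \<Otimes>\<^sub>M N)" "(y, w) \<in> space (borel \<Otimes>\<^sub>M N)"
        using w by (auto simp: space_pair_measure)
      have i: "integrable P (\<lambda>\<eta>. h (step t ((x, w), \<eta>)))" "integrable P (\<lambda>\<eta>. h (step t ((y, w), \<eta>)))"
        using P.integrable_bounded_function[OF hs[OF sp(1)] hB] P.integrable_bounded_function[OF hs[OF sp(2)] hB] by auto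
      have eq: "q (x, w) - q (y, w) = (\<integral>\<eta>. h (step t ((x, w), \<eta>)) - h (step t ((y, w), \<eta>)) \<partial>P)"
        using i by (simp add: q_def)
      show ?thesis unfolding eq
      proof (rule P.abs_integral_le_bound)
        show "(\<lambda>\<eta>. h (step t ((x, w), \<eta>)) - h (step t ((y, w), \<eta>))) \<in> borel_measurable P"
          using hs[OF sp(1)] hs[OF sp(2)] by simp
        fix \<eta> assume "\<eta> \<in> space P"
        then have "(w, \<eta>) \<in> space (N \<Otimes>\<^sub>M P)" using w by (simp add: space_pair_measure)
        then have "\<bar>h (step t ((x, w), \<eta>)) - h (step t ((y, w), \<eta>))\<bar> \<le> L * (K * norm (x - y))"
          unfolding step_def using hL[of "\<Phi> t (w, \<eta>) x" _ "\<Phi> t (w, \<eta>) y"] mult_left_mono[OF K L0]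
          by (fastforce intro: order_trans)
        then show "\<bar>h (step t ((x, w), \<eta>)) - h (step t ((y, w), \<eta>))\<bar> \<le> (L * K) * norm (x - y)"
          by (simp add: mult.assoc)
      qed
    qed
    have "((\<lambda>T. \<integral>p. q p \<partial>occupation T) \<longlongrightarrow> (\<integral>p. q p \<partial>\<mu>)) G"
      by (rule lim[OF qm _ qL, of 1]) (use qB in \<open>auto simp: space_pair_measure\<close>)
    moreover have "((\<lambda>T. \<integral>p. h p \<partial>occupation T) \<longlongrightarrow> (\<integral>p. h p \<partial>\<mu>)) G"
      by (rule lim[OF h hB hL])
    ultimately have "((\<lambda>T. (\<integral>p. q p \<partial>occupation T) - (\<integral>p. h p \<partial>occupation T)) \<longlongrightarrow> (\<integral>p. q p \<partial>\<mu>) - (\<integral>p. h p \<partial>\<mu>)) G"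
      by (rule tendsto_diff)
    moreover have "((\<lambda>T. (\<integral>p. q p \<partial>occupation T) - (\<integral>p. h p \<partial>occupation T)) \<longlongrightarrow> 0) G"
    proof (rule Lim_null_comparison)
      show "\<forall>\<^sub>F T in G. norm ((\<integral>p. q p \<partial>occupation T) - (\<integral>p. h p \<partial>occupation T)) \<le> 2 * t / max 1 T"
        using average_occupation[OF t h hB] by (auto simp: q_def)
      have "((\<lambda>T. 2 * t / T) \<longlongrightarrow> 0) at_top" by real_asymp
      then have "((\<lambda>T. 2 * t / max 1 T) \<longlongrightarrow> 0) at_top"
        by (rule Lim_transform_eventually) (use eventually_ge_at_top[of 1] in \<open>eventually_elim, simp add: max_def\<close>)
      then show "((\<lambda>T. 2 * t / max 1 T) \<longlongrightarrow> 0) G" using Gtop by (rule tendsto_mono[rotated])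
    qed
    ultimately have "(\<integral>p. q p \<partial>\<mu>) - (\<integral>p. h p \<partial>\<mu>) = 0"
      using G(2) tendsto_unique by blast
    moreover have "(\<integral>p. h p \<partial>average t \<mu>) = (\<integral>p. q p \<partial>\<mu>)"
      unfolding q_def by (rule average(3)[OF t \<mu>(1,2) h hB])
    ultimately show "(\<integral>(x, w). f x * indicator E w \<partial>average t \<mu>) = (\<integral>(x, w). f x * indicator E w \<partial>\<mu>)"
      by (simp add: h_def split_beta')
  qed
  show ?thesis by (rule that[OF G \<mu> inv lim])
qed

end

section \<open>The spaces of paths\<close>

lemma holder_normD:
  assumes "holder_norm h \<omega> \<le> ennreal C" "0 \<le> C" "s \<le> 0" "t \<le> 0"
  shows "norm (\<omega> t - \<omega> s) \<le> C * (sqrt (1 + \<bar>t\<bar> + \<bar>s\<bar>) * \<bar>t - s\<bar> powr ((1 - h) / 2))"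
proof (cases "s = t")
  case False
  have "ennreal (holder_quot h \<omega> (s, t)) \<le> holder_norm h \<omega>"
    unfolding holder_norm_def using assms(3,4) by (intro SUP_upper) auto
  then have "holder_quot h \<omega> (s, t) \<le> C"
    using assms(1,2) by (meson ennreal_le_iff order_trans)
  then show ?thesis
    using False by (simp add: holder_quot_def divide_le_eq mult_le_0_iff)
qed simp

lemma holder_normI:
  assumes "\<And>s t. s \<le> 0 \<Longrightarrow> t \<le> 0 \<Longrightarrow> s \<noteq> t \<Longrightarrow>
    norm (\<omega> t - \<omega> s) \<le> C * (sqrt (1 + \<bar>t\<bar> + \<bar>s\<bar>) * \<bar>t - s\<bar> powr ((1 - h) / 2))" "0 \<le> C"
  shows "holder_norm h \<omega> \<le> ennreal C"
  unfolding holder_norm_def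
proof (rule SUP_least)
  fix p :: "real \<times> real" assume p: "p \<in> {..0} \<times> {..0}"
  obtain s t where st: "p = (s, t)" by (cases p)
  show "ennreal (holder_quot h \<omega> p) \<le> ennreal C"
  proof (rule ennreal_leI, cases "s = t")
    case False
    then show "holder_quot h \<omega> p \<le> C"
      using assms(1)[of s t] p by (simp add: st holder_quot_def divide_le_eq mult_le_0_iff)
  qed (use assms(2) in \<open>simp add: st holder_quot_def\<close>)
qed

lemma BH_zero: "\<omega> \<in> BH h \<Longrightarrow> 0 \<le> t \<Longrightarrow> \<omega> t = 0"
  by (simp add: BH_def)

lemma BH_finite: "\<omega> \<in> BH h \<Longrightarrow> \<exists>C\<ge>0. holder_norm h \<omega> \<le> ennreal C"
  by (rule exI[of _ "enn2real (holder_norm h \<omega>)"]) (auto simp: BH_def)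

text \<open>Interpolation: the weight in the norm dominates \<open>\<bar>t - s\<bar> powr (1/2)\<close> both near and far from
  the diagonal.\<close>

lemma holder_norm_interpolation:
  fixes \<omega> :: "('d::finite) hpath"
  assumes h: "0 < h" "h < 1" and A: "0 \<le> A" and B: "0 \<le> B"
    and lip: "\<And>s t. s \<le> 0 \<Longrightarrow> t \<le> 0 \<Longrightarrow> norm (\<omega> t - \<omega> s) \<le> A * \<bar>t - s\<bar>"
    and osc: "\<And>s t. s \<le> 0 \<Longrightarrow> t \<le> 0 \<Longrightarrow> norm (\<omega> t - \<omega> s) \<le> B"
  shows "holder_norm h \<omega> \<le> ennreal (sqrt (A * B))"
proof (rule holder_normI)
  fix s t :: real assume st: "s \<le> 0" "t \<le> 0" "s \<noteq> t"
  define \<delta> where "\<delta> = \<bar>t - s\<bar>"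
  have \<delta>: "\<delta> > 0" "\<delta> \<le> \<bar>t\<bar> + \<bar>s\<bar>" using st by (auto simp: \<delta>_def)
  have "norm (\<omega> t - \<omega> s) ^ 2 \<le> (A * \<delta>) * B"
    unfolding power2_eq_square \<delta>_def
    using lip[OF st(1,2)] osc[OF st(1,2)] A by (intro mult_mono) auto
  then have "norm (\<omega> t - \<omega> s) \<le> sqrt (A * B * \<delta>)"
    by (intro real_le_rsqrt) (simp add: mult_ac)
  also have "\<dots> = sqrt (A * B) * sqrt \<delta>" by (simp add: real_sqrt_mult)
  also have "sqrt \<delta> \<le> sqrt (1 + \<bar>t\<bar> + \<bar>s\<bar>) * \<delta> powr ((1 - h) / 2)"
  proof (cases "\<delta> \<le> 1")
    case True
    have "sqrt \<delta> = \<delta> powr (1/2)" using \<delta> by (simp add: powr_half_sqrt)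
    also have "\<dots> \<le> \<delta> powr ((1 - h) / 2)"
      using True \<delta> h by (intro powr_mono') auto
    also have "\<dots> \<le> sqrt (1 + \<bar>t\<bar> + \<bar>s\<bar>) * \<delta> powr ((1 - h) / 2)"
      by (rule mult_le_cancel_right1[THEN iffD2]) auto
    finally show ?thesis .
  next
    case False
    have "sqrt \<delta> \<le> sqrt (1 + \<bar>t\<bar> + \<bar>s\<bar>)" using \<delta> by simp
    also have "\<dots> \<le> sqrt (1 + \<bar>t\<bar> + \<bar>s\<bar>) * \<delta> powr ((1 - h) / 2)"
      using False h by (intro mult_le_cancel_left1[THEN iffD2]) (auto intro!: ge_one_powr_ge_zero)
    finally show ?thesis .
  qed
  finally show "norm (\<omega> t - \<omega> s) \<le> sqrt (A * B) * (sqrt (1 + \<bar>t\<bar> + \<bar>s\<bar>) * \<bar>t - s\<bar> powr ((1 - h) / 2))"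
    using A B by (simp add: \<delta>_def mult_left_mono)
qed (use A B in simp)

section \<open>Smooth paths with compact support\<close>

lemma C0_infE:
  fixes f :: "('d::finite) hpath"
  assumes "f \<in> C0_inf"
  obtains g K where "0 < K" "\<And>t. t \<le> - K \<Longrightarrow> f t = 0" "\<And>t. 0 \<le> t \<Longrightarrow> f t = 0"
    "\<And>t. t \<le> 0 \<Longrightarrow> g 0 t = f t"
    "\<And>n t. t \<le> 0 \<Longrightarrow> (g n has_vector_derivative g (Suc n) t) (at t within {..0})"
proof -
  from assms obtain T g where T: "\<forall>t\<le>T. f t = 0" and z: "\<forall>t\<ge>0. f t = 0"
    and g: "\<forall>t\<le>0. g 0 t = f t" "\<forall>n. \<forall>t\<le>0. (g n has_vector_derivative g (Suc n) t) (at t within {..0})"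
    unfolding C0_inf_def by auto
  show ?thesis by (rule that[of "max 1 (- T)" g]) (use T z g in auto)
qed

text \<open>Each \<open>g n\<close> vanishes on the open set of times below \<open>- K\<close>,
  hence so does its derivative. The local argument does not cover \<open>- K\<close> itself, which
  explains the strict inequality.\<close>

lemma derivatives_vanish:
  fixes g :: "nat \<Rightarrow> real \<Rightarrow> 'a::real_normed_vector"
  assumes g: "\<And>n t. t \<le> 0 \<Longrightarrow> (g n has_vector_derivative g (Suc n) t) (at t within {..0})"
    and z: "\<And>t. t \<le> - K \<Longrightarrow> g 0 t = 0" and K: "0 < K" and t: "t < - K"
  shows "g n t = 0"
  using t
proof (induction n arbitrary: t)
  case (Suc n)
  have "((\<lambda>_. 0) has_vector_derivative 0) (at t within {..0})" by simp
  then have "(g n has_vector_derivative 0) (at t within {..0})"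
  proof (rule has_vector_derivative_transform_within[of _ _ _ _ "- K - t"])
    show "0 = g n x" if "x \<in> {..0}" "dist x t < - K - t" for x
    proof -
      have "x < - K" using that(2) by (simp add: dist_real_def abs_less_iff)
      then show ?thesis using Suc.IH by simp
    qed
  qed (use Suc.prems K in auto)
  moreover have "at t within {..0} \<noteq> bot"
    using Suc.prems K by (subst at_within_nhd[of _ "{..<0}" _ UNIV]) auto
  ultimately show ?case
    using g[of t n] Suc.prems K vector_derivative_unique_within by fastforce
qed (use z in auto)

lemma bounded_derivative_lipschitz:
  fixes g g' :: "real \<Rightarrow> 'a::real_normed_vector"
  assumes "\<And>t. t \<le> 0 \<Longrightarrow> (g has_vector_derivative g' t) (at t within {..0})"
    and "\<And>t. t \<le> 0 \<Longrightarrow> norm (g' t) \<le> L" "s \<le> 0" "t \<le> 0"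
  shows "norm (g t - g s) \<le> L * \<bar>t - s\<bar>"
proof -
  have "norm (g t - g s) \<le> L * norm (t - s)"
  proof (rule differentiable_bound[where S="{..0}" and f'="\<lambda>t x. x *\<^sub>R g' t"])
    show "(g has_derivative (\<lambda>x. x *\<^sub>R g' t)) (at t within {..0})" if "t \<in> {..0}" for t
      using assms(1)[of t] that by (simp add: has_vector_derivative_def)
    show "onorm (\<lambda>x. x *\<^sub>R g' t) \<le> L" if "t \<in> {..0}" for t
      using assms(2)[of t] that by (simp add: onorm_scaleR_left[OF bounded_linear_ident] onorm_id)
  qed (use assms in auto)
  then show ?thesis by simp
qed

lemma derivatives_bounded:
  fixes g :: "nat \<Rightarrow> real \<Rightarrow> 'a::real_normed_vector"
  assumes g: "\<And>n t. t \<le> 0 \<Longrightarrow> (g n has_vector_derivative g (Suc n) t) (at t within {..0})"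
    and z: "\<And>t. t \<le> - K \<Longrightarrow> g 0 t = 0" and K: "0 < K"
  obtains L where "0 < L" "\<And>t. t \<le> 0 \<Longrightarrow> norm (g n t) \<le> L"
proof -
  have "continuous_on {..0} (g n)"
    using g by (intro continuous_on_vector_derivative) auto
  then have "continuous_on {- K..0} (g n)" by (rule continuous_on_subset) auto
  then have "compact (g n ` {- K..0})" by (intro compact_continuous_image) auto
  then obtain L where L: "L > 0" "\<And>t. t \<in> {- K..0} \<Longrightarrow> norm (g n t) \<le> L"
    using compact_imp_bounded bounded_pos by (metis imageI)
  show ?thesis
  proof (rule that[OF L(1)])
    fix t :: real assume "t \<le> 0"
    then show "norm (g n t) \<le> L"
      using L derivatives_vanish[of g K t n] g z K by (cases "t < - K") auto
  qed
qed

text \<open>One natural number serves both as support bound and as Lipschitz constant. The smooth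
  paths thus fall into countably many classes, as separability will require.\<close>

lemma C0_inf_lipschitz:
  fixes f :: "('d::finite) hpath"
  assumes "f \<in> C0_inf"
  obtains m :: nat where "0 < m" "\<And>t. t \<le> - real m \<Longrightarrow> f t = 0"
    "\<And>s t. s \<le> 0 \<Longrightarrow> t \<le> 0 \<Longrightarrow> norm (f t - f s) \<le> real m * \<bar>t - s\<bar>"
proof -
  obtain g K where K: "0 < K" "\<And>t. t \<le> - K \<Longrightarrow> f t = 0" and g0: "\<And>t. t \<le> 0 \<Longrightarrow> g 0 t = f t"
    and g: "\<And>n t. t \<le> 0 \<Longrightarrow> (g n has_vector_derivative g (Suc n) t) (at t within {..0})"
    using C0_infE[OF assms] by metis
  have z: "g 0 t = 0" if "t \<le> - K" for t using that K g0[of t] by simp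
  obtain L where L: "0 < L" "\<And>t. t \<le> 0 \<Longrightarrow> norm (g 1 t) \<le> L"
    using derivatives_bounded[of g K 1] g z K(1) by auto
  obtain m :: nat where m: "real m \<ge> max K L" using real_arch_simple by blast
  show ?thesis
  proof (rule that[of m])
    show "0 < m" using m K by (auto intro!: Nat.gr0I)
    show "f t = 0" if "t \<le> - real m" for t using that m K by auto
    fix s t :: real assume st: "s \<le> 0" "t \<le> 0"
    have "norm (g 0 t - g 0 s) \<le> L * \<bar>t - s\<bar>"
      using bounded_derivative_lipschitz[of "g 0" "g 1" L s t] g[of _ 0] L st by simp
    also have "\<dots> \<le> real m * \<bar>t - s\<bar>" using m by (intro mult_right_mono) auto
    finally show "norm (f t - f s) \<le> real m * \<bar>t - s\<bar>" using g0 st by simp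
  qed
qed

lemma C0_inf_in_BH:
  assumes h: "0 < h" "h < 1" and f: "f \<in> C0_inf"
  shows "f \<in> BH h"
proof -
  obtain m :: nat where m: "0 < m" "\<And>t. t \<le> - real m \<Longrightarrow> f t = 0"
    "\<And>s t. s \<le> 0 \<Longrightarrow> t \<le> 0 \<Longrightarrow> norm (f t - f s) \<le> real m * \<bar>t - s\<bar>"
    using C0_inf_lipschitz[OF f] by metis
  have z: "f 0 = 0" using f by (simp add: C0_inf_def)
  \<comment> \<open>The path starts from 0 at time 0, has slope at most \<open>m\<close> and
    vanishes beyond time \<open>- m\<close>.\<close>
  have b: "norm (f t) \<le> real m * real m" if "t \<le> 0" for t
  proof (cases "t \<le> - real m")
    case False
    have "norm (f t) \<le> real m * \<bar>t\<bar>" using m(3)[of 0 t] that z by simp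
    also have "\<dots> \<le> real m * real m" using False that by (intro mult_left_mono) auto
    finally show ?thesis .
  qed (use m in auto)
  have "norm (f t - f s) \<le> 2 * (real m * real m)" if "s \<le> 0" "t \<le> 0" for s t
    using norm_triangle_ineq4[of "f t" "f s"] b[OF that(1)] b[OF that(2)] by linarith
  then have "holder_norm h f \<le> ennreal (sqrt (real m * (2 * (real m * real m))))"
    using m(3) h by (intro holder_norm_interpolation) auto
  then have fin: "holder_norm h f < \<infinity>" by (simp add: le_less_trans)
  have "holder_norm h (\<lambda>t. f t - f t) = 0"
    by (simp add: holder_norm_def holder_quot_def case_prod_beta zero_ennreal_def[symmetric])
  moreover have "f t = 0" if "0 \<le> t" for t using f that by (simp add: C0_inf_def)
  ultimately show ?thesis unfolding BH_def using f fin by (auto intro!: bexI[of _ f])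
qed

section \<open>Differences, limits and continuity of elements of \<open>BH h\<close>\<close>

lemma C0_inf_diff:
  assumes "f \<in> C0_inf" "g \<in> C0_inf"
  shows "(\<lambda>t. f t - g t) \<in> C0_inf"
proof -
  from assms obtain S a T b where *: "\<forall>t\<le>S. f t = 0" "\<forall>t\<ge>0. f t = 0" "\<forall>t\<ge>0. g t = 0" "\<forall>t\<le>T. g t = 0"
     "\<forall>t\<le>0. a 0 t = f t" "\<forall>n. \<forall>t\<le>0. (a n has_vector_derivative a (Suc n) t) (at t within {..0})"
     "\<forall>t\<le>0. b 0 t = g t" "\<forall>n. \<forall>t\<le>0. (b n has_vector_derivative b (Suc n) t) (at t within {..0})"
    unfolding C0_inf_def by auto
  then show ?thesis unfolding C0_inf_def
    by (auto intro!: exI[of _ "min S T"] exI[of _ "\<lambda>n t. a n t - b n t"] has_vector_derivative_diff)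
qed

lemma holder_norm_diff: "holder_norm h (\<lambda>t. \<omega> t - \<eta> t) \<le> holder_norm h \<omega> + holder_norm h \<eta>"
  using holder_norm_triangle[of h \<omega> "\<lambda>t. - \<eta> t"] by (simp add: holder_norm_minus)

lemma holder_norm_commute: "holder_norm h (\<lambda>t. \<omega> t - \<eta> t) = holder_norm h (\<lambda>t. \<eta> t - \<omega> t)"
  using holder_norm_minus[of h "\<lambda>t. \<omega> t - \<eta> t"] by simp

lemma BH_diff:
  assumes "\<omega> \<in> BH h" "\<eta> \<in> BH h"
  shows "(\<lambda>t. \<omega> t - \<eta> t) \<in> BH h"
  unfolding BH_def
proof (intro CollectI conjI allI impI)
  show "\<omega> t - \<eta> t = 0" if "0 \<le> t" for t using that assms by (simp add: BH_zero)
  show "holder_norm h (\<lambda>t. \<omega> t - \<eta> t) < \<infinity>"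
    using holder_norm_diff[of h \<omega> \<eta>] assms by (auto simp: BH_def intro: le_less_trans)
  fix e :: ennreal assume "e > 0"
  then have e2: "e / 2 > 0" by (simp add: ennreal_zero_less_divide)
  obtain f g where f: "f \<in> C0_inf" "holder_norm h (\<lambda>t. \<omega> t - f t) < e / 2"
    and g: "g \<in> C0_inf" "holder_norm h (\<lambda>t. \<eta> t - g t) < e / 2"
    using assms e2 unfolding BH_def by blast
  have "holder_norm h (\<lambda>t. (\<omega> t - \<eta> t) - (f t - g t)) = holder_norm h (\<lambda>t. (\<omega> t - f t) - (\<eta> t - g t))"
    by (rule arg_cong[where f="holder_norm h"]) (auto simp: algebra_simps)
  also have "\<dots> \<le> holder_norm h (\<lambda>t. \<omega> t - f t) + holder_norm h (\<lambda>t. \<eta> t - g t)"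
    by (rule holder_norm_diff)
  also have "\<dots> < e / 2 + e / 2" using f(2) g(2) by (rule add_strict_mono)
  also have "\<dots> = (e * 2) / 2" by (simp only: add_divide_distrib_ennreal[symmetric] mult_2_right)
  also have "\<dots> = e" by (rule mult_divide_eq_ennreal) auto
  finally show "\<exists>f\<in>C0_inf. holder_norm h (\<lambda>t. \<omega> t - \<eta> t - f t) < e"
    using C0_inf_diff[OF f(1) g(1)] by (rule bexI)
qed

lemma zero_in_BH: "(\<lambda>_. 0 :: real ^ 'd::finite) \<in> BH h"
proof -
  have "(\<lambda>_. 0 :: real ^ 'd) \<in> C0_inf"
    by (auto simp: C0_inf_def intro!: exI[of _ "\<lambda>_ _. 0"])
  moreover have "holder_norm h (\<lambda>_. 0 :: real ^ 'd) = 0"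
    by (simp add: holder_norm_def holder_quot_def case_prod_beta zero_ennreal_def[symmetric])
  ultimately show ?thesis unfolding BH_def by (auto intro!: bexI[of _ "\<lambda>_. 0"])
qed

text \<open>Membership in \<open>BH h\<close> means approximability by \<open>C0_inf\<close>; two
  approximations, each with half the error, are chained.\<close>

lemma BH_closed:
  assumes z: "\<And>t. 0 \<le> t \<Longrightarrow> \<omega> t = 0"
    and lim: "\<And>e. e > 0 \<Longrightarrow> \<exists>\<eta>\<in>BH h. holder_norm h (\<lambda>t. \<omega> t - \<eta> t) < ennreal e"
  shows "\<omega> \<in> BH h"
  unfolding BH_def
proof (intro CollectI conjI allI impI z)
  have tri: "holder_norm h (\<lambda>t. \<omega> t - f t) \<le> holder_norm h (\<lambda>t. \<omega> t - \<eta> t) + holder_norm h (\<lambda>t. \<eta> t - f t)" for f \<eta>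
    using holder_norm_triangle[of h "\<lambda>t. \<omega> t - \<eta> t" "\<lambda>t. \<eta> t - f t"] by simp
  obtain \<eta> where \<eta>: "\<eta> \<in> BH h" "holder_norm h (\<lambda>t. \<omega> t - \<eta> t) < ennreal 1" using lim[of 1] by auto
  have "holder_norm h \<omega> \<le> holder_norm h (\<lambda>t. \<omega> t - \<eta> t) + holder_norm h \<eta>"
    using tri[of "\<lambda>_. 0" \<eta>] by simp
  also have "\<dots> < \<infinity>" using \<eta> by (auto simp: BH_def intro: less_trans)
  finally show "holder_norm h \<omega> < \<infinity>" .
  fix e :: ennreal assume "e > 0"
  then obtain r where r: "r > 0" "ennreal r < e"
    by (metis ennreal_0 ennreal_less_iff dense ennreal_cases less_top_ennreal not_gr_zero order_less_irrefl order_less_trans zero_less_iff_neq_zero ennreal_eq_0_iff linorder_not_le)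
  obtain \<eta> where \<eta>: "\<eta> \<in> BH h" "holder_norm h (\<lambda>t. \<omega> t - \<eta> t) < ennreal (r / 2)" using lim[of "r / 2"] r by auto
  have "ennreal (r / 2) > 0" using r by simp
  then obtain f where f: "f \<in> C0_inf" "holder_norm h (\<lambda>t. \<eta> t - f t) < ennreal (r / 2)"
    using \<eta>(1) unfolding BH_def by blast
  have "holder_norm h (\<lambda>t. \<omega> t - f t) \<le> holder_norm h (\<lambda>t. \<omega> t - \<eta> t) + holder_norm h (\<lambda>t. \<eta> t - f t)" by (rule tri)
  also have "\<dots> < ennreal (r / 2) + ennreal (r / 2)" by (rule add_strict_mono[OF \<eta>(2) f(2)])
  also have "\<dots> = ennreal r" using r by (simp flip: ennreal_plus)
  finally show "\<exists>f\<in>C0_inf. holder_norm h (\<lambda>t. \<omega> t - f t) < e" using f(1) r(2) by (meson less_trans)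
qed

lemma BH_approx:
  assumes "\<omega> \<in> BH h" "e > 0"
  obtains f where "f \<in> C0_inf" "holder_norm h (\<lambda>t. \<omega> t - f t) < ennreal e"
proof -
  have "ennreal e > 0" using assms(2) by simp
  then have "\<exists>f\<in>C0_inf. holder_norm h (\<lambda>t. \<omega> t - f t) < ennreal e"
    using assms(1) unfolding BH_def by simp
  then show ?thesis using that by blast
qed

lemma BH_continuous:
  assumes h: "h < 1" and \<omega>: "\<omega> \<in> BH h"
  shows "continuous_on UNIV \<omega>"
proof -
  have z: "\<omega> t = 0" if "0 \<le> t" for t using BH_zero[OF \<omega> that] .
  have "continuous_on {..0} \<omega>"
  proof (rule continuous_on_sequentiallyI)
    fix u :: "nat \<Rightarrow> real" and a assume ua: "\<forall>n. u n \<in> {..0}" "a \<in> {..0}" "u \<longlonglongrightarrow> a"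
    obtain C where C: "C \<ge> 0" "holder_norm h \<omega> \<le> ennreal C" using BH_finite[OF \<omega>] by auto
    have "(\<lambda>n. C * (sqrt (1 + \<bar>u n\<bar> + \<bar>a\<bar>) * \<bar>u n - a\<bar> powr ((1 - h) / 2))) \<longlonglongrightarrow>
        C * (sqrt (1 + \<bar>a\<bar> + \<bar>a\<bar>) * \<bar>a - a\<bar> powr ((1 - h) / 2))"
      using h by (intro tendsto_intros tendsto_powr' ua) (auto simp: tendsto_rabs)
    then have "(\<lambda>n. C * (sqrt (1 + \<bar>u n\<bar> + \<bar>a\<bar>) * \<bar>u n - a\<bar> powr ((1 - h) / 2))) \<longlonglongrightarrow> 0" by simp
    then have "(\<lambda>n. \<omega> (u n) - \<omega> a) \<longlonglongrightarrow> 0"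
      by (rule Lim_null_comparison[rotated]) (use ua holder_normD[OF C(2,1)] in \<open>auto intro!: always_eventually\<close>)
    then show "(\<lambda>n. \<omega> (u n)) \<longlonglongrightarrow> \<omega> a" by (simp add: LIM_zero_iff)
  qed
  moreover have "continuous_on {0..} \<omega>"
    by (rule continuous_on_eq[where f="\<lambda>_. 0"]) (auto simp: z)
  ultimately have "continuous_on ({..0} \<union> {0..}) \<omega>"
    by (intro continuous_on_closed_Un) auto
  moreover have "{..0} \<union> {0..} = (UNIV :: real set)" by auto
  ultimately show ?thesis by simp
qed

text \<open>Among smooth paths with a common slope bound, uniform closeness implies closeness in
  norm by interpolation. Up to a small uniform error such a path is determined by its support bound
  and finitely many rounded values on a grid, and one representative is chosen for each such datum
  that occurs.\<close>

lemma BH_separable: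
  assumes h: "0 < h" "h < 1"
  obtains C :: "('d::finite) hpath set" where "countable C" "C \<subseteq> BH h"
    "\<And>\<omega> e. \<omega> \<in> BH h \<Longrightarrow> e > 0 \<Longrightarrow> \<exists>c\<in>C. holder_norm h (\<lambda>t. \<omega> t - c t) < ennreal e"
proof -
  obtain Q :: "(real ^ 'd) set" where Q: "countable Q" "\<And>X. open X \<Longrightarrow> X \<noteq> {} \<Longrightarrow> \<exists>q\<in>Q. q \<in> X"
    using countable_dense_exists by blast
  \<comment> \<open>Here \<open>m\<close> bounds support and slope, \<open>1 / n\<close> is the mesh
    of the grid on the interval from \<open>- m\<close> to 0, and \<open>v\<close> lists points of
    \<open>Q\<close> near the values at the grid points.\<close>
  define S where "S p = (case p of (m, n, v) \<Rightarrow> {f \<in> C0_inf. (\<forall>t \<le> - real m. f t = 0) \<and>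
      (\<forall>s\<le>0. \<forall>t\<le>0. norm (f t - f s) \<le> real m * \<bar>t - s\<bar>) \<and>
      (\<forall>j\<le>m * n. norm (f (- real j / real n) - v ! j) < 1 / real n)})"
    for p :: "nat \<times> nat \<times> (real ^ 'd) list"
  define I where "I = {p \<in> UNIV \<times> UNIV \<times> lists Q. S p \<noteq> {}}"
  define pick where "pick p = (SOME f. f \<in> S p)" for p
  have pick: "pick p \<in> S p" if "p \<in> I" for p
    using that unfolding I_def pick_def by (auto simp: some_in_eq)
  have SC: "f \<in> C0_inf" if "f \<in> S p" for f p using that by (auto simp: S_def split: prod.splits)
  have cI: "countable I"
    unfolding I_def by (rule countable_subset[of _ "UNIV \<times> UNIV \<times> lists Q"]) (auto intro!: countable_SIGMA Q)
  show ?thesis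
  proof (rule that[of "pick ` I"])
    show "countable (pick ` I)" using cI by simp
    show "pick ` I \<subseteq> BH h" using pick SC C0_inf_in_BH[OF h] by blast
    fix \<omega> :: "'d hpath" and e :: real assume \<omega>: "\<omega> \<in> BH h" and e: "e > 0"
    obtain f where f: "f \<in> C0_inf" "holder_norm h (\<lambda>t. \<omega> t - f t) < ennreal (e / 2)"
      using BH_approx[OF \<omega>, of "e / 2"] e by auto
    obtain m :: nat where m: "0 < m" "\<And>t. t \<le> - real m \<Longrightarrow> f t = 0"
      "\<And>s t. s \<le> 0 \<Longrightarrow> t \<le> 0 \<Longrightarrow> norm (f t - f s) \<le> real m * \<bar>t - s\<bar>"
      using C0_inf_lipschitz[OF f(1)] by metis
    \<comment> \<open>The product of slope bound and oscillation bound that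
      \<open>holder_norm_interpolation\<close> yields for the difference of two members of one class
      is \<open>K / n\<close>; its root must be below \<open>e / 2\<close>.\<close>
    define K where "K = 2 * real m * (2 * (2 * real m + 2))"
    obtain n :: nat where n: "n > 0" "K / real n < (e / 2)\<^sup>2"
    proof -
      have "((\<lambda>n. K / real n) \<longlongrightarrow> 0) sequentially" by real_asymp
      then have "eventually (\<lambda>n. K / real n < (e / 2)\<^sup>2) sequentially"
        using e by (intro order_tendstoD(2)) auto
      then have "eventually (\<lambda>n. K / real n < (e / 2)\<^sup>2 \<and> n > 0) sequentially"
        using eventually_gt_at_top[of 0] by eventually_elim auto
      then show ?thesis using that by (auto simp: eventually_sequentially)
    qed
    have "\<exists>q\<in>Q. norm (f (- real j / real n) - q) < 1 / real n" for j
      using Q(2)[of "ball (f (- real j / real n)) (1 / real n)"] n by (auto simp: dist_norm)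
    then obtain q where q: "\<And>j. q j \<in> Q" "\<And>j. norm (f (- real j / real n) - q j) < 1 / real n"
      by metis
    define v where "v = map q [0..<m * n + 1]"
    define p where "p = (m, n, v)"
    have fS: "f \<in> S p" unfolding S_def p_def v_def using f(1) m q(2) by (auto simp: nth_append simp del: upt_Suc)
    have pI: "p \<in> I" using fS q(1) unfolding I_def p_def v_def by auto
    define g where "g = pick p"
    have gS: "g \<in> S p" unfolding g_def by (rule pick[OF pI])
    have g: "\<And>t. t \<le> - real m \<Longrightarrow> g t = 0" "\<And>s t. s \<le> 0 \<Longrightarrow> t \<le> 0 \<Longrightarrow> norm (g t - g s) \<le> real m * \<bar>t - s\<bar>"
      "\<And>j. j \<le> m * n \<Longrightarrow> norm (g (- real j / real n) - q j) < 1 / real n"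
      using gS unfolding S_def p_def v_def by (auto simp del: upt_Suc)
    have small: "norm (f t - g t) \<le> (2 * real m + 2) / real n" if t: "t \<le> 0" for t
    proof (cases "t \<le> - real m")
      case True
      then show ?thesis using m(2) g(1) by simp
    next
      case False
      define j where "j = nat \<lfloor>- t * real n\<rfloor>"
      have j0: "0 \<le> - t * real n" using t by (simp add: mult_nonpos_nonneg)
      have j: "real j \<le> - t * real n" "- t * real n < real j + 1"
        using j0 by (auto simp: j_def)
      have "- t * real n \<le> real m * real n" using False by (intro mult_right_mono) auto
      then have jm: "j \<le> m * n" using j(1) by (metis of_nat_le_iff of_nat_mult order_trans)
      define u where "u = - real j / real n"
      have u: "u \<le> 0" "\<bar>t - u\<bar> \<le> 1 / real n"
      proof -
        show "u \<le> 0" by (simp add: u_def)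
        have "t - u = (t * real n + real j) / real n" using n by (simp add: u_def field_simps)
        moreover have "\<bar>t * real n + real j\<bar> \<le> 1" using j by auto
        ultimately show "\<bar>t - u\<bar> \<le> 1 / real n" using n by (simp add: divide_right_mono)
      qed
      have *: "real m * \<bar>t - u\<bar> \<le> real m * (1 / real n)" using u(2) by (intro mult_left_mono) auto
      \<comment> \<open>Moving both paths to the grid point \<open>u\<close> costs
        \<open>m / n\<close> each, and comparing both values with \<open>q j\<close> costs
        \<open>1 / n\<close> each.\<close>
      have "norm (f t - g t) \<le> norm (f t - f u) + norm (g t - g u) + norm (f u - q j) + norm (g u - q j)"
        by norm
      also have "\<dots> \<le> real m * (1 / real n) + real m * (1 / real n) + 1 / real n + 1 / real n"
        using m(3)[OF u(1) t] g(2)[OF u(1) t] * q(2)[of j] g(3)[OF jm] unfolding u_def[symmetric] by linarith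
      also have "\<dots> = (2 * real m + 2) / real n" by (simp add: add_divide_distrib)
      finally show ?thesis .
    qed
    have "holder_norm h (\<lambda>t. f t - g t) \<le> ennreal (sqrt ((2 * real m) * (2 * ((2 * real m + 2) / real n))))"
    proof (rule holder_norm_interpolation[OF h])
      fix s t :: real assume st: "s \<le> 0" "t \<le> 0"
      have "norm (f t - g t - (f s - g s)) \<le> norm (f t - f s) + norm (g t - g s)" by norm
      also have "\<dots> \<le> 2 * real m * \<bar>t - s\<bar>" using m(3)[OF st] g(2)[OF st] by simp
      finally show "norm (f t - g t - (f s - g s)) \<le> 2 * real m * \<bar>t - s\<bar>" .
      show "norm (f t - g t - (f s - g s)) \<le> 2 * ((2 * real m + 2) / real n)"
        using small[OF st(1)] small[OF st(2)] norm_triangle_ineq4[of "f t - g t" "f s - g s"] by linarith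
    qed auto
    also have "(2 * real m) * (2 * ((2 * real m + 2) / real n)) = K / real n" by (simp add: K_def)
    also have "ennreal (sqrt (K / real n)) < ennreal (e / 2)"
    proof (rule ennreal_lessI)
      show "sqrt (K / real n) < e / 2"
        using e n(2) real_sqrt_less_mono[OF n(2)] by simp
    qed (use e in simp)
    finally have fg: "holder_norm h (\<lambda>t. f t - g t) < ennreal (e / 2)" .
    have "holder_norm h (\<lambda>t. \<omega> t - g t) \<le> holder_norm h (\<lambda>t. \<omega> t - f t) + holder_norm h (\<lambda>t. f t - g t)"
      using holder_norm_triangle[of h "\<lambda>t. \<omega> t - f t" "\<lambda>t. f t - g t"] by simp
    also have "\<dots> < ennreal (e / 2) + ennreal (e / 2)" by (rule add_strict_mono[OF f(2) fg])
    also have "\<dots> = ennreal e" using e by (simp flip: ennreal_plus)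
    finally show "\<exists>c\<in>pick ` I. holder_norm h (\<lambda>t. \<omega> t - c t) < ennreal e"
      using pI g_def by blast
  qed
qed

text \<open>By continuity rational pairs of times suffice. The norm becomes a countable supremum of
  functions of two evaluations each, which makes it measurable.\<close>

lemma holder_norm_countable:
  fixes \<omega> :: "('d::finite) hpath"
  assumes c: "continuous_on UNIV \<omega>"
  shows "holder_norm h \<omega> = (SUP p \<in> (\<rat> \<inter> {..0}) \<times> (\<rat> \<inter> {..0}). ennreal (holder_quot h \<omega> p))" (is "_ = ?S")
proof (rule antisym)
  show "?S \<le> holder_norm h \<omega>" unfolding holder_norm_def by (intro SUP_subset_mono) auto
  show "holder_norm h \<omega> \<le> ?S"
    unfolding holder_norm_def
  proof (rule SUP_least)
    fix p :: "real \<times> real" assume p: "p \<in> {..0} \<times> {..0}"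
    obtain s t where st: "p = (s, t)" by (cases p)
    show "ennreal (holder_quot h \<omega> p) \<le> ?S"
    proof (cases "s = t")
      case False
      \<comment> \<open>Approximation strictly from the left keeps the rational times in
        \<open>{..0}\<close>, also at the end point 0.\<close>
      have ex: "\<exists>r. \<forall>n. r n \<in> \<rat> \<inter> {..0} \<and> u - 1 / real (Suc n) < r n \<and> r n < u" if "u \<le> 0" for u :: real
      proof -
        have "\<exists>r. r \<in> \<rat> \<and> u - 1 / real (Suc n) < r \<and> r < u" for n
          using Rats_dense_in_real[of "u - 1 / real (Suc n)" u] by auto
        then obtain r where "\<forall>n. r n \<in> \<rat> \<and> u - 1 / real (Suc n) < r n \<and> r n < u" by metis
        then show ?thesis using that by (intro exI[of _ r]) (auto intro: order_trans less_imp_le)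
      qed
      have conv: "r \<longlonglongrightarrow> u" if "\<forall>n. r n \<in> \<rat> \<inter> {..0} \<and> u - 1 / real (Suc n) < r n \<and> r n < u" for r u
      proof (rule tendsto_sandwich)
        show "(\<lambda>n. u - 1 / real (Suc n)) \<longlonglongrightarrow> u" by real_asymp
        show "(\<lambda>n. u) \<longlonglongrightarrow> u" by simp
      qed (use that in \<open>auto intro!: always_eventually less_imp_le\<close>)
      obtain a where a: "\<forall>n. a n \<in> \<rat> \<inter> {..0} \<and> s - 1 / real (Suc n) < a n \<and> a n < s" using ex p st by auto
      obtain b where b: "\<forall>n. b n \<in> \<rat> \<inter> {..0} \<and> t - 1 / real (Suc n) < b n \<and> b n < t" using ex p st by auto
      have ac: "a \<longlonglongrightarrow> s" and bc: "b \<longlonglongrightarrow> t" using conv a b by auto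
      have "isCont \<omega> s" "isCont \<omega> t" using c by (auto simp: continuous_on_eq_continuous_at)
      then have wc: "(\<lambda>n. \<omega> (a n)) \<longlonglongrightarrow> \<omega> s" "(\<lambda>n. \<omega> (b n)) \<longlonglongrightarrow> \<omega> t"
        using ac bc by (auto intro: isCont_tendsto_compose)
      have "(\<lambda>n. holder_quot h \<omega> (a n, b n)) \<longlonglongrightarrow> holder_quot h \<omega> (s, t)"
        unfolding holder_quot_def prod.case
        using False ac bc wc
        by (intro tendsto_intros) (auto simp: add_nonneg_eq_0_iff)
      then have "(\<lambda>n. ennreal (holder_quot h \<omega> (a n, b n))) \<longlonglongrightarrow> ennreal (holder_quot h \<omega> (s, t))"
        by (rule tendsto_ennrealI)
      then show ?thesis unfolding st
      proof (rule tendsto_upperbound)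
        show "\<forall>\<^sub>F n in sequentially. ennreal (holder_quot h \<omega> (a n, b n)) \<le> ?S"
          using a b by (auto intro!: always_eventually SUP_upper)
      qed simp
    qed (simp add: st holder_quot_def)
  qed
qed

lemma openin_BH_top:
  "openin (BH_top h) U \<longleftrightarrow> U \<subseteq> BH h \<and>
     (\<forall>x\<in>U. \<exists>r>0. \<forall>y\<in>BH h. holder_norm h (\<lambda>t. x t - y t) < ennreal r \<longrightarrow> y \<in> U)"
proof -
  interpret Metric_space "BH h" "holder_dist h" by (rule Metric_space_BH)
  have d: "holder_dist h x y < r \<longleftrightarrow> holder_norm h (\<lambda>t. x t - y t) < ennreal r"
    if "x \<in> BH h" "y \<in> BH h" "r > 0" for x y :: "'a hpath" and r
  proof -
    have "holder_norm h (\<lambda>t. x t - y t) < \<infinity>" using BH_diff[OF that(1,2)] by (simp add: BH_def)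
    then show ?thesis using that(3) unfolding holder_dist_def
      by (metis enn2real_less_iff ennreal_enn2real_if ennreal_less_iff enn2real_nonneg infinity_ennreal_def less_irrefl)
  qed
  have "(\<exists>r>0. mball x r \<subseteq> U) \<longleftrightarrow> (\<exists>r>0. \<forall>y\<in>BH h. holder_norm h (\<lambda>t. x t - y t) < ennreal r \<longrightarrow> y \<in> U)"
    if "x \<in> BH h" for x
    using d[OF that] that by (intro ex_cong1 conj_cong refl) (auto simp: subset_iff)
  then show ?thesis unfolding BH_top_def openin_mtopology by blast
qed

lemma space_BH_borel: "space (BH_borel h :: ('d::finite) hpath measure) = BH h"
proof -
  have "{U. openin (BH_top h) U} \<subseteq> Pow (BH h :: 'd hpath set)" by (auto simp: openin_BH_top)
  then show ?thesis by (simp add: BH_borel_def space_measure_of)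
qed

lemma openin_BH_sets: "openin (BH_top h) U \<Longrightarrow> U \<in> sets (BH_borel h)"
proof -
  have "{U. openin (BH_top h) U} \<subseteq> Pow (BH h)" by (auto simp: openin_BH_top)
  then show "openin (BH_top h) U \<Longrightarrow> U \<in> sets (BH_borel h)"
    by (auto simp: BH_borel_def)
qed

text \<open>By separability an open set is a countable union of balls, and by
  \<open>holder_norm_countable\<close> a ball is described by countably many evaluations. The Borel
  sets are thus controlled by evaluations alone.\<close>

lemma measurable_BH_borelI:
  fixes X :: "'w \<Rightarrow> ('d::finite) hpath"
  assumes h: "0 < h" "h < 1"
    and X: "\<And>w. w \<in> space M \<Longrightarrow> X w \<in> BH h"
    and ev: "\<And>t. (\<lambda>w. X w t) \<in> borel_measurable M"
  shows "X \<in> M \<rightarrow>\<^sub>M BH_borel h"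
  unfolding BH_borel_def
proof (rule measurable_measure_of)
  show "{U. openin (BH_top h) U} \<subseteq> Pow (BH h)" by (auto simp: openin_BH_top)
  show "X \<in> space M \<rightarrow> BH h" using X by auto
  fix U :: "'d hpath set" assume "U \<in> {U. openin (BH_top h) U}"
  then have U: "U \<subseteq> BH h" "\<And>x. x \<in> U \<Longrightarrow> \<exists>r>0. \<forall>y\<in>BH h. holder_norm h (\<lambda>t. x t - y t) < ennreal r \<longrightarrow> y \<in> U"
    by (auto simp: openin_BH_top)
  obtain C :: "'d hpath set" where C: "countable C" "C \<subseteq> BH h"
    "\<And>\<omega> e. \<omega> \<in> BH h \<Longrightarrow> e > 0 \<Longrightarrow> \<exists>c\<in>C. holder_norm h (\<lambda>t. \<omega> t - c t) < ennreal e"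
    using BH_separable[OF h] by metis
  define B where "B p = {\<omega> \<in> BH h. holder_norm h (\<lambda>t. \<omega> t - fst p t) < ennreal (1 / real (Suc (snd p)))}" for p :: "'d hpath \<times> nat"
  define J where "J = {p \<in> C \<times> UNIV. B p \<subseteq> U}"
  have cJ: "countable J" unfolding J_def by (rule countable_subset[of _ "C \<times> UNIV"]) (auto intro!: countable_SIGMA C)
  have UJ: "U = (\<Union>p\<in>J. B p)"
  proof
    show "U \<subseteq> (\<Union>p\<in>J. B p)"
    proof
      fix x assume x: "x \<in> U"
      then obtain r where r: "r > 0" "\<And>y. y \<in> BH h \<Longrightarrow> holder_norm h (\<lambda>t. x t - y t) < ennreal r \<Longrightarrow> y \<in> U"
        using U(2) by blast
      \<comment> \<open>Twice the radius \<open>1 / Suc n\<close> must stay below \<open>r\<close>,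
        because \<open>x\<close> and \<open>y\<close> are compared through the centre
        \<open>c\<close>.\<close>
      obtain n where n: "1 / real (Suc n) < r / 2"
        using nat_approx_posE[of "r / 2"] r by auto
      obtain c where c: "c \<in> C" "holder_norm h (\<lambda>t. x t - c t) < ennreal (1 / real (Suc n))"
        using C(3)[of x "1 / real (Suc n)"] x U(1) by auto
      have "B (c, n) \<subseteq> U"
      proof
        fix y assume y: "y \<in> B (c, n)"
        have "holder_norm h (\<lambda>t. x t - y t) \<le> holder_norm h (\<lambda>t. x t - c t) + holder_norm h (\<lambda>t. c t - y t)"
          using holder_norm_triangle[of h "\<lambda>t. x t - c t" "\<lambda>t. c t - y t"] by simp
        also have "\<dots> < ennreal (1 / real (Suc n)) + ennreal (1 / real (Suc n))"
          using c(2) y holder_norm_commute[of h c y] by (intro add_strict_mono) (auto simp: B_def)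
        also have "\<dots> = ennreal (1 / real (Suc n) + 1 / real (Suc n))" by (rule ennreal_plus[symmetric]) auto
        also have "\<dots> \<le> ennreal r" using n by (intro ennreal_leI) linarith
        finally show "y \<in> U" using r(2)[of y] y by (simp add: B_def)
      qed
      then show "x \<in> (\<Union>p\<in>J. B p)"
        using c x U(1) by (auto simp: J_def B_def intro!: bexI[of _ "(c, n)"])
    qed
  qed (auto simp: J_def)
  have "X -` B p \<inter> space M \<in> sets M" if p: "p \<in> J" for p
  proof -
    have pC: "fst p \<in> BH h" using p C(2) by (auto simp: J_def)
    have "(\<lambda>w. holder_norm h (\<lambda>t. X w t - fst p t)) \<in> borel_measurable M"
    proof (subst measurable_cong)
      fix w assume w: "w \<in> space M"
      show "holder_norm h (\<lambda>t. X w t - fst p t)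
          = (SUP q \<in> (\<rat> \<inter> {..0}) \<times> (\<rat> \<inter> {..0}). ennreal (holder_quot h (\<lambda>t. X w t - fst p t) q))"
        using BH_continuous[OF h(2) BH_diff[OF X[OF w] pC]] by (rule holder_norm_countable)
    next
      have cQ: "countable ((\<rat> \<inter> {..0}) \<times> (\<rat> \<inter> {..0} :: real set))"
        by (intro countable_SIGMA countable_Int1 countable_rat)
      show "(\<lambda>w. SUP q \<in> (\<rat> \<inter> {..0}) \<times> (\<rat> \<inter> {..0}). ennreal (holder_quot h (\<lambda>t. X w t - fst p t) q)) \<in> borel_measurable M"
      proof (rule borel_measurable_SUP[OF cQ])
        fix q :: "real \<times> real"
        note [measurable] = ev
        show "(\<lambda>w. ennreal (holder_quot h (\<lambda>t. X w t - fst p t) q)) \<in> borel_measurable M"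
          unfolding holder_quot_def split_beta' by measurable
      qed
    qed
    then have "{w \<in> space M. holder_norm h (\<lambda>t. X w t - fst p t) < ennreal (1 / real (Suc (snd p)))} \<in> sets M"
      by measurable
    also have "{w \<in> space M. holder_norm h (\<lambda>t. X w t - fst p t) < ennreal (1 / real (Suc (snd p)))}
        = X -` B p \<inter> space M"
      using X by (auto simp: B_def)
    finally show ?thesis .
  qed
  then have "(\<Union>p\<in>J. X -` B p \<inter> space M) \<in> sets M" using cJ by (intro sets.countable_UN') auto
  also have "(\<Union>p\<in>J. X -` B p \<inter> space M) = X -` U \<inter> space M" unfolding UJ by auto
  finally show "X -` U \<inter> space M \<in> sets M" .
qed

text \<open>Time 0, at which all paths vanish, serves as the second time in the norm.\<close>

lemma BH_eval_bound:
  assumes "\<omega> \<in> BH h" "\<eta> \<in> BH h" "holder_norm h (\<lambda>t. \<omega> t - \<eta> t) \<le> ennreal C" "0 \<le> C"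
  shows "norm (\<omega> t - \<eta> t) \<le> C * (sqrt (1 + \<bar>t\<bar>) * \<bar>t\<bar> powr ((1 - h) / 2))"
proof (cases "t \<le> 0")
  case True
  then show ?thesis
    using holder_normD[OF assms(3,4), of 0 t] BH_zero[OF assms(1), of 0] BH_zero[OF assms(2), of 0] by simp
qed (use assms BH_zero[OF assms(1), of t] BH_zero[OF assms(2), of t] in simp)

lemma continuous_map_eval: "continuous_map (BH_top h) euclidean (\<lambda>\<omega>. \<omega> t :: real ^ 'd::finite)"
proof -
  have top: "topspace (BH_top h) = BH h"
    unfolding BH_top_def by (rule Metric_space.topspace_mtopology[OF Metric_space_BH])
  have "openin (BH_top h) {\<omega> \<in> BH h. \<omega> t \<in> U}" if U: "open U" for U :: "(real ^ 'd) set"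
    unfolding openin_BH_top
  proof (intro conjI ballI)
    fix x assume x: "x \<in> {\<omega> \<in> BH h. \<omega> t \<in> U}"
    then obtain r where r: "r > 0" "ball (x t) r \<subseteq> U" using U openE by blast
    \<comment> \<open>The summand 1 keeps the constant positive at \<open>t = 0\<close> and makes
      the final estimate strict.\<close>
    define c where "c = sqrt (1 + \<bar>t\<bar>) * \<bar>t\<bar> powr ((1 - h) / 2) + 1"
    have c: "c > 0" by (auto simp: c_def intro!: add_nonneg_pos)
    show "\<exists>r>0. \<forall>y\<in>BH h. holder_norm h (\<lambda>t. x t - y t) < ennreal r \<longrightarrow> y \<in> {\<omega> \<in> BH h. \<omega> t \<in> U}"
    proof (intro exI[of _ "r / c"] conjI ballI impI)
      fix y assume y: "y \<in> BH h" "holder_norm h (\<lambda>t. x t - y t) < ennreal (r / c)"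
      have "norm (x t - y t) \<le> (r / c) * (sqrt (1 + \<bar>t\<bar>) * \<bar>t\<bar> powr ((1 - h) / 2))"
        using BH_eval_bound[of x h y "r / c" t] x y r c by auto
      also have "\<dots> < (r / c) * c" using r c by (intro mult_strict_left_mono) (auto simp: c_def)
      also have "\<dots> = r" using c by simp
      finally show "y \<in> {\<omega> \<in> BH h. \<omega> t \<in> U}" using r(2) y(1) by (auto simp: dist_norm)
    qed (use r c in simp)
  qed auto
  then show ?thesis by (simp add: continuous_map_def top)
qed

lemma borel_measurable_BH_continuous:
  assumes "continuous_map (BH_top h) euclidean f"
  shows "f \<in> borel_measurable (BH_borel h)"
proof (rule borel_measurableI)
  fix U :: "'b set" assume "open U"
  have top: "topspace (BH_top h) = BH h"
    unfolding BH_top_def by (rule Metric_space.topspace_mtopology[OF Metric_space_BH])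
  have "openin (BH_top h) {\<omega> \<in> topspace (BH_top h). f \<omega> \<in> U}"
    using assms \<open>open U\<close> by (simp add: continuous_map_def)
  then have "{\<omega> \<in> BH h. f \<omega> \<in> U} \<in> sets (BH_borel h)" unfolding top by (rule openin_BH_sets)
  then show "f -` U \<inter> space (BH_borel h) \<in> sets (BH_borel h)"
    by (simp add: space_BH_borel vimage_def Int_def conj_commute)
qed

section \<open>The fractional operator commutes with shifts\<close>

lemma reflected_power_integral:
  assumes a: "a > (-1::real)" and c: "0 \<le> c"
  shows "has_bochner_integral lborel (\<lambda>r. indicator {- c..0} r * (- r) powr a) (c powr (a + 1) / (a + 1))"
proof -
  have "((\<lambda>x. if x \<in> {0..c} then x powr a else 0) has_integral c powr (a + 1) / (a + 1)) UNIV"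
    using has_integral_powr_from_0[OF a c] by (simp only: has_integral_restrict_UNIV)
  also have "(\<lambda>x. if x \<in> {0..c} then x powr a else 0) = (\<lambda>x. indicator {0..c} x * x powr a)"
    by (auto simp: indicator_def)
  finally have "(\<integral>\<^sup>+ x. ennreal (indicator {0..c} x * x powr a) \<partial>lborel) = ennreal (c powr (a + 1) / (a + 1))"
    by (intro nn_integral_has_integral_lborel) auto
  then have "has_bochner_integral lborel (\<lambda>x. indicator {0..c} x * x powr a) (c powr (a + 1) / (a + 1))"
    using a by (intro has_bochner_integral_nn_integral) auto
  then have "has_bochner_integral lborel (\<lambda>x. indicator {0..c} (0 + (-1) * x) * (0 + (-1) * x) powr a)
      (c powr (a + 1) / (a + 1) /\<^sub>R \<bar>-1\<bar>)"
    by (subst (asm) lborel_has_bochner_integral_real_affine_iff[of "-1" _ _ 0]) auto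
  moreover have "(\<lambda>x. indicator {0..c} (0 + (-1) * x) * (0 + (-1) * x) powr a)
      = (\<lambda>r. indicator {- c..0} r * (- r) powr a)"
    by (rule ext) (auto simp: indicator_def)
  ultimately show ?thesis by simp
qed

text \<open>The kernel has mass of order \<open>c powr (a + 1)\<close> on the interval from
  \<open>- c\<close> to 0. An integrand that spreads out while its size decreases faster than this
  mass grows is therefore negligible.\<close>

lemma kernel_integral:
  fixes k :: "real \<Rightarrow> real ^ 'd::finite"
  assumes a: "a > (-1::real)" and c: "0 \<le> c" and B: "0 \<le> B"
    and cont: "continuous_on {..0} k"
    and bound: "\<And>r. r \<le> 0 \<Longrightarrow> norm (k r) \<le> B" and supp: "\<And>r. r < - c \<Longrightarrow> k r = 0"
  shows "set_integrable lborel {..0} (\<lambda>r. ((- r) powr a) *\<^sub>R k r)"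
    and "norm (LINT r:{..0}|lborel. ((- r) powr a) *\<^sub>R k r) \<le> B * (c powr (a + 1) / (a + 1))"
proof -
  note w = reflected_power_integral[OF a c]
  let ?f = "\<lambda>r. indicator {..0} r *\<^sub>R ((- r) powr a) *\<^sub>R k r"
  let ?w = "\<lambda>r. B * (indicator {- c..0} r * (- r) powr a)"
  have iw: "integrable lborel ?w" using w by (intro integrable_mult_right) (auto simp: has_bochner_integral_iff)
  have "(\<lambda>r. indicator {..0} r *\<^sub>R k r) \<in> borel_measurable borel"
    using cont by (intro borel_measurable_continuous_on_indicator) auto
  then have "(\<lambda>r. ((- r) powr a) *\<^sub>R (indicator {..0} r *\<^sub>R k r)) \<in> borel_measurable lborel"
    by measurable
  then have m: "?f \<in> borel_measurable lborel" by (simp add: mult.commute)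
  have b: "norm (?f r) \<le> ?w r" for r
    using bound[of r] supp[of r] B by (auto simp: indicator_def mult.commute intro!: mult_right_mono)
  have int: "integrable lborel ?f"
    by (rule Bochner_Integration.integrable_bound[OF iw m]) (use b B in \<open>auto intro!: AE_I2 simp: abs_mult order_trans[OF b]\<close>)
  then show "set_integrable lborel {..0} (\<lambda>r. ((- r) powr a) *\<^sub>R k r)" by (simp add: set_integrable_def)
  have "norm (LINT r:{..0}|lborel. ((- r) powr a) *\<^sub>R k r) \<le> (\<integral>r. norm (?f r) \<partial>lborel)"
    unfolding set_lebesgue_integral_def by (rule integral_norm_bound)
  also have "\<dots> \<le> (\<integral>r. ?w r \<partial>lborel)"
    using int iw b by (intro integral_mono integrable_norm) auto
  also have "\<dots> = B * (c powr (a + 1) / (a + 1))"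
    using w by (simp add: has_bochner_integral_iff)
  finally show "norm (LINT r:{..0}|lborel. ((- r) powr a) *\<^sub>R k r) \<le> \<dots>" .
qed

lemma at_within_atMost_nonbot: "t \<le> (0::real) \<Longrightarrow> at t within {..0} \<noteq> bot"
  by (metis at_le bot.extremum_uniqueI greaterThan_iff lessThan_iff less_le_trans order.strict_implies_order subsetI trivial_limit_at_left_real atMost_iff)

section \<open>One-sided derivatives and shifts of paths\<close>

lemma path_deriv_eq:
  fixes f :: "('d::finite) hpath"
  assumes "\<And>s. s \<le> 0 \<Longrightarrow> f s = g s" "(g has_vector_derivative g') (at t within {..0})" "t \<le> 0"
  shows "path_deriv f t = g'"
proof -
  have "(f has_vector_derivative g') (at t within {..0})"
    by (rule has_vector_derivative_transform[OF _ _ assms(2)]) (use assms in auto)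
  then show ?thesis unfolding path_deriv_def
    by (rule vector_derivative_within[OF at_within_atMost_nonbot[OF assms(3)]])
qed

lemma has_vector_derivative_affine_atMost:
  fixes g :: "real \<Rightarrow> 'a::real_normed_vector"
  assumes g: "\<And>t. t \<le> 0 \<Longrightarrow> (g has_vector_derivative g' t) (at t within {..0})"
    and "0 \<le> c" "0 \<le> u" "s \<le> 0"
  shows "((\<lambda>s. g (c * s - u)) has_vector_derivative c *\<^sub>R g' (c * s - u)) (at s within {..0})"
proof -
  have le: "c * s - u \<le> 0" if "s \<le> 0" for s
    using mult_nonneg_nonpos[OF assms(2) that] assms(3) by linarith
  have "((\<lambda>s. c * s - u) has_vector_derivative c) (at s within {..0})"
    by (auto intro!: derivative_eq_intros simp: has_vector_derivative_def)
  moreover have "(g has_vector_derivative g' (c * s - u)) (at (c * s - u) within (\<lambda>s. c * s - u) ` {..0})"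
    by (rule has_vector_derivative_within_subset[OF g]) (use le assms in auto)
  ultimately show ?thesis
    using vector_diff_chain_within[of "\<lambda>s. c * s - u" c s "{..0}" g] by (simp add: o_def)
qed

text \<open>For nonpositive times the shift adds \<open>2 * u\<close> to
  \<open>1 + \<bar>t\<bar> + \<bar>s\<bar>\<close>, which enlarges it at most by the factor
  \<open>1 + 2 * u\<close>, and it leaves \<open>t - s\<close> unchanged.\<close>

lemma holder_norm_shift:
  fixes \<omega> \<eta> :: "('d::finite) hpath"
  assumes "holder_norm h (\<lambda>t. \<omega> t - \<eta> t) \<le> ennreal C" "0 \<le> C" "0 \<le> u"
  shows "holder_norm h (\<lambda>t. shift u \<omega> t - shift u \<eta> t) \<le> ennreal (C * sqrt (1 + 2 * u))"
proof (rule holder_normI)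
  fix s t :: real assume st: "s \<le> 0" "t \<le> 0"
  have "shift u \<omega> t - shift u \<eta> t - (shift u \<omega> s - shift u \<eta> s)
      = (\<omega> (t - u) - \<eta> (t - u)) - (\<omega> (s - u) - \<eta> (s - u))"
    using st by (simp add: shift_def)
  also have "norm \<dots> \<le> C * (sqrt (1 + \<bar>t - u\<bar> + \<bar>s - u\<bar>) * \<bar>(t - u) - (s - u)\<bar> powr ((1 - h) / 2))"
    by (rule holder_normD[OF assms(1,2)]) (use st assms in auto)
  also have "\<dots> \<le> C * ((sqrt (1 + 2 * u) * sqrt (1 + \<bar>t\<bar> + \<bar>s\<bar>)) * \<bar>t - s\<bar> powr ((1 - h) / 2))"
  proof (intro mult_left_mono mult_mono)
    have "0 \<le> 2 * u * (\<bar>t\<bar> + \<bar>s\<bar>)" using assms by simp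
    then have "1 + \<bar>t - u\<bar> + \<bar>s - u\<bar> \<le> (1 + 2 * u) * (1 + \<bar>t\<bar> + \<bar>s\<bar>)"
      using st assms(3) by (simp add: algebra_simps)
    then show "sqrt (1 + \<bar>t - u\<bar> + \<bar>s - u\<bar>) \<le> sqrt (1 + 2 * u) * sqrt (1 + \<bar>t\<bar> + \<bar>s\<bar>)"
      by (simp add: real_sqrt_mult[symmetric])
  qed (use assms in auto)
  finally show "norm (shift u \<omega> t - shift u \<eta> t - (shift u \<omega> s - shift u \<eta> s))
      \<le> C * sqrt (1 + 2 * u) * (sqrt (1 + \<bar>t\<bar> + \<bar>s\<bar>) * \<bar>t - s\<bar> powr ((1 - h) / 2))"
    by (simp add: mult_ac)
qed (use assms in auto)

lemma BH_continuous_map_sequentially: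
  fixes F :: "('d::finite) hpath \<Rightarrow> 'a::metric_space"
  assumes F: "continuous_map (BH_top h) euclidean F" and x: "x \<in> BH h" "\<And>n. X n \<in> BH h"
    and c: "\<And>n. 0 \<le> c n" "c \<longlonglongrightarrow> 0" "\<And>n. holder_norm h (\<lambda>t. x t - X n t) \<le> ennreal (c n)"
  shows "(\<lambda>n. F (X n)) \<longlonglongrightarrow> F x"
proof (rule topological_tendstoI)
  fix U assume U: "open U" "F x \<in> U"
  have top: "topspace (BH_top h) = BH h"
    unfolding BH_top_def by (rule Metric_space.topspace_mtopology[OF Metric_space_BH])
  have "openin (BH_top h) {\<omega> \<in> BH h. F \<omega> \<in> U}"
    using F U(1) by (simp add: continuous_map_def top)
  then obtain r where r: "r > 0" "\<And>y. y \<in> BH h \<Longrightarrow> holder_norm h (\<lambda>t. x t - y t) < ennreal r \<Longrightarrow> F y \<in> U"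
    using x(1) U(2) unfolding openin_BH_top by blast
  have "eventually (\<lambda>n. c n < r) sequentially" using c(2) r(1) by (rule order_tendstoD)
  then show "eventually (\<lambda>n. F (X n) \<in> U) sequentially"
  proof eventually_elim
    case (elim n)
    have "holder_norm h (\<lambda>t. x t - X n t) < ennreal r"
      using c(3)[of n] elim c(1)[of n] by (meson ennreal_lessI le_less_trans order.strict_trans1)
    then show ?case using r(2) x(2) by blast
  qed
qed

context
  fixes H \<alpha> :: real and P :: "('d::finite) hpath measure" and D :: "'d hpath \<Rightarrow> 'd hpath"
  assumes H: "0 < H" "H < 1" and D: "frac_operator H P \<alpha> D"
begin

lemma frac_operator_C0_inf:
  assumes "f \<in> C0_inf" "t \<le> 0"
  shows "D f t = (1 / \<alpha>) *\<^sub>R (LINT r:{..0}|lborel. ((- r) powr (H - 1 / 2)) *\<^sub>R (path_deriv f (t + r) - path_deriv f r))"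
  using D assms unfolding frac_operator_def by blast

lemma continuous_map_frac_operator: "continuous_map (BH_top H) euclidean (\<lambda>\<omega>. D \<omega> t)"
  using continuous_map_compose[OF _ continuous_map_eval, of "BH_top H" "1 - H" D t] D
  unfolding frac_operator_def by (simp add: o_def)

text \<open>The shift of a smooth compactly supported path is constant near \<open>-\<infinity>\<close>. Rescaling the path
  itself provides a slowly varying correction that makes it compactly supported again.\<close>

lemma frac_operator_shift_C0_inf:
  assumes f: "f \<in> C0_inf" and u: "0 \<le> u" and t: "t \<le> 0"
  shows "shift u f \<in> BH H" "D (shift u f) t = D f (t - u) - D f (- u)"
proof -
  obtain g K where K: "0 < K" and fK: "\<And>t. t \<le> - K \<Longrightarrow> f t = 0" "\<And>t. 0 \<le> t \<Longrightarrow> f t = 0"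
    and g0: "\<And>t. t \<le> 0 \<Longrightarrow> g 0 t = f t"
    and g: "\<And>n t. t \<le> 0 \<Longrightarrow> (g n has_vector_derivative g (Suc n) t) (at t within {..0})"
    using C0_infE[OF f] by metis
  have z: "g 0 t = 0" if "t \<le> - K" for t using that K g0[of t] fK by simp
  have van: "g n t = 0" if "t < - K" for n t using derivatives_vanish[OF g z K that] .
  obtain M where M: "0 < M" "\<And>t. t \<le> 0 \<Longrightarrow> norm (g 0 t) \<le> M"
    using derivatives_bounded[OF g z K, where n=0] by metis
  obtain L where L: "0 < L" "\<And>t. t \<le> 0 \<Longrightarrow> norm (g 1 t) \<le> L"
    using derivatives_bounded[OF g z K, where n=1] by metis
  obtain L2 where L2: "0 < L2" "\<And>t. t \<le> 0 \<Longrightarrow> norm (g 2 t) \<le> L2"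
    using derivatives_bounded[OF g z K, where n=2] by metis
  have lip0: "norm (g 0 t - g 0 s) \<le> L * \<bar>t - s\<bar>" if "s \<le> 0" "t \<le> 0" for s t
    using bounded_derivative_lipschitz[of "g 0" "g 1" L s t] g[of _ 0] L that by simp
  have lip1: "norm (g 1 t - g 1 s) \<le> L2 * \<bar>t - s\<bar>" if "s \<le> 0" "t \<le> 0" for s t
    using bounded_derivative_lipschitz[of "g 1" "g 2" L2 s t] g[of _ 1] L2 that by (simp add: numeral_2_eq_2)
  have c1: "continuous_on {..0} (g 1)"
    using g by (intro continuous_on_vector_derivative) auto
  \<comment> \<open>The shifted path minus a copy stretched by the factor \<open>Suc n\<close>. The
    two terms agree at 0 and both vanish far out. The factor \<open>1 * s\<close> is kept so that
    the same rules treat both terms.\<close>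
  define G where "G n s = (if s \<le> 0 then g 0 (1 * s - u) - g 0 ((1 / real (Suc n)) * s - u) else 0)" for n s
  have small: "(1 / real (Suc n)) * s - u \<le> 0" "1 * s - u \<le> 0" if "s \<le> 0" for n s
    using that u by (auto intro: order_trans[OF divide_nonpos_nonneg])
  have GC: "G n \<in> C0_inf" for n
    unfolding C0_inf_def
  proof (intro CollectI conjI allI impI)
    show "G n t = 0" if "0 \<le> t" for t using that by (auto simp: G_def)
    show "\<exists>T. \<forall>t\<le>T. G n t = 0"
    proof (intro exI[of _ "- (real (Suc n) * (K + 1))"] allI impI)
      fix t assume t: "t \<le> - (real (Suc n) * (K + 1))"
      have "(1 / real (Suc n)) * t \<le> (1 / real (Suc n)) * (- (real (Suc n) * (K + 1)))"
        using t by (intro mult_left_mono) auto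
      then have 1: "(1 / real (Suc n)) * t - u < - K" using u by simp
      have "K + 1 \<le> real (Suc n) * (K + 1)" using K by (simp add: algebra_simps)
      then have "1 * t - u < - K" using t u by linarith
      then show "G n t = 0" using 1 by (simp add: G_def van)
    qed
    show "\<exists>ga. (\<forall>t\<le>0. ga 0 t = G n t) \<and> (\<forall>n. \<forall>t\<le>0. (ga n has_vector_derivative ga (Suc n) t) (at t within {..0}))"
    proof (intro exI[of _ "\<lambda>k s. 1 ^ k *\<^sub>R g k (1 * s - u) - (1 / real (Suc n)) ^ k *\<^sub>R g k ((1 / real (Suc n)) * s - u)"] conjI allI impI)
      fix k and s :: real assume s: "s \<le> 0"
      have "((\<lambda>s. c ^ k *\<^sub>R g k (c * s - u)) has_vector_derivative c ^ Suc k *\<^sub>R g (Suc k) (c * s - u)) (at s within {..0})"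
        if "0 \<le> c" for c
        using bounded_linear.has_vector_derivative[OF bounded_linear_scaleR_right[of "c ^ k"]
            has_vector_derivative_affine_atMost[of "g k" "g (Suc k)", OF g that u s]]
        by (simp add: mult.commute)
      note der = this
      show "((\<lambda>s. 1 ^ k *\<^sub>R g k (1 * s - u) - (1 / real (Suc n)) ^ k *\<^sub>R g k ((1 / real (Suc n)) * s - u))
          has_vector_derivative 1 ^ Suc k *\<^sub>R g (Suc k) (1 * s - u)
            - (1 / real (Suc n)) ^ Suc k *\<^sub>R g (Suc k) ((1 / real (Suc n)) * s - u)) (at s within {..0})"
        by (rule has_vector_derivative_diff[OF der der]) auto
    qed (simp add: G_def)
  qed
  have GBH: "G n \<in> BH H" for n by (rule C0_inf_in_BH[OF H GC])
  \<comment> \<open>Interpolation between the slope \<open>L / Suc n\<close> and the oscillation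
    \<open>2 * M\<close> of the stretched term.\<close>
  define cc where "cc n = sqrt (L / real (Suc n) * (2 * M))" for n
  have cc0: "cc \<longlonglongrightarrow> 0"
  proof -
    have "(\<lambda>n. sqrt (L / real (Suc n) * (2 * M))) \<longlonglongrightarrow> sqrt 0"
      by (intro tendsto_real_sqrt) real_asymp
    then show ?thesis by (simp add: cc_def[abs_def])
  qed
  have dist: "holder_norm H (\<lambda>s. shift u f s - G n s) \<le> ennreal (cc n)" for n
    unfolding cc_def
  proof (rule holder_norm_interpolation[OF H])
    fix s t :: real assume st: "s \<le> 0" "t \<le> 0"
    have e: "shift u f t - G n t = g 0 ((1 / real (Suc n)) * t - u) - g 0 (- u)" if "t \<le> 0" for t
      using that u g0[of "t - u"] g0[of "- u"] by (simp add: shift_def G_def)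
    show "norm (shift u f t - G n t - (shift u f s - G n s)) \<le> L / real (Suc n) * \<bar>t - s\<bar>"
    proof -
      have "norm (shift u f t - G n t - (shift u f s - G n s))
          = norm (g 0 ((1 / real (Suc n)) * t - u) - g 0 ((1 / real (Suc n)) * s - u))"
        using st by (simp only: e) simp
      also have "\<dots> \<le> L * \<bar>((1 / real (Suc n)) * t - u) - ((1 / real (Suc n)) * s - u)\<bar>"
        by (intro lip0 small st)
      also have "((1 / real (Suc n)) * t - u) - ((1 / real (Suc n)) * s - u) = (t - s) / real (Suc n)"
        by (simp add: diff_divide_distrib)
      finally show ?thesis by (simp add: abs_divide)
    qed
    show "norm (shift u f t - G n t - (shift u f s - G n s)) \<le> 2 * M"
      using norm_triangle_ineq4[of "g 0 ((1 / real (Suc n)) * t - u)" "g 0 ((1 / real (Suc n)) * s - u)"]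
        M(2)[OF small(1)[OF st(1)], of n] M(2)[OF small(1)[OF st(2)], of n] st by (simp add: e)
  qed (use L M in auto)
  show sBH: "shift u f \<in> BH H"
  proof (rule BH_closed)
    show "shift u f t = 0" if "0 \<le> t" for t using that by (auto simp: shift_def)
    fix e :: real assume "e > 0"
    then have "eventually (\<lambda>n. cc n < e) sequentially" using cc0 by (intro order_tendstoD) auto
    then obtain n where n: "cc n < e" by (auto simp: eventually_sequentially)
    have "holder_norm H (\<lambda>t. shift u f t - G n t) < ennreal e"
      by (rule le_less_trans[OF dist[of n] ennreal_lessI]) (use n \<open>e > 0\<close> in auto)
    then show "\<exists>\<eta>\<in>BH H. holder_norm H (\<lambda>t. shift u f t - \<eta> t) < ennreal e"
      using GBH by blast
  qed
  have "(\<lambda>n. D (G n) t) \<longlonglongrightarrow> D (shift u f) t"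
    by (rule BH_continuous_map_sequentially[OF continuous_map_frac_operator sBH GBH _ cc0 dist])
      (use L M in \<open>simp add: cc_def\<close>)
  moreover have "(\<lambda>n. D (G n) t) \<longlonglongrightarrow> D f (t - u) - D f (- u)"
  proof -
    define w where "w r = (- r) powr (H - 1 / 2)" for r :: real
    have a: "H - 1 / 2 > (-1::real)" using H by simp
    define J where "J k = (LINT r:{..0}|lborel. w r *\<^sub>R k r)" for k :: "real \<Rightarrow> real ^ 'd"
    have D_f: "D f b = (1 / \<alpha>) *\<^sub>R J (\<lambda>r. g 1 (b + r) - g 1 r)" if b: "b \<le> 0" for b
    proof -
      have "path_deriv f s = g 1 s" if "s \<le> 0" for s
        by (rule path_deriv_eq[of f "g 0"]) (use g0 g[of s 0] that in auto)
      then show ?thesis unfolding frac_operator_C0_inf[OF f b] J_def w_def using b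
        by (intro arg_cong[where f="\<lambda>x. (1 / \<alpha>) *\<^sub>R x"] set_lebesgue_integral_cong) auto
    qed
    have g1c: "continuous_on {..0} (\<lambda>r. g 1 (c * r + b))" if "0 \<le> c" "b \<le> 0" for c b
      by (rule continuous_on_compose2[OF c1])
        (use that in \<open>auto intro!: continuous_intros simp: mult_nonneg_nonpos add_nonpos_nonpos\<close>)
    have i1: "set_integrable lborel {..0} (\<lambda>r. w r *\<^sub>R (g 1 (b + r) - g 1 r))" if b: "b \<le> 0" for b
      unfolding w_def
    proof (rule kernel_integral(1)[OF a, of K "2 * L"])
      show "continuous_on {..0} (\<lambda>r. g 1 (b + r) - g 1 r)"
        using g1c[of 1 b] g1c[of 1 0] b by (auto intro!: continuous_on_diff simp: add.commute)
      show "norm (g 1 (b + r) - g 1 r) \<le> 2 * L" if "r \<le> 0" for r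
        using norm_triangle_ineq4[of "g 1 (b + r)" "g 1 r"] L(2)[of r] L(2)[of "b + r"] that b by simp
      show "g 1 (b + r) - g 1 r = 0" if "r < - K" for r using that b by (simp add: van)
    qed (use K L in auto)
    \<comment> \<open>The contribution of the stretched term: its derivative carries one factor
      \<open>1 / Suc n\<close> and the increment over \<open>t\<close> a second one, while the
      support has length at most \<open>Suc n * K\<close>.\<close>
    define k2 where "k2 n r = (1 / real (Suc n)) *\<^sub>R (g 1 ((1 / real (Suc n)) * (t + r) - u) - g 1 ((1 / real (Suc n)) * r - u))" for n r
    define c2 where "c2 n = real (Suc n) * K" for n
    define B2 where "B2 n = (1 / real (Suc n)) * (L2 * (\<bar>t\<bar> / real (Suc n)))" for n
    have k2: "set_integrable lborel {..0} (\<lambda>r. w r *\<^sub>R k2 n r)"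
      "norm (J (k2 n)) \<le> B2 n * (c2 n powr (H - 1 / 2 + 1) / (H - 1 / 2 + 1))" for n
    proof -
      have 1: "0 \<le> c2 n" "0 \<le> B2 n" using K L2 by (auto simp: c2_def B2_def)
      have "(1 / real (Suc n)) * t \<le> 0" using t by (simp add: divide_nonpos_nonneg)
      then have "continuous_on {..0} (\<lambda>r. g 1 ((1 / real (Suc n)) * r + ((1 / real (Suc n)) * t - u)))"
        using u by (intro g1c) auto
      moreover have "continuous_on {..0} (\<lambda>r. g 1 ((1 / real (Suc n)) * r + (- u)))"
        using u by (intro g1c) auto
      ultimately have 2: "continuous_on {..0} (k2 n)"
        unfolding k2_def[abs_def]
        by (intro continuous_on_scaleR continuous_on_const continuous_on_diff) (simp_all add: algebra_simps add_divide_distrib)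
      have 3: "norm (k2 n r) \<le> B2 n" if "r \<le> 0" for r
      proof -
        have "norm (g 1 ((1 / real (Suc n)) * (t + r) - u) - g 1 ((1 / real (Suc n)) * r - u))
            \<le> L2 * \<bar>((1 / real (Suc n)) * (t + r) - u) - ((1 / real (Suc n)) * r - u)\<bar>"
          by (intro lip1 small) (use that t in auto)
        also have "((1 / real (Suc n)) * (t + r) - u) - ((1 / real (Suc n)) * r - u) = t / real (Suc n)"
          by (simp add: add_divide_distrib)
        finally show ?thesis unfolding k2_def B2_def norm_scaleR by (intro mult_mono) (auto simp: abs_divide)
      qed
      have 4: "k2 n r = 0" if "r < - c2 n" for r
      proof -
        have "(1 / real (Suc n)) * r < (1 / real (Suc n)) * (- c2 n)" using that by (intro mult_strict_left_mono) auto
        then have r: "(1 / real (Suc n)) * r - u < - K" using u by (simp add: c2_def)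
        moreover have "(1 / real (Suc n)) * (t + r) \<le> (1 / real (Suc n)) * r" using t by (intro mult_left_mono) auto
        ultimately have "(1 / real (Suc n)) * (t + r) - u < - K" by linarith
        with r show ?thesis unfolding k2_def by (simp only: van) simp
      qed
      show "set_integrable lborel {..0} (\<lambda>r. w r *\<^sub>R k2 n r)"
        unfolding w_def by (rule kernel_integral(1)[OF a 1 2 3 4])
      show "norm (J (k2 n)) \<le> B2 n * (c2 n powr (H - 1 / 2 + 1) / (H - 1 / 2 + 1))"
        unfolding w_def J_def by (rule kernel_integral(2)[OF a 1 2 3 4])
    qed
    have D_G: "D (G n) t = D f (t - u) - D f (- u) - (1 / \<alpha>) *\<^sub>R J (k2 n)" for n
    proof -
      have pG: "path_deriv (G n) s = g 1 (s - u) - (1 / real (Suc n)) *\<^sub>R g 1 ((1 / real (Suc n)) * s - u)" if s: "s \<le> 0" for s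
      proof (rule path_deriv_eq[OF _ _ s])
        show "((\<lambda>s. g 0 (1 * s - u) - g 0 ((1 / real (Suc n)) * s - u)) has_vector_derivative
            g 1 (s - u) - (1 / real (Suc n)) *\<^sub>R g 1 ((1 / real (Suc n)) * s - u)) (at s within {..0})"
          using has_vector_derivative_affine_atMost[of "g 0" "g (Suc 0)" 1 u s]
            has_vector_derivative_affine_atMost[of "g 0" "g (Suc 0)" "1 / real (Suc n)" u s] g u s
          by (intro has_vector_derivative_diff) (auto simp del: of_nat_Suc)
      qed (simp add: G_def)
      \<comment> \<open>Adding and subtracting \<open>g 1 r\<close> turns the unstretched part into
        the integrand of \<open>D f (t - u)\<close> minus that of \<open>D f (- u)\<close>.\<close>
      have "J (\<lambda>r. path_deriv (G n) (t + r) - path_deriv (G n) r)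
          = J (\<lambda>r. ((g 1 (t - u + r) - g 1 r) - (g 1 (- u + r) - g 1 r)) - k2 n r)"
        unfolding J_def
      proof (intro set_lebesgue_integral_cong ballI allI impI)
        fix r :: real assume r: "r \<in> {..0}"
        then have 1: "path_deriv (G n) (t + r) = g 1 (t + r - u) - (1 / real (Suc n)) *\<^sub>R g 1 ((1 / real (Suc n)) * (t + r) - u)"
          using t by (intro pG) auto
        have 2: "path_deriv (G n) r = g 1 (r - u) - (1 / real (Suc n)) *\<^sub>R g 1 ((1 / real (Suc n)) * r - u)"
          using r by (intro pG) auto
        show "w r *\<^sub>R (path_deriv (G n) (t + r) - path_deriv (G n) r)
            = w r *\<^sub>R (((g 1 (t - u + r) - g 1 r) - (g 1 (- u + r) - g 1 r)) - k2 n r)"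
          unfolding 1 2 k2_def by (simp add: scaleR_diff_right algebra_simps)
      qed auto
      also have "\<dots> = J (\<lambda>r. g 1 (t - u + r) - g 1 r) - J (\<lambda>r. g 1 (- u + r) - g 1 r) - J (k2 n)"
      proof -
        have tu: "t - u \<le> 0" "- u \<le> 0" using t u by auto
        show ?thesis unfolding J_def scaleR_diff_right[of "w _"]
          using set_integral_diff(2)[OF set_integral_diff(1)[OF i1[OF tu(1)] i1[OF tu(2)]] k2(1)[of n]]
            set_integral_diff(2)[OF i1[OF tu(1)] i1[OF tu(2)]]
          by (simp only: scaleR_diff_right[of "w _"])
      qed
      finally show ?thesis
        unfolding frac_operator_C0_inf[OF GC t] using D_f[of "t - u"] D_f[of "- u"] t u
        by (simp add: J_def w_def scaleR_diff_right)
    qed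
    \<comment> \<open>The bound is at most of order \<open>n powr (H - 3 / 2)\<close>: two factors
      \<open>1 / n\<close> against kernel mass of order \<open>n powr (H + 1 / 2)\<close>.\<close>
    have "(\<lambda>n. B2 n * (c2 n powr (H - 1 / 2 + 1) / (H - 1 / 2 + 1))) \<longlonglongrightarrow> 0"
      unfolding B2_def c2_def using K L2 H by real_asymp
    then have "(\<lambda>n. J (k2 n)) \<longlonglongrightarrow> 0"
      by (rule Lim_null_comparison[rotated]) (use k2(2) in auto)
    then have "(\<lambda>n. D f (t - u) - D f (- u) - (1 / \<alpha>) *\<^sub>R J (k2 n)) \<longlonglongrightarrow> D f (t - u) - D f (- u) - (1 / \<alpha>) *\<^sub>R 0"
      by (intro tendsto_intros)
    then show ?thesis by (simp add: D_G)
  qed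
  ultimately show "D (shift u f) t = D f (t - u) - D f (- u)" by (rule LIMSEQ_unique)
qed

text \<open>Both sides depend continuously on \<open>\<zeta>\<close> in the norm of
  \<open>BH H\<close>, by \<open>holder_norm_shift\<close> and the continuity of \<open>D\<close>,
  and \<open>C0_inf\<close> is dense.\<close>

lemma frac_operator_shift:
  assumes \<zeta>: "\<zeta> \<in> BH H" and u: "0 \<le> u" and t: "t \<le> 0"
  shows "shift u \<zeta> \<in> BH H" "D (shift u \<zeta>) t = D \<zeta> (t - u) - D \<zeta> (- u)"
proof -
  have "\<exists>f\<in>C0_inf. holder_norm H (\<lambda>t. \<zeta> t - f t) \<le> ennreal (1 / real (Suc n))" for n
    using BH_approx[OF \<zeta>, of "1 / real (Suc n)"] by (metis less_imp_le of_nat_0_less_iff zero_less_Suc zero_less_divide_1_iff)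
  then obtain f where f: "\<And>n. f n \<in> C0_inf" "\<And>n. holder_norm H (\<lambda>t. \<zeta> t - f n t) \<le> ennreal (1 / real (Suc n))"
    by metis
  have fBH: "f n \<in> BH H" for n by (rule C0_inf_in_BH[OF H f(1)])
  have sf: "shift u (f n) \<in> BH H" for n by (rule frac_operator_shift_C0_inf(1)[OF f(1) u t])
  define c where "c n = 1 / real (Suc n) * sqrt (1 + 2 * u)" for n
  have c0: "c \<longlonglongrightarrow> 0" unfolding c_def by real_asymp
  have dist: "holder_norm H (\<lambda>t. shift u \<zeta> t - shift u (f n) t) \<le> ennreal (c n)" for n
    unfolding c_def by (rule holder_norm_shift[OF f(2) _ u]) simp
  show sBH: "shift u \<zeta> \<in> BH H"
  proof (rule BH_closed)
    show "shift u \<zeta> t = 0" if "0 \<le> t" for t using that by (auto simp: shift_def)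
    fix e :: real assume "e > 0"
    then have "eventually (\<lambda>n. c n < e) sequentially" using c0 by (intro order_tendstoD) auto
    then obtain n where n: "c n < e" by (auto simp: eventually_sequentially)
    have "holder_norm H (\<lambda>t. shift u \<zeta> t - shift u (f n) t) < ennreal e"
      by (rule le_less_trans[OF dist[of n] ennreal_lessI]) (use n \<open>e > 0\<close> in auto)
    then show "\<exists>\<eta>\<in>BH H. holder_norm H (\<lambda>t. shift u \<zeta> t - \<eta> t) < ennreal e"
      using sf by blast
  qed
  have "(\<lambda>n. D (shift u (f n)) t) \<longlonglongrightarrow> D (shift u \<zeta>) t"
    by (rule BH_continuous_map_sequentially[OF continuous_map_frac_operator sBH sf _ c0 dist]) (use u in \<open>simp add: c_def\<close>)
  moreover have "(\<lambda>n. D (f n) s) \<longlonglongrightarrow> D \<zeta> s" for s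
    by (rule BH_continuous_map_sequentially[OF continuous_map_frac_operator \<zeta> fBH _ _ f(2)]) (simp, real_asymp)
  then have "(\<lambda>n. D (f n) (t - u) - D (f n) (- u)) \<longlonglongrightarrow> D \<zeta> (t - u) - D \<zeta> (- u)"
    by (intro tendsto_diff)
  moreover have "D (shift u (f n)) t = D (f n) (t - u) - D (f n) (- u)" for n
    by (rule frac_operator_shift_C0_inf(2)[OF f(1) u t])
  ultimately show "D (shift u \<zeta>) t = D \<zeta> (t - u) - D \<zeta> (- u)"
    using LIMSEQ_unique by fastforce
qed

end

section \<open>Differential equations with additive noise\<close>

lemma gronwall_differential:
  fixes v v' :: "real \<Rightarrow> real"
  assumes T: "0 \<le> T"
    and v: "\<And>t. t \<in> {0..T} \<Longrightarrow> (v has_real_derivative v' t) (at t within {0..T})"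
    and le: "\<And>t. t \<in> {0..T} \<Longrightarrow> v' t \<le> a * v t"
  shows "v T \<le> exp (a * T) * v 0"
proof -
  define w where "w t = exp (- a * t) * v t" for t
  have w: "(w has_real_derivative exp (- a * t) * (v' t - a * v t)) (at t within {0..T})" if "t \<in> {0..T}" for t
    unfolding w_def by (auto intro!: derivative_eq_intros v[OF that] simp: algebra_simps)
  have "w T \<le> w 0"
  proof (rule DERIV_nonpos_imp_decreasing_open[OF T])
    fix t assume t: "0 < t" "t < T"
    have "at t within {0..T} = at t" using t by (simp add: at_within_Icc_at)
    then show "\<exists>y. (w has_real_derivative y) (at t) \<and> y \<le> 0"
      using w[of t] le[of t] t by (auto intro!: exI[of _ "exp (- a * t) * (v' t - a * v t)"] mult_nonneg_nonpos)
  next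
    show "continuous_on {0..T} w"
      using w by (intro DERIV_continuous_on) auto
  qed
  then have "exp (a * T) * (exp (- a * T) * v T) \<le> exp (a * T) * v 0"
    unfolding w_def by (intro mult_left_mono) auto
  then show ?thesis by (simp add: exp_minus mult.assoc[symmetric])
qed

text \<open>The noise cancels in the difference, which is differentiable even where the solutions
  are not. Adding \<open>c / b\<close> absorbs the constant \<open>c\<close>, and the shifted
  squared distance satisfies a linear inequality of rate \<open>2 * b\<close>. A negative
  \<open>b\<close> will bound distances uniformly in time; a positive \<open>b\<close> with
  \<open>c = 0\<close> will give uniqueness and Lipschitz dependence.\<close>

lemma solution_difference:
  fixes y z :: "real \<Rightarrow> 'a::euclidean_space" and F :: "'a \<Rightarrow> 'a"
  assumes T: "0 \<le> T" and F: "continuous_on UNIV F"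
    and y: "continuous_on {0..T} y" and z: "continuous_on {0..T} z"
    and eq: "\<And>t. t \<in> {0..T} \<Longrightarrow>
      y t - z t = y 0 - z 0 + (integral {0..t} (\<lambda>s. F (y s)) - integral {0..t} (\<lambda>s. F (z s)))"
    and diss: "\<And>x x'. (F x' - F x) \<bullet> (x' - x) \<le> c + b * (norm (x' - x))\<^sup>2" and b: "b \<noteq> 0"
  shows "(norm (y T - z T))\<^sup>2 + c / b \<le> exp (2 * b * T) * ((norm (y 0 - z 0))\<^sup>2 + c / b)"
proof -
  have Fy: "continuous_on {0..T} (\<lambda>s. F (y s))" and Fz: "continuous_on {0..T} (\<lambda>s. F (z s))"
    using continuous_on_compose2[OF F y] continuous_on_compose2[OF F z] by auto
  define u where "u t = y t - z t" for t
  have u: "(u has_vector_derivative F (y t) - F (z t)) (at t within {0..T})" if t: "t \<in> {0..T}" for t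
  proof -
    have "((\<lambda>t. (y 0 - z 0) + (integral {0..t} (\<lambda>s. F (y s)) - integral {0..t} (\<lambda>s. F (z s))))
        has_vector_derivative 0 + (F (y t) - F (z t))) (at t within {0..T})"
      by (intro has_vector_derivative_add has_vector_derivative_diff has_vector_derivative_const
          integral_has_vector_derivative[OF Fy t] integral_has_vector_derivative[OF Fz t])
    then have X: "((\<lambda>t. (y 0 - z 0) + (integral {0..t} (\<lambda>s. F (y s)) - integral {0..t} (\<lambda>s. F (z s))))
        has_vector_derivative F (y t) - F (z t)) (at t within {0..T})" by simp
    show ?thesis
      by (rule has_vector_derivative_transform[OF t _ X]) (unfold u_def, rule eq)
  qed
  have d1: "((\<lambda>t. (norm (u t))\<^sup>2 + c / b) has_real_derivative 2 * (u t \<bullet> (F (y t) - F (z t)))) (at t within {0..T})"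
    if t: "t \<in> {0..T}" for t
  proof -
    have "((\<lambda>t. u t \<bullet> u t) has_vector_derivative u t \<bullet> (F (y t) - F (z t)) + (F (y t) - F (z t)) \<bullet> u t) (at t within {0..T})"
      by (rule bounded_bilinear.has_vector_derivative[OF bounded_bilinear_inner u[OF t] u[OF t]])
    then have "((\<lambda>t. u t \<bullet> u t) has_real_derivative 2 * (u t \<bullet> (F (y t) - F (z t)))) (at t within {0..T})"
      by (simp add: has_real_derivative_iff_has_vector_derivative inner_commute)
    then have "((\<lambda>t. u t \<bullet> u t + c / b) has_real_derivative 2 * (u t \<bullet> (F (y t) - F (z t))) + 0) (at t within {0..T})"
      by (intro DERIV_add DERIV_const)
    then show ?thesis by (simp add: power2_norm_eq_inner)
  qed
  have d2: "2 * (u t \<bullet> (F (y t) - F (z t))) \<le> 2 * b * ((norm (u t))\<^sup>2 + c / b)" for t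
    using diss[of "y t" "z t"] b by (simp add: u_def inner_commute algebra_simps)
  have "(norm (u T))\<^sup>2 + c / b \<le> exp (2 * b * T) * ((norm (u 0))\<^sup>2 + c / b)"
    by (rule gronwall_differential[OF T d1 d2])
  then show ?thesis by (simp add: u_def)
qed

text \<open>Against the weight \<open>exp (2 * L * u)\<close> an integral operator with Lipschitz
  constant \<open>L\<close> contracts by the factor \<open>1 / 2\<close>; the powers of 2 in the
  Picard estimate originate here.\<close>

lemma integral_exp_bound:
  assumes t: "0 \<le> t" and L: "(0::real) < L"
  shows "(\<integral>u. indicator {0..t} u * (L * (K * exp (2 * L * u))) \<partial>lborel) = K * (exp (2 * L * t) - 1) / 2"
    and "integrable lborel (\<lambda>u. indicator {0..t} u * (L * (K * exp (2 * L * u))))"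
proof -
  have c: "continuous_on {0..t} (\<lambda>u. L * (K * exp (2 * L * u)))" by (intro continuous_intros)
  then have s: "set_integrable lborel {0..t} (\<lambda>u. L * (K * exp (2 * L * u)))"
    by (rule borel_integrable_atLeastAtMost')
  then show "integrable lborel (\<lambda>u. indicator {0..t} u * (L * (K * exp (2 * L * u))))"
    by (simp add: set_integrable_def)
  have "((\<lambda>u. L * (K * exp (2 * L * u))) has_integral (K * exp (2 * L * t) / 2 - K * exp (2 * L * 0) / 2)) {0..t}"
    using L by (intro fundamental_theorem_of_calculus[OF t])
      (auto intro!: derivative_eq_intros simp: has_real_derivative_iff_has_vector_derivative[symmetric])
  then have "integral {0..t} (\<lambda>u. L * (K * exp (2 * L * u))) = K * (exp (2 * L * t) - 1) / 2"
    by (auto dest!: integral_unique simp: field_simps)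
  then show "(\<integral>u. indicator {0..t} u * (L * (K * exp (2 * L * u))) \<partial>lborel) = K * (exp (2 * L * t) - 1) / 2"
    using set_borel_integral_eq_integral(2)[OF s] by (simp only: set_lebesgue_integral_def real_scaleR_def)
qed

text \<open>Picard iteration with the drift truncated outside a ball. The iterates depend measurably on
  all arguments, and they converge to the solution as soon as the ball contains it.\<close>

lemma solution_measurable:
  fixes F :: "'a::euclidean_space \<Rightarrow> 'a" and b :: "real \<Rightarrow> 'w \<Rightarrow> 'a" and Y :: "real \<Rightarrow> 'w \<Rightarrow> 'a \<Rightarrow> 'a"
  assumes lip: "\<And>R::nat. \<exists>L. \<forall>x\<in>cball 0 R. \<forall>y\<in>cball 0 R. norm (F x - F y) \<le> L * norm (x - y)"
    and F: "continuous_on UNIV F"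
    and bm: "(\<lambda>(t, w). b t w) \<in> borel_measurable (borel \<Otimes>\<^sub>M M)"
    and cont: "\<And>w x. w \<in> space M \<Longrightarrow> continuous_on {0..} (\<lambda>t. Y t w x)"
    and sol: "\<And>w x t. w \<in> space M \<Longrightarrow> 0 \<le> t \<Longrightarrow> Y t w x = x + integral {0..t} (\<lambda>s. F (Y s w x)) + b t w"
  shows "(\<lambda>(t, w, x). Y (max 0 t) w x) \<in> borel \<Otimes>\<^sub>M (M \<Otimes>\<^sub>M borel) \<rightarrow>\<^sub>M borel"
proof -
  \<comment> \<open>Composing with the projection onto a ball makes the drift globally Lipschitz and
    bounded without changing it inside the ball.\<close>
  define Fr where "Fr R x = F (closest_point (cball 0 (real R)) x)" for R :: nat and x
  \<comment> \<open>The upper limit of integration enters through an indicator, so that joint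
    measurability in time, noise and starting point passes from one iterate to the next.\<close>
  define Z where "Z R n = rec_nat (\<lambda>p :: real \<times> 'w \<times> 'a. snd (snd p))
      (\<lambda>n z p. snd (snd p) + (\<integral>u. (if 0 \<le> u \<and> u \<le> fst p then 1 else 0) *\<^sub>R Fr R (z (u, snd p)) \<partial>lborel) + b (fst p) (fst (snd p))) n"
    for R n
  have Z0: "Z R 0 p = snd (snd p)" and
    ZS: "Z R (Suc n) p = snd (snd p) + (\<integral>u. (if 0 \<le> u \<and> u \<le> fst p then 1 else 0) *\<^sub>R Fr R (Z R n (u, snd p)) \<partial>lborel) + b (fst p) (fst (snd p))"
    for R n p
    by (simp_all add: Z_def)
  have FrL: "\<exists>L>0. \<forall>x y. norm (Fr R x - Fr R y) \<le> L * norm (x - y)" for R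
  proof -
    obtain L where L: "\<And>x y. x \<in> cball 0 (real R) \<Longrightarrow> y \<in> cball 0 (real R) \<Longrightarrow> norm (F x - F y) \<le> L * norm (x - y)"
      using lip[of R] by blast
    have cp: "closest_point (cball 0 (real R)) x \<in> cball 0 (real R)" for x :: 'a
      by (rule closest_point_in_set) auto
    have "norm (Fr R x - Fr R y) \<le> (\<bar>L\<bar> + 1) * norm (x - y)" for x y
    proof -
      let ?p = "closest_point (cball 0 (real R))"
      have "norm (Fr R x - Fr R y) \<le> L * norm (?p x - ?p y)" unfolding Fr_def by (rule L[OF cp cp])
      also have "\<dots> \<le> (\<bar>L\<bar> + 1) * norm (?p x - ?p y)" by (intro mult_right_mono) auto
      also have "norm (?p x - ?p y) \<le> norm (x - y)"
        using closest_point_lipschitz[of "cball 0 (real R)" x y] by (simp add: dist_norm)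
      finally show ?thesis by (simp add: mult_left_mono)
    qed
    then show ?thesis by (intro exI[of _ "\<bar>L\<bar> + 1"]) auto
  qed
  have FrB: "\<exists>B. \<forall>x. norm (Fr R x) \<le> B" for R
  proof -
    have "compact (F ` cball 0 (real R))"
      by (intro compact_continuous_image continuous_on_subset[OF F]) auto
    from compact_imp_bounded[OF this] obtain B where "\<forall>y\<in>F ` cball 0 (real R). norm y \<le> B"
      unfolding bounded_iff by blast
    then have B: "\<And>x. x \<in> cball 0 (real R) \<Longrightarrow> norm (F x) \<le> B" by blast
    have "closest_point (cball 0 (real R)) x \<in> cball 0 (real R)" for x :: 'a
      by (rule closest_point_in_set) auto
    then show ?thesis unfolding Fr_def using B by blast
  qed
  have Frm [measurable]: "Fr R \<in> borel_measurable borel" for R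
  proof (rule borel_measurable_continuous_onI)
    show "continuous_on UNIV (Fr R)"
      unfolding Fr_def[abs_def]
      by (rule continuous_on_compose2[OF F continuous_on_closest_point]) auto
  qed
  have bm' [measurable]: "(\<lambda>p. b (fst p) (fst (snd p))) \<in> borel_measurable (borel \<Otimes>\<^sub>M (M \<Otimes>\<^sub>M borel))"
    using measurable_compose[of "\<lambda>p. (fst p, fst (snd p))" "borel \<Otimes>\<^sub>M (M \<Otimes>\<^sub>M borel)" "borel \<Otimes>\<^sub>M M" _ borel, OF _ bm]
    by simp
  have Zm [measurable]: "Z R n \<in> borel_measurable (borel \<Otimes>\<^sub>M (M \<Otimes>\<^sub>M borel))" for R n
  proof (induction n)
    case 0
    then show ?case unfolding Z0[abs_def] by measurable
  next
    case (Suc n)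
    note [measurable] = Suc
    show ?case unfolding ZS[abs_def] by measurable
  qed
  have conv: "(\<lambda>n. Z R n (t, w, x)) \<longlonglongrightarrow> Y t w x"
    if w: "w \<in> space M" and t: "0 \<le> t" and R: "\<And>s. s \<in> {0..t} \<Longrightarrow> norm (Y s w x) \<le> real R" for R t w x
  proof -
    have Yc: "continuous_on {0..t} (\<lambda>s. Y s w x)" using cont[OF w, of x] by (rule continuous_on_subset) auto
    have FrY: "Fr R (Y s w x) = F (Y s w x)" if "s \<in> {0..t}" for s
      unfolding Fr_def using R[OF that] by (subst closest_point_self) auto
    obtain L where L: "L > 0" "\<And>x y. norm (Fr R x - Fr R y) \<le> L * norm (x - y)" using FrL by blast
    obtain B where B: "\<And>x. norm (Fr R x) \<le> B" using FrB by blast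
    have sec [measurable]: "(\<lambda>u. Z R n (u, w, x)) \<in> borel_measurable borel" for n
      using w by measurable
    have FY: "set_integrable lborel {0..s} (\<lambda>u. F (Y u w x))" if "s \<in> {0..t}" for s
      by (rule borel_integrable_atLeastAtMost', rule continuous_on_compose2[OF F, of _ "\<lambda>u. Y u w x"])
        (use that continuous_on_subset[OF Yc] in auto)
    have FZ: "integrable lborel (\<lambda>u. (if 0 \<le> u \<and> u \<le> s then 1 else 0) *\<^sub>R Fr R (Z R n (u, w, x)))" for s n
    proof (rule Bochner_Integration.integrable_bound)
      show "integrable lborel (\<lambda>u. B * indicator {0..s} u)"
        by (intro integrable_mult_right integrable_real_indicator) (auto simp: emeasure_lborel_Icc_eq)
      show "AE u in lborel. norm ((if 0 \<le> u \<and> u \<le> s then 1 else 0) *\<^sub>R Fr R (Z R n (u, w, x))) \<le> norm (B * indicator {0..s} u)"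
        using B order_trans[OF B abs_ge_self] by (auto simp: indicator_def)
    qed measurable
    define K where "K = real R + norm x"
    have est: "norm (Z R n (s, w, x) - Y s w x) \<le> (K / 2 ^ n) * exp (2 * L * s)" if "s \<in> {0..t}" for s n
      using that
    proof (induction n arbitrary: s)
      case 0
      have "norm (x - Y s w x) \<le> K" using norm_triangle_ineq4[of x "Y s w x"] R[OF 0] by (simp add: K_def)
      also have "\<dots> \<le> K * exp (2 * L * s)"
      proof -
        have "1 \<le> exp (2 * L * s)" "0 \<le> K" using 0 L(1) by (auto simp: K_def add_nonneg_nonneg)
        from mult_left_mono[OF this] show ?thesis by simp
      qed
      finally show ?case by (simp add: Z0)
    next
      case (Suc n)
      have s: "0 \<le> s" using Suc.prems by simp
      have iY: "integrable lborel (\<lambda>u. (if 0 \<le> u \<and> u \<le> s then 1 else 0) *\<^sub>R F (Y u w x))"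
        using FY[OF Suc.prems] unfolding set_integrable_def by (simp add: indicator_def of_bool_def)
      have "integral {0..s} (\<lambda>u. F (Y u w x)) = (\<integral>u. (if 0 \<le> u \<and> u \<le> s then 1 else 0) *\<^sub>R F (Y u w x) \<partial>lborel)"
        using set_borel_integral_eq_integral(2)[OF FY[OF Suc.prems]]
        by (simp add: set_lebesgue_integral_def indicator_def of_bool_def)
      then have eq: "Z R (Suc n) (s, w, x) - Y s w x
          = (\<integral>u. (if 0 \<le> u \<and> u \<le> s then 1 else 0) *\<^sub>R Fr R (Z R n (u, w, x))
             - (if 0 \<le> u \<and> u \<le> s then 1 else 0) *\<^sub>R F (Y u w x) \<partial>lborel)"
        using FZ[of s n] iY by (simp add: ZS sol[OF w s, of x])
      have "norm (Z R (Suc n) (s, w, x) - Y s w x)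
          \<le> (\<integral>u. norm ((if 0 \<le> u \<and> u \<le> s then 1 else 0) *\<^sub>R Fr R (Z R n (u, w, x))
             - (if 0 \<le> u \<and> u \<le> s then 1 else 0) *\<^sub>R F (Y u w x)) \<partial>lborel)"
        unfolding eq by (rule integral_norm_bound)
      also have "\<dots> \<le> (\<integral>u. indicator {0..s} u * (L * ((K / 2 ^ n) * exp (2 * L * u))) \<partial>lborel)"
      proof (rule integral_mono)
        show "integrable lborel (\<lambda>u. norm ((if 0 \<le> u \<and> u \<le> s then 1 else 0) *\<^sub>R Fr R (Z R n (u, w, x))
             - (if 0 \<le> u \<and> u \<le> s then 1 else 0) *\<^sub>R F (Y u w x)))"
          by (rule integrable_norm[OF Bochner_Integration.integrable_diff[OF FZ iY]])
        show "integrable lborel (\<lambda>u. indicator {0..s} u * (L * ((K / 2 ^ n) * exp (2 * L * u))))"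
          by (rule integral_exp_bound(2)[OF s L(1)])
        fix u :: real
        show "norm ((if 0 \<le> u \<and> u \<le> s then 1 else 0) *\<^sub>R Fr R (Z R n (u, w, x))
             - (if 0 \<le> u \<and> u \<le> s then 1 else 0) *\<^sub>R F (Y u w x))
            \<le> indicator {0..s} u * (L * ((K / 2 ^ n) * exp (2 * L * u)))"
        proof (cases "u \<in> {0..s}")
          case True
          then have u: "u \<in> {0..t}" using Suc.prems by auto
          have "norm (Fr R (Z R n (u, w, x)) - F (Y u w x)) \<le> L * norm (Z R n (u, w, x) - Y u w x)"
            using L(2)[of "Z R n (u, w, x)" "Y u w x"] by (simp add: FrY[OF u])
          also have "\<dots> \<le> L * ((K / 2 ^ n) * exp (2 * L * u))"
            using L(1) Suc.IH[OF u] by (intro mult_left_mono) auto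
          finally show ?thesis using True by simp
        qed auto
      qed
      also have "\<dots> = (K / 2 ^ n) * (exp (2 * L * s) - 1) / 2" by (rule integral_exp_bound(1)[OF s L(1)])
      also have "\<dots> \<le> (K / 2 ^ Suc n) * exp (2 * L * s)"
        by (simp add: K_def field_simps)
      finally show ?case .
    qed
    have "(\<lambda>n. (K / 2 ^ n) * exp (2 * L * t)) \<longlonglongrightarrow> 0"
    proof -
      have "(\<lambda>n. (K * exp (2 * L * t)) * (1 / 2) ^ n) \<longlonglongrightarrow> 0"
        by (intro tendsto_mult_right_zero LIMSEQ_realpow_zero) auto
      then show ?thesis by (simp add: power_divide mult.commute)
    qed
    then have "(\<lambda>n. Z R n (t, w, x) - Y t w x) \<longlonglongrightarrow> 0"
      by (rule Lim_null_comparison[rotated]) (use est t in auto)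
    then show ?thesis by (simp add: LIM_zero_iff)
  qed
  \<comment> \<open>For \<open>R\<close> beyond the bound of the solution on the given time interval
    the limit in \<open>n\<close> is exactly the solution, so the limit in \<open>R\<close> is
    eventually constant. For smaller \<open>R\<close> the value of \<open>lim\<close> is never
    inspected.\<close>
  define A where "A R p = lim (\<lambda>n. Z R n (max 0 (fst p), snd p))" for R and p :: "real \<times> 'w \<times> 'a"
  have Am: "A R \<in> borel_measurable (borel \<Otimes>\<^sub>M (M \<Otimes>\<^sub>M borel))" for R
    unfolding A_def by measurable
  show ?thesis
  proof (rule borel_measurable_LIMSEQ_metric[OF Am])
    fix p :: "real \<times> 'w \<times> 'a" assume p: "p \<in> space (borel \<Otimes>\<^sub>M (M \<Otimes>\<^sub>M (borel :: 'a measure)))"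
    obtain t w x where twx: "p = (t, w, x)" by (cases p) auto
    have w: "w \<in> space M" using p by (simp add: twx space_pair_measure)
    define s where "s = max 0 t"
    have "compact ((\<lambda>s. Y s w x) ` {0..s})"
      by (intro compact_continuous_image continuous_on_subset[OF cont[OF w, of x]]) auto
    from compact_imp_bounded[OF this] obtain B where "\<forall>y\<in>(\<lambda>s. Y s w x) ` {0..s}. norm y \<le> B"
      unfolding bounded_iff by blast
    then have B: "\<And>r. r \<in> {0..s} \<Longrightarrow> norm (Y r w x) \<le> B" by blast
    have "A R p = Y s w x" if "real R \<ge> B" for R
      unfolding A_def using conv[OF w, of s x R] B that by (auto intro!: limI simp: twx s_def intro: order_trans)
    moreover obtain R0 :: nat where "real R0 \<ge> B" using real_arch_simple by blast
    ultimately have "eventually (\<lambda>R. A R p = Y s w x) sequentially"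
      by (auto simp: eventually_sequentially intro!: exI[of _ R0])
    then show "(\<lambda>R. A R p) \<longlonglongrightarrow> (case p of (t, w, x) \<Rightarrow> Y (max 0 t) w x)"
      by (simp add: twx s_def tendsto_eventually)
  qed
qed

section \<open>The fractional equation\<close>

text \<open>The block of length \<open>s\<close> is reversed twice and thereby restored, with its
  constants cancelling since \<open>\<omega>p 0 = 0\<close>. The path \<open>\<omega>''\<close> lies
  behind this block and is replaced by \<open>\<eta>\<close>.\<close>

lemma concat_path_glue:
  fixes \<omega>p \<eta> \<omega>'' :: "('d::finite) hpath"
  assumes s: "0 \<le> s" and z: "\<omega>p 0 = 0"
  shows "concat_path s (\<eta>, concat_path s (\<omega>'', \<omega>p))
    = (\<lambda>q. if q > 0 then 0 else if - s \<le> q then \<omega>p q else \<eta> (q + s) + \<omega>p (- s))"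
  using s z by (auto simp: concat_path_def fun_eq_iff)

text \<open>Noise is read backwards from 0, so feeding \<open>\<omega>p\<close> for time
  \<open>s\<close> and then \<open>\<eta>\<close> for time \<open>t\<close> amounts to feeding for
  time \<open>s + t\<close> the path in which \<open>\<eta>\<close> is attached to
  \<open>\<omega>p\<close> at \<open>- s\<close>.\<close>

lemma concat_path_concat_path:
  fixes \<omega>m \<omega>p \<eta> \<omega>' :: "('d::finite) hpath"
  assumes "0 \<le> s" "0 \<le> t" "\<eta> 0 = 0"
    and "\<omega>' = (\<lambda>q. if q > 0 then 0 else if - s \<le> q then \<omega>p q else \<eta> (q + s) + \<omega>p (- s))"
  shows "concat_path t (concat_path s (\<omega>m, \<omega>p), \<eta>) = concat_path (s + t) (\<omega>m, \<omega>')"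
proof
  fix r
  consider "r > 0" | "r \<le> 0" "- t < r" | "r = - t" | "r < - t" "- (s + t) \<le> r" | "r < - (s + t)"
    using assms(2) by linarith
  then show "concat_path t (concat_path s (\<omega>m, \<omega>p), \<eta>) r = concat_path (s + t) (\<omega>m, \<omega>') r"
    using assms by cases (auto simp: concat_path_def algebra_simps)
qed

lemma concat_path_agree:
  fixes \<omega>m \<omega>p \<omega>' :: "('d::finite) hpath"
  assumes "0 \<le> u" "\<And>q. - u \<le> q \<Longrightarrow> q \<le> 0 \<Longrightarrow> \<omega>' q = \<omega>p q"
  shows "concat_path u (\<omega>m, \<omega>') = concat_path u (\<omega>m, \<omega>p)"
  using assms by (auto simp: concat_path_def fun_eq_iff)

lemma shift_concat_path:
  fixes \<xi> \<eta> :: "('d::finite) hpath"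
  assumes "\<And>t. 0 \<le> t \<Longrightarrow> \<xi> t = 0" "\<eta> 0 = 0" "0 \<le> u"
  shows "shift u (concat_path u (\<xi>, \<eta>)) = \<xi>"
proof
  fix s show "shift u (concat_path u (\<xi>, \<eta>)) s = \<xi> s"
    using assms by (cases "s < 0") (auto simp: shift_def concat_path_def)
qed

lemma differentiable_imp_continuous_UNIV:
  "(\<And>x. F differentiable (at x)) \<Longrightarrow> continuous_on UNIV F"
  by (simp add: continuous_at_imp_continuous_on differentiable_imp_continuous_within)

locale fractional_sde =
  fixes H \<alpha> :: real
    and P :: "('d::finite) hpath measure"
    and D :: "'d hpath \<Rightarrow> 'd hpath"
    and F :: "real ^ 'd \<Rightarrow> real ^ 'd"
    and \<sigma> :: "real ^ 'd ^ 'd"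
    and \<Phi> :: "real \<Rightarrow> 'd hpath \<times> 'd hpath \<Rightarrow> real ^ 'd \<Rightarrow> real ^ 'd"
    and \<mu> :: "((real ^ 'd) \<times> 'd hpath) measure"
    and Bt :: "'d hpath set"
    and \<nu> :: "'d hpath \<Rightarrow> (real ^ 'd) measure"
  assumes H: "0 < H" "H < 1"
    and wiener: "wiener_measure H P"
    and operator: "frac_operator H P \<alpha> D"
    and drift: "drift_conditions H F"
    and solution: "sde_solution H D F \<sigma> \<Phi>"
    and invariant: "invariant_measure H P \<Phi> \<mu>"
    and disint: "disintegration H P \<Phi> \<mu> Bt \<nu>"
begin

section \<open>The law of the past, restricted to the invariant set\<close>

lemma prob_space_P: "prob_space P"
  using wiener by (simp add: wiener_measure_def brownian_motion_def centered_gaussian_process_def)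

lemma sets_P: "sets P = sets (BH_borel H)"
  using wiener by (simp add: wiener_measure_def)

lemma space_P: "space P = BH H"
  using sets_eq_imp_space_eq[OF sets_P] by (simp add: space_BH_borel)

sublocale P: prob_space P by (rule prob_space_P)

lemma Bt_sets: "Bt \<in> sets P" and Bt_prob: "emeasure P Bt = 1"
  using disint by (auto simp: disintegration_def)

lemma Bt_BH: "Bt \<subseteq> BH H"
  using sets.sets_into_space[OF Bt_sets] by (simp add: space_P)

text \<open>The invariance of \<open>Bt\<close> and of \<open>\<nu>\<close> holds for every past in
  \<open>Bt\<close>. With \<open>Bt\<close> as the underlying space it holds at all points of
  \<open>space N\<close>, while fresh noise keeps the full space of \<open>P\<close>.\<close>

definition N :: "'d hpath measure" where "N = restrict_space P Bt"

lemma space_N: "space N = Bt"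
  using Bt_BH by (auto simp: N_def space_restrict_space space_P)

lemma sets_N_iff: "A \<in> sets N \<longleftrightarrow> A \<in> sets P \<and> A \<subseteq> Bt"
  unfolding N_def using Bt_sets by (subst sets_restrict_space_iff) auto

lemma emeasure_N: "A \<in> sets N \<Longrightarrow> emeasure N A = emeasure P A"
  unfolding N_def by (rule emeasure_restrict_space) (use Bt_sets in \<open>auto simp: sets_N_iff[unfolded N_def]\<close>)

sublocale N: prob_space N
  by (rule prob_spaceI) (use Bt_sets in \<open>simp add: space_N emeasure_N sets_N_iff Bt_prob\<close>)

lemma AE_Bt: "AE \<omega> in P. \<omega> \<in> Bt"
  using Bt_prob by (intro P.AE_prob_1) (simp add: P.emeasure_eq_measure)

lemma measurable_N_P: "f \<in> P \<rightarrow>\<^sub>M X \<Longrightarrow> f \<in> N \<rightarrow>\<^sub>M X"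
  unfolding N_def by (rule measurable_restrict_space1)

lemma integral_N_P:
  fixes h :: "'d hpath \<Rightarrow> real"
  assumes "h \<in> borel_measurable P"
  shows "(\<integral>\<eta>. h \<eta> \<partial>N) = (\<integral>\<eta>. h \<eta> \<partial>P)"
proof -
  have "(\<integral>\<eta>. h \<eta> \<partial>N) = (\<integral>\<eta>. indicator Bt \<eta> *\<^sub>R h \<eta> \<partial>P)"
    unfolding N_def using Bt_sets by (intro integral_restrict_space) (simp add: sets.Int)
  also have "\<dots> = (\<integral>\<eta>. h \<eta> \<partial>P)"
    using assms Bt_sets AE_Bt by (intro integral_cong_AE) auto
  finally show ?thesis .
qed

lemma nn_integral_N_P:
  assumes "h \<in> borel_measurable P"
  shows "(\<integral>\<^sup>+\<eta>. h \<eta> \<partial>N) = (\<integral>\<^sup>+\<eta>. h \<eta> \<partial>P)"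
proof -
  have "(\<integral>\<^sup>+\<eta>. h \<eta> \<partial>N) = (\<integral>\<^sup>+\<eta>. h \<eta> * indicator Bt \<eta> \<partial>P)"
    unfolding N_def using Bt_sets by (intro nn_integral_restrict_space) (simp add: sets.Int)
  also have "\<dots> = (\<integral>\<^sup>+\<eta>. h \<eta> \<partial>P)"
    by (intro nn_integral_cong_AE) (use AE_Bt in \<open>eventually_elim, simp\<close>)
  finally show ?thesis .
qed

lemma Bt_nonempty: "Bt \<noteq> {}"
  using Bt_prob by auto

lemma concat_Bt: "\<omega>m \<in> Bt \<Longrightarrow> \<omega>p \<in> BH H \<Longrightarrow> 0 \<le> t \<Longrightarrow> concat_path t (\<omega>m, \<omega>p) \<in> Bt"
  using disint unfolding disintegration_def by blast

lemma distr_disint: "\<omega>m \<in> Bt \<Longrightarrow> \<omega>p \<in> BH H \<Longrightarrow> 0 \<le> t \<Longrightarrow>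
    distr (\<nu> \<omega>m) borel (\<Phi> t (\<omega>m, \<omega>p)) = \<nu> (concat_path t (\<omega>m, \<omega>p))"
  using disint unfolding disintegration_def by blast

section \<open>Measurability of evaluation and concatenation\<close>

lemma eval_measurable: "(\<lambda>\<omega>. \<omega> t) \<in> borel_measurable P"
  using borel_measurable_BH_continuous[OF continuous_map_eval] sets_P
  by (simp cong: measurable_cong_sets)

lemma eval_joint: "(\<lambda>(u, \<omega>). \<omega> u) \<in> borel_measurable (borel \<Otimes>\<^sub>M P)"
  using caratheodory_measurable[of "\<lambda>u \<omega>. \<omega> u" P] eval_measurable BH_continuous[OF H(2)]
  by (auto simp: space_P)

lemma eval_compose:
  assumes "u \<in> borel_measurable M" "X \<in> M \<rightarrow>\<^sub>M P"
  shows "(\<lambda>w. X w (u w)) \<in> borel_measurable M"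
  using measurable_compose[OF measurable_Pair[OF assms] eval_joint] by simp

text \<open>The invariance of \<open>Bt\<close> places the concatenations in \<open>BH H\<close>;
  measurability can then be checked on evaluations.\<close>

lemma measurable_concat:
  assumes s: "s \<in> borel_measurable M" "\<And>w. w \<in> space M \<Longrightarrow> 0 \<le> s w"
    and X: "X \<in> M \<rightarrow>\<^sub>M N" and Y: "Y \<in> M \<rightarrow>\<^sub>M P"
  shows "(\<lambda>w. concat_path (s w) (X w, Y w)) \<in> M \<rightarrow>\<^sub>M N"
proof -
  have XP: "X \<in> M \<rightarrow>\<^sub>M P" by (rule measurable_restrict_space2_iff[THEN iffD1, THEN conjunct1, of X M P Bt]) (use X in \<open>simp add: N_def\<close>)
  have XB: "X w \<in> Bt" and YB: "Y w \<in> BH H" if "w \<in> space M" for w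
    using measurable_space[OF X that] measurable_space[OF Y that] by (auto simp: space_N space_P)
  have "(\<lambda>w. concat_path (s w) (X w, Y w)) \<in> M \<rightarrow>\<^sub>M BH_borel H"
  proof (rule measurable_BH_borelI[OF H])
    show "concat_path (s w) (X w, Y w) \<in> BH H" if "w \<in> space M" for w
      using concat_Bt[OF XB YB s(2)] that Bt_BH by blast
    fix t :: real
    note [measurable] = s(1) eval_compose[OF _ XP] eval_compose[OF _ Y]
    show "(\<lambda>w. concat_path (s w) (X w, Y w) t) \<in> borel_measurable M"
      unfolding concat_path_def by simp measurable
  qed
  then have "(\<lambda>w. concat_path (s w) (X w, Y w)) \<in> M \<rightarrow>\<^sub>M P"
    using sets_P by (simp cong: measurable_cong_sets)
  then show ?thesis
    unfolding N_def using concat_Bt[OF XB YB s(2)] by (intro measurable_restrict_space2) auto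
qed

lemma concat_joint: "(\<lambda>(t, \<omega>). concat_path (max 0 t) \<omega>) \<in> borel \<Otimes>\<^sub>M (N \<Otimes>\<^sub>M P) \<rightarrow>\<^sub>M N"
  using measurable_concat[of "\<lambda>p. max 0 (fst p)" "borel \<Otimes>\<^sub>M (N \<Otimes>\<^sub>M P)" "\<lambda>p. fst (snd p)" "\<lambda>p. snd (snd p)"]
  by (simp add: split_beta')

lemma concat_measurable: "0 \<le> t \<Longrightarrow> concat_path t \<in> N \<Otimes>\<^sub>M P \<rightarrow>\<^sub>M N"
  using measurable_concat[of "\<lambda>_. t" "N \<Otimes>\<^sub>M P" fst snd] by simp

section \<open>Consequences of the drift conditions\<close>

lemma F_continuous: "continuous_on UNIV F"
  using drift by (intro differentiable_imp_continuous_UNIV) (simp add: drift_conditions_def)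

text \<open>The polynomial bound on the derivative is uniform on a ball, and balls are
  convex.\<close>

lemma F_lipschitz_ball: "\<exists>L. \<forall>x\<in>cball 0 (real R). \<forall>y\<in>cball 0 (real R). norm (F x - F y) \<le> L * norm (x - y)"
proof -
  from drift obtain C M where C: "C > 0" "M \<ge> 1" "\<And>x. onorm (frechet_derivative F (at x)) \<le> C * (1 + norm x) powr M"
    and d: "\<And>x. F differentiable (at x)"
    unfolding drift_conditions_def by blast
  have "norm (F x - F y) \<le> (C * (1 + real R) powr M) * norm (x - y)"
    if "x \<in> cball 0 (real R)" "y \<in> cball 0 (real R)" for x y
  proof (rule differentiable_bound[where S="cball 0 (real R)" and f'="\<lambda>x. frechet_derivative F (at x)"])
    show "(F has_derivative frechet_derivative F (at z)) (at z within cball 0 (real R))" for z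
      using d[of z] by (simp add: frechet_derivative_works has_derivative_at_withinI)
    show "onorm (frechet_derivative F (at z)) \<le> C * (1 + real R) powr M" if "z \<in> cball 0 (real R)" for z
    proof -
      have "(1 + norm z) powr M \<le> (1 + real R) powr M" using that C by (intro powr_mono2) auto
      then show ?thesis using C(3)[of z] C(1) by (meson mult_left_mono order_trans less_imp_le)
    qed
  qed (use that in \<open>auto simp: convex_cball\<close>)
  then show ?thesis by blast
qed

text \<open>The minimum is split into two bounds of the shape required by
  \<open>solution_difference\<close>, with \<open>b = - C2\<close> and
  \<open>b = C3\<close>.\<close>

lemma F_dissipative:
  "\<exists>C1>0. \<exists>C2>0. \<exists>C3>0. (\<forall>x x'. (F x' - F x) \<bullet> (x' - x) \<le> C1 + (- C2) * (norm (x' - x))\<^sup>2) \<and>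
    (\<forall>x x'. (F x' - F x) \<bullet> (x' - x) \<le> 0 + C3 * (norm (x' - x))\<^sup>2)"
proof -
  obtain C1 C2 C3 where C: "C1 > 0" "C2 > 0" "C3 > 0"
    "\<And>x y. (F y - F x) \<bullet> (y - x) \<le> min (C1 - C2 * (norm (y - x))\<^sup>2) (C3 * (norm (y - x))\<^sup>2)"
    using drift unfolding drift_conditions_def by blast
  show ?thesis
    by (rule exI[of _ C1], intro conjI C(1), rule exI[of _ C2], intro conjI C(2), rule exI[of _ C3])
      (use C in simp)
qed

lemma fbm_zero:
  assumes "concat_path 0 \<omega> \<in> BH H" shows "fbm_path D 0 \<omega> = 0"
proof -
  have "topspace (BH_top H) = BH H" "topspace (BH_top (1 - H) :: 'd hpath topology) = BH (1 - H)"
    unfolding BH_top_def by (rule Metric_space.topspace_mtopology[OF Metric_space_BH])+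
  then have "D (concat_path 0 \<omega>) \<in> BH (1 - H)"
    using operator assms unfolding frac_operator_def continuous_map_def by auto
  then show ?thesis by (simp add: fbm_path_def BH_zero)
qed

section \<open>Regularity, uniqueness and flow property of the solution\<close>

lemma solution_cont: "\<omega> \<in> BH H \<times> BH H \<Longrightarrow> continuous_on {0..} (\<lambda>t. \<Phi> t \<omega> x)"
  using solution unfolding sde_solution_def by blast

lemma solution_eq: "\<omega> \<in> BH H \<times> BH H \<Longrightarrow> 0 \<le> t \<Longrightarrow>
    \<Phi> t \<omega> x = x + integral {0..t} (\<lambda>s. F (\<Phi> s \<omega> x)) + \<sigma> *v fbm_path D t \<omega>"
  using solution unfolding sde_solution_def by blast

lemma solution_zero: "\<omega> \<in> BH H \<times> BH H \<Longrightarrow> concat_path 0 \<omega> \<in> BH H \<Longrightarrow> \<Phi> 0 \<omega> x = x"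
  using solution_eq[of \<omega> 0 x] by (simp add: fbm_zero)

lemma F_solution_continuous:
  assumes "\<omega> \<in> BH H \<times> BH H" shows "continuous_on {0..} (\<lambda>t. F (\<Phi> t \<omega> x))"
  by (rule continuous_on_compose2[OF F_continuous solution_cont[OF assms]]) auto

lemma Bt_pair: "\<omega> \<in> Bt \<times> BH H \<Longrightarrow> \<omega> \<in> BH H \<times> BH H"
  using Bt_BH by auto

lemma concat_Bt_pair: "\<omega> \<in> Bt \<times> BH H \<Longrightarrow> 0 \<le> t \<Longrightarrow> concat_path t \<omega> \<in> Bt"
  using concat_Bt by auto

lemma solution_start: "\<omega> \<in> Bt \<times> BH H \<Longrightarrow> \<Phi> 0 \<omega> x = x"
  using solution_zero[OF Bt_pair, of \<omega> x] concat_Bt_pair[of \<omega> 0] Bt_BH by auto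

text \<open>Continuity of the noise is read off from the equation, in which every other term is
  continuous in time.\<close>

lemma noise_continuous:
  assumes "\<omega> \<in> BH H \<times> BH H" shows "continuous_on {0..} (\<lambda>t. \<sigma> *v fbm_path D t \<omega>)"
proof -
  let ?I = "\<lambda>t. integral {0..t} (\<lambda>s. F (\<Phi> s \<omega> 0))"
  have I: "continuous_on {0..} ?I"
    unfolding continuous_on_eq_continuous_within
    proof
      fix t :: real assume t: "t \<in> {0..}"
      have "continuous_on {0..t + 1} ?I"
        by (rule indefinite_integral_continuous_1[OF integrable_continuous_interval])
          (rule continuous_on_subset[OF F_solution_continuous[OF assms]], auto)
      then have "continuous (at t within {0..t + 1}) ?I"
        using t by (auto simp: continuous_on_eq_continuous_within)
      moreover have "at t within {0..} = at t within {0..t + 1}"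
        by (rule at_within_nhd[of _ "{..<t + 1}"]) auto
      ultimately show "continuous (at t within {0..}) ?I" by (simp add: continuous_within)
    qed
  have "continuous_on {0..} (\<lambda>t. \<Phi> t \<omega> 0 - ?I t)"
    by (intro continuous_on_diff solution_cont[OF assms] I)
  then show ?thesis
    by (rule continuous_on_eq) (use solution_eq[OF assms, of _ 0] in auto)
qed

lemma noise_measurable: "(\<lambda>(t, \<omega>). \<sigma> *v fbm_path D (max 0 t) \<omega>) \<in> borel_measurable (borel \<Otimes>\<^sub>M (N \<Otimes>\<^sub>M P))"
proof (rule caratheodory_measurable)
  fix t :: real
  let ?t = "max 0 t"
  have c: "concat_path ?t \<in> N \<Otimes>\<^sub>M P \<rightarrow>\<^sub>M P"
    using concat_measurable[of ?t] unfolding N_def[symmetric]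
    by (metis N_def max.cobounded1 measurable_restrict_space2_iff)
  have "(\<lambda>\<omega>. D \<omega> (- ?t)) \<in> borel_measurable P"
    using borel_measurable_BH_continuous[OF continuous_map_frac_operator[OF H operator]] sets_P
    by (simp cong: measurable_cong_sets)
  from measurable_compose[OF c this] have "(\<lambda>\<omega>. fbm_path D ?t \<omega>) \<in> borel_measurable (N \<Otimes>\<^sub>M P)"
    unfolding fbm_path_def by simp
  moreover have "(\<lambda>x. \<sigma> *v x) \<in> borel_measurable borel"
    by (intro borel_measurable_continuous_onI linear_continuous_on matrix_vector_mul_bounded_linear)
  ultimately show "(\<lambda>\<omega>. \<sigma> *v fbm_path D ?t \<omega>) \<in> borel_measurable (N \<Otimes>\<^sub>M P)"
    by (rule measurable_compose)
next
  fix \<omega> assume "\<omega> \<in> space (N \<Otimes>\<^sub>M P)"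
  then have "\<omega> \<in> BH H \<times> BH H" using Bt_BH by (auto simp: space_pair_measure space_N space_P)
  then show "continuous_on UNIV (\<lambda>t. \<sigma> *v fbm_path D (max 0 t) \<omega>)"
    by (intro continuous_on_compose2[OF noise_continuous, of _ UNIV "\<lambda>t. max 0 t"] continuous_intros) auto
qed

lemma solution_joint: "(\<lambda>(t, \<omega>, x). \<Phi> (max 0 t) \<omega> x) \<in> borel \<Otimes>\<^sub>M ((N \<Otimes>\<^sub>M P) \<Otimes>\<^sub>M borel) \<rightarrow>\<^sub>M borel"
proof (rule solution_measurable[OF F_lipschitz_ball F_continuous noise_measurable])
  fix \<omega> and x assume "\<omega> \<in> space (N \<Otimes>\<^sub>M P)"
  then have \<omega>: "\<omega> \<in> BH H \<times> BH H" using Bt_BH by (auto simp: space_pair_measure space_N space_P)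
  show "continuous_on {0..} (\<lambda>t. \<Phi> t \<omega> x)" by (rule solution_cont[OF \<omega>])
  show "\<Phi> t \<omega> x = x + integral {0..t} (\<lambda>s. F (\<Phi> s \<omega> x)) + \<sigma> *v fbm_path D (max 0 t) \<omega>" if "0 \<le> t" for t
    using solution_eq[OF \<omega> that, of x] that by simp
qed


lemma solution_integrable:
  assumes "\<omega> \<in> BH H \<times> BH H" "0 \<le> a"
  shows "(\<lambda>s. F (\<Phi> s \<omega> x)) integrable_on {a..b}"
  by (rule integrable_continuous_interval, rule continuous_on_subset[OF F_solution_continuous[OF assms(1)]])
    (use assms(2) in auto)

lemma solutions_with_equal_noise:
  fixes y z :: "real \<Rightarrow> real ^ 'd"
  assumes T: "0 \<le> T" and y: "continuous_on {0..T} y" and z: "continuous_on {0..T} z"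
    and eq: "\<And>t. t \<in> {0..T} \<Longrightarrow>
      y t - z t = y 0 - z 0 + (integral {0..t} (\<lambda>s. F (y s)) - integral {0..t} (\<lambda>s. F (z s)))"
    and start: "y 0 = z 0"
  shows "y T = z T"
proof -
  obtain C1 C2 C3 where C: "C1 > 0" "C2 > 0" "C3 > 0"
    "\<And>x x'. (F x' - F x) \<bullet> (x' - x) \<le> C1 + (- C2) * (norm (x' - x))\<^sup>2"
    "\<And>x x'. (F x' - F x) \<bullet> (x' - x) \<le> 0 + C3 * (norm (x' - x))\<^sup>2"
    using F_dissipative by blast
  show ?thesis
    using solution_difference[OF T F_continuous y z eq C(5)] C(3) start by simp
qed

lemma solution_unique:
  assumes T: "0 \<le> T" and \<omega>: "\<omega> \<in> BH H \<times> BH H" "\<omega>' \<in> BH H \<times> BH H"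
    and start: "\<Phi> 0 \<omega> x = \<Phi> 0 \<omega>' x"
    and eq: "\<And>t. t \<in> {0..T} \<Longrightarrow> fbm_path D t \<omega> = fbm_path D t \<omega>'"
  shows "\<Phi> T \<omega> x = \<Phi> T \<omega>' x"
proof (rule solutions_with_equal_noise[OF T, of "\<lambda>t. \<Phi> t \<omega> x" "\<lambda>t. \<Phi> t \<omega>' x"])
  show "continuous_on {0..T} (\<lambda>t. \<Phi> t \<omega> x)" "continuous_on {0..T} (\<lambda>t. \<Phi> t \<omega>' x)"
    by (rule continuous_on_subset[OF solution_cont[OF \<omega>(1)]] continuous_on_subset[OF solution_cont[OF \<omega>(2)]], auto)+
  fix t assume t: "t \<in> {0..T}"
  then have t0: "0 \<le> t" by simp
  show "\<Phi> t \<omega> x - \<Phi> t \<omega>' x = \<Phi> 0 \<omega> x - \<Phi> 0 \<omega>' x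
      + (integral {0..t} (\<lambda>s. F (\<Phi> s \<omega> x)) - integral {0..t} (\<lambda>s. F (\<Phi> s \<omega>' x)))"
    using solution_eq[OF \<omega>(1) t0, of x] solution_eq[OF \<omega>(2) t0, of x] eq[OF t] start by simp
qed (use start in simp)

lemma solution_unique_path:
  assumes T: "0 \<le> T" and \<omega>: "\<omega> \<in> Bt \<times> BH H" "\<omega>' \<in> Bt \<times> BH H"
    and eq: "\<And>t. t \<in> {0..T} \<Longrightarrow> concat_path t \<omega> = concat_path t \<omega>'"
  shows "\<Phi> T \<omega> x = \<Phi> T \<omega>' x"
  by (rule solution_unique[OF T Bt_pair[OF \<omega>(1)] Bt_pair[OF \<omega>(2)]])
    (use eq solution_start \<omega> in \<open>auto simp: fbm_path_def\<close>)

text \<open>Concatenations of \<open>\<eta>\<close> and of the zero path with one and the same past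
  from \<open>Bt\<close> lie in \<open>BH H\<close>; in their difference that past cancels.\<close>

lemma zero_past_concat_BH:
  fixes \<eta> :: "'d hpath"
  assumes "\<eta> \<in> BH H" "0 \<le> t"
  shows "concat_path t (\<lambda>_. 0, \<eta>) \<in> BH H"
proof -
  obtain \<omega>m where \<omega>m: "\<omega>m \<in> Bt" using Bt_nonempty by blast
  have "(\<lambda>s. concat_path t (\<omega>m, \<eta>) s - concat_path t (\<omega>m, \<lambda>_. 0) s) \<in> BH H"
    using concat_Bt[OF \<omega>m assms] concat_Bt[OF \<omega>m zero_in_BH assms(2)] Bt_BH by (intro BH_diff) auto
  also have "(\<lambda>s. concat_path t (\<omega>m, \<eta>) s - concat_path t (\<omega>m, \<lambda>_. 0) s) = concat_path t (\<lambda>_. 0, \<eta>)"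
    by (auto simp: concat_path_def fun_eq_iff)
  finally show ?thesis .
qed

text \<open>\<open>theta (- t)\<close> undoes the concatenation: the shift recovers
  \<open>\<omega>m\<close>, and a second reversal recovers \<open>\<omega>p\<close> on the interval
  from \<open>- t\<close> to 0. Beyond it the recovered path is constant, which the solution up to
  time \<open>t\<close> does not see.\<close>

lemma cocycle_concat:
  assumes \<omega>: "\<omega>m \<in> Bt" "\<omega>p \<in> BH H" and t: "0 \<le> t"
  shows "cocycle \<Phi> t (concat_path t (\<omega>m, \<omega>p)) x = \<Phi> t (\<omega>m, \<omega>p) x"
proof -
  define \<eta> where "\<eta> = concat_path t (\<omega>m, \<omega>p)"
  have \<eta>: "\<eta> \<in> Bt" "\<eta> \<in> BH H" using concat_Bt[OF \<omega> t] Bt_BH by (auto simp: \<eta>_def)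
  have z: "\<omega>m r = 0" "\<omega>p r = 0" "\<eta> r = 0" if "0 \<le> r" for r
    using \<omega> \<eta> Bt_BH that by (auto intro: BH_zero)
  show ?thesis
  proof (cases "t = 0")
    \<comment> \<open>At \<open>t = 0\<close> the index \<open>- t\<close> is nonnegative, so
      \<open>theta\<close> takes its other branch.\<close>
    case True
    have e: "concat_path 0 (\<xi>, \<zeta>) = \<xi>" if "\<And>r. 0 \<le> r \<Longrightarrow> \<xi> r = 0" "\<zeta> 0 = 0" for \<xi> \<zeta> :: "'d hpath"
      using that by (auto simp: concat_path_def fun_eq_iff)
    have "\<eta> = \<omega>m" using True e[of \<omega>m \<omega>p] z by (simp add: \<eta>_def)
    moreover have "theta 0 (\<omega>m, \<lambda>_. 0) = (\<omega>m, \<lambda>_. 0)"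
      using e[of \<omega>m "\<lambda>_. 0"] z by (simp add: theta_def) (auto simp: shift_def)
    ultimately have "cocycle \<Phi> t \<eta> x = \<Phi> 0 (\<omega>m, \<lambda>_. 0) x" by (simp add: cocycle_def True)
    moreover have "(\<lambda>_. 0 :: real ^ 'd) \<in> BH H" by (rule zero_in_BH)
    ultimately show ?thesis
      using solution_start[of "(\<omega>m, \<lambda>_. 0)" x] solution_start[of "(\<omega>m, \<omega>p)" x] \<omega>
      by (simp add: True \<eta>_def)
  next
    case False
    have "shift t \<eta> = \<omega>m" unfolding \<eta>_def by (rule shift_concat_path) (use z t in auto)
    then have th: "theta (- t) (\<eta>, \<lambda>_. 0) = (\<omega>m, concat_path t (\<lambda>_. 0, \<eta>))"
      using False t by (simp add: theta_def)
    have "\<Phi> t (\<omega>m, concat_path t (\<lambda>_. 0, \<eta>)) x = \<Phi> t (\<omega>m, \<omega>p) x"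
    proof (rule solution_unique_path[OF t])
      show "concat_path u (\<omega>m, concat_path t (\<lambda>_. 0, \<eta>)) = concat_path u (\<omega>m, \<omega>p)" if "u \<in> {0..t}" for u
        using that z concat_path_glue[OF t, of \<omega>p "\<lambda>_. 0" \<omega>m] unfolding \<eta>_def
        by (intro concat_path_agree) auto
    qed (use \<omega> zero_past_concat_BH[OF \<eta>(2) t] in auto)
    then show ?thesis unfolding cocycle_def \<eta>_def[symmetric] th .
  qed
qed

text \<open>The driving noise of two successive time intervals written as one path:
  \<open>\<omega>p\<close> drives the first \<open>s\<close> units of time and \<open>\<eta>\<close>
  the rest. The constant \<open>\<omega>p (- s)\<close> makes the two pieces meet when
  \<open>\<eta> 0 = 0\<close>.\<close>

definition glue :: "real \<Rightarrow> 'd hpath \<times> 'd hpath \<Rightarrow> 'd hpath" where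
  "glue s = (\<lambda>(\<eta>, \<omega>p) q. if q > 0 then 0 else if - s \<le> q then \<omega>p q else \<eta> (q + s) + \<omega>p (- s))"

lemma glue_eq: "0 \<le> s \<Longrightarrow> \<omega>p \<in> BH H \<Longrightarrow> glue s (\<eta>, \<omega>p) = concat_path s (\<eta>, concat_path s (\<omega>'', \<omega>p))"
  using concat_path_glue[of s \<omega>p \<eta> \<omega>''] by (simp add: glue_def BH_zero)

lemma glue_Bt:
  assumes "0 \<le> s" "\<eta> \<in> Bt" "\<omega>p \<in> BH H" shows "glue s (\<eta>, \<omega>p) \<in> Bt"
  unfolding glue_eq[OF assms(1,3), of \<eta> \<eta>]
  using concat_Bt[OF assms(2) _ assms(1)] concat_Bt[OF assms(2,3,1)] Bt_BH by blast

lemma concat_glue: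
  assumes "0 \<le> s" "0 \<le> t" "\<eta> \<in> BH H"
  shows "concat_path t (concat_path s (\<omega>m, \<omega>p), \<eta>) = concat_path (s + t) (\<omega>m, glue s (\<eta>, \<omega>p))"
  by (rule concat_path_concat_path[OF assms(1,2)]) (use assms(3) in \<open>auto simp: BH_zero glue_def\<close>)

text \<open>The cocycle property of the flow. After time \<open>s\<close> both sides are driven by
  the same noise increments and start from the same point, so Gronwall identifies them.\<close>

lemma flow_glue:
  assumes \<omega>: "\<omega>m \<in> Bt" "\<omega>p \<in> BH H" "\<eta> \<in> Bt" and s: "0 \<le> s" and t: "0 \<le> t"
  shows "\<Phi> t (concat_path s (\<omega>m, \<omega>p), \<eta>) (\<Phi> s (\<omega>m, \<omega>p) x) = \<Phi> (s + t) (\<omega>m, glue s (\<eta>, \<omega>p)) x"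
proof -
  define \<omega>' where "\<omega>' = glue s (\<eta>, \<omega>p)"
  define \<xi> where "\<xi> = concat_path s (\<omega>m, \<omega>p)"
  have \<eta>B: "\<eta> \<in> BH H" using \<omega> Bt_BH by auto
  have \<omega>': "\<omega>' \<in> BH H" using glue_Bt[OF s \<omega>(3,2)] Bt_BH by (auto simp: \<omega>'_def)
  have \<xi>: "\<xi> \<in> Bt" unfolding \<xi>_def by (rule concat_Bt[OF \<omega>(1,2) s])
  have p1: "(\<omega>m, \<omega>') \<in> BH H \<times> BH H" and p2: "(\<xi>, \<eta>) \<in> BH H \<times> BH H"
    using \<omega> \<omega>' \<xi> \<eta>B Bt_BH by auto
  have "concat_path u (\<omega>m, \<omega>') = concat_path u (\<omega>m, \<omega>p)" if "u \<in> {0..s}" for u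
    using that unfolding \<omega>'_def glue_def by (intro concat_path_agree) auto
  then have init: "\<Phi> s (\<omega>m, \<omega>') x = \<Phi> s (\<omega>m, \<omega>p) x" and cs: "concat_path s (\<omega>m, \<omega>') = \<xi>"
    using solution_unique_path[OF s, of "(\<omega>m, \<omega>')" "(\<omega>m, \<omega>p)" x] \<omega> \<omega>' s by (auto simp: \<xi>_def)
  \<comment> \<open>Since \<open>\<xi>\<close> is the shift of \<open>\<zeta>\<close> by
    \<open>u\<close>, the shift identity for \<open>D\<close> turns the increment of the noise after
    time \<open>s\<close> into the noise generated by the past \<open>\<xi>\<close> and the fresh
    path \<open>\<eta>\<close>.\<close>
  have noise: "fbm_path D (s + u) (\<omega>m, \<omega>') - fbm_path D s (\<omega>m, \<omega>') = fbm_path D u (\<xi>, \<eta>)" if u: "0 \<le> u" for u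
  proof -
    define \<zeta> where "\<zeta> = concat_path u (\<xi>, \<eta>)"
    have \<zeta>: "\<zeta> \<in> BH H" using concat_Bt[OF \<xi> \<eta>B u] Bt_BH by (auto simp: \<zeta>_def)
    have "shift u \<zeta> = \<xi>"
      unfolding \<zeta>_def by (rule shift_concat_path) (use \<xi> \<eta>B Bt_BH u in \<open>auto simp: subset_iff BH_zero\<close>)
    then have "D \<xi> (- s) = D \<zeta> (- s - u) - D \<zeta> (- u)"
      using frac_operator_shift(2)[OF H operator \<zeta> u, of "- s"] s by simp
    moreover have "concat_path (s + u) (\<omega>m, \<omega>') = \<zeta>"
      using concat_glue[OF s u \<eta>B, of \<omega>m \<omega>p] by (simp add: \<zeta>_def \<xi>_def \<omega>'_def)
    ultimately show ?thesis by (simp add: fbm_path_def cs \<zeta>_def[symmetric])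
  qed
  have start: "\<Phi> 0 (\<xi>, \<eta>) (\<Phi> s (\<omega>m, \<omega>p) x) = \<Phi> s (\<omega>m, \<omega>p) x"
    by (rule solution_start) (use \<xi> \<eta>B in simp)
  have "\<Phi> t (\<xi>, \<eta>) (\<Phi> s (\<omega>m, \<omega>p) x) = \<Phi> (s + t) (\<omega>m, \<omega>') x"
  proof (rule solutions_with_equal_noise[OF t, of "\<lambda>u. \<Phi> u (\<xi>, \<eta>) (\<Phi> s (\<omega>m, \<omega>p) x)" "\<lambda>u. \<Phi> (s + u) (\<omega>m, \<omega>') x"])
    show "continuous_on {0..t} (\<lambda>u. \<Phi> u (\<xi>, \<eta>) (\<Phi> s (\<omega>m, \<omega>p) x))"
      by (rule continuous_on_subset[OF solution_cont[OF p2]]) auto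
    show "continuous_on {0..t} (\<lambda>u. \<Phi> (s + u) (\<omega>m, \<omega>') x)"
      by (rule continuous_on_compose2[OF solution_cont[OF p1]]) (use s in \<open>auto intro!: continuous_intros\<close>)
    fix u assume "u \<in> {0..t}"
    then have u: "0 \<le> u" by simp
    have "integral {0..s + u} (\<lambda>r. F (\<Phi> r (\<omega>m, \<omega>') x))
        = integral {0..s} (\<lambda>r. F (\<Phi> r (\<omega>m, \<omega>') x)) + integral {s..s + u} (\<lambda>r. F (\<Phi> r (\<omega>m, \<omega>') x))"
      using s u solution_integrable[OF p1 order_refl]
      by (intro Henstock_Kurzweil_Integration.integral_combine[symmetric]) auto
    moreover have "integral {s..s + u} (\<lambda>r. F (\<Phi> r (\<omega>m, \<omega>') x)) = integral {0..u} (\<lambda>r. F (\<Phi> (s + r) (\<omega>m, \<omega>') x))"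
      using integral_shift_Icc_real[of 0 u "\<lambda>r. F (\<Phi> r (\<omega>m, \<omega>') x)" s] by (simp add: o_def add.commute)
    moreover have "\<sigma> *v fbm_path D (s + u) (\<omega>m, \<omega>') = \<sigma> *v fbm_path D s (\<omega>m, \<omega>') + \<sigma> *v fbm_path D u (\<xi>, \<eta>)"
      unfolding matrix_vector_right_distrib[symmetric] noise[OF u, symmetric] by simp
    ultimately have ez: "\<Phi> (s + u) (\<omega>m, \<omega>') x = x + (integral {0..s} (\<lambda>r. F (\<Phi> r (\<omega>m, \<omega>') x))
        + integral {0..u} (\<lambda>r. F (\<Phi> (s + r) (\<omega>m, \<omega>') x))) + (\<sigma> *v fbm_path D s (\<omega>m, \<omega>') + \<sigma> *v fbm_path D u (\<xi>, \<eta>))"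
      using solution_eq[OF p1, of "s + u" x] s u by simp
    define a where "a = \<Phi> s (\<omega>m, \<omega>p) x"
    have ea: "a = x + integral {0..s} (\<lambda>r. F (\<Phi> r (\<omega>m, \<omega>') x)) + \<sigma> *v fbm_path D s (\<omega>m, \<omega>')"
      using solution_eq[OF p1 s, of x] by (simp add: a_def init)
    have ey: "\<Phi> u (\<xi>, \<eta>) a = a + integral {0..u} (\<lambda>r. F (\<Phi> r (\<xi>, \<eta>) a)) + \<sigma> *v fbm_path D u (\<xi>, \<eta>)"
      by (rule solution_eq[OF p2 u])
    have "\<Phi> u (\<xi>, \<eta>) a - \<Phi> (s + u) (\<omega>m, \<omega>') x
        = (a - (x + integral {0..s} (\<lambda>r. F (\<Phi> r (\<omega>m, \<omega>') x)) + \<sigma> *v fbm_path D s (\<omega>m, \<omega>')))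
          + (integral {0..u} (\<lambda>r. F (\<Phi> r (\<xi>, \<eta>) a)) - integral {0..u} (\<lambda>r. F (\<Phi> (s + r) (\<omega>m, \<omega>') x)))"
      unfolding ez by (subst ey) (simp add: algebra_simps)
    also have "a - (x + integral {0..s} (\<lambda>r. F (\<Phi> r (\<omega>m, \<omega>') x)) + \<sigma> *v fbm_path D s (\<omega>m, \<omega>')) = 0"
      using ea by simp
    finally show "\<Phi> u (\<xi>, \<eta>) (\<Phi> s (\<omega>m, \<omega>p) x) - \<Phi> (s + u) (\<omega>m, \<omega>') x
        = \<Phi> 0 (\<xi>, \<eta>) (\<Phi> s (\<omega>m, \<omega>p) x) - \<Phi> (s + 0) (\<omega>m, \<omega>') x
          + (integral {0..u} (\<lambda>r. F (\<Phi> r (\<xi>, \<eta>) (\<Phi> s (\<omega>m, \<omega>p) x))) - integral {0..u} (\<lambda>r. F (\<Phi> (s + r) (\<omega>m, \<omega>') x)))"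
      by (simp add: start init a_def)
  qed (simp add: start init)
  then show ?thesis by (simp add: \<xi>_def \<omega>'_def)
qed

section \<open>Dependence on the initial value\<close>

lemma solution_pair_eq:
  assumes "\<omega> \<in> Bt \<times> BH H" "0 \<le> t"
  shows "\<Phi> t \<omega> x - \<Phi> t \<omega> y = \<Phi> 0 \<omega> x - \<Phi> 0 \<omega> y
      + (integral {0..t} (\<lambda>s. F (\<Phi> s \<omega> x)) - integral {0..t} (\<lambda>s. F (\<Phi> s \<omega> y)))"
  using solution_eq[OF Bt_pair[OF assms(1)] assms(2), of x] solution_eq[OF Bt_pair[OF assms(1)] assms(2), of y]
    solution_start[OF assms(1)] by simp

text \<open>The case \<open>c = 0\<close>, \<open>b = C3\<close> of
  \<open>solution_difference\<close> gives the factor \<open>exp (C3 * t)\<close>, the same for all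
  noise paths.\<close>

lemma solution_lipschitz:
  assumes t: "0 \<le> t"
  shows "\<exists>K. \<forall>\<omega>\<in>Bt \<times> BH H. \<forall>x y. norm (\<Phi> t \<omega> x - \<Phi> t \<omega> y) \<le> K * norm (x - y)"
proof -
  obtain C1 C2 C3 where C: "C1 > 0" "C2 > 0" "C3 > 0"
    "\<And>x x'. (F x' - F x) \<bullet> (x' - x) \<le> C1 + (- C2) * (norm (x' - x))\<^sup>2"
    "\<And>x x'. (F x' - F x) \<bullet> (x' - x) \<le> 0 + C3 * (norm (x' - x))\<^sup>2"
    using F_dissipative by blast
  have "norm (\<Phi> t \<omega> x - \<Phi> t \<omega> y) \<le> sqrt (exp (2 * C3 * t)) * norm (x - y)" if \<omega>: "\<omega> \<in> Bt \<times> BH H" for \<omega> x y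
  proof -
    have c: "continuous_on {0..t} (\<lambda>s. \<Phi> s \<omega> z)" for z
      by (rule continuous_on_subset[OF solution_cont[OF Bt_pair[OF \<omega>]]]) auto
    have "(norm (\<Phi> t \<omega> x - \<Phi> t \<omega> y))\<^sup>2 + 0 / C3 \<le> exp (2 * C3 * t) * ((norm (\<Phi> 0 \<omega> x - \<Phi> 0 \<omega> y))\<^sup>2 + 0 / C3)"
      by (rule solution_difference[OF t F_continuous c c solution_pair_eq[OF \<omega>] C(5)]) (use C(3) in auto)
    then have "(norm (\<Phi> t \<omega> x - \<Phi> t \<omega> y))\<^sup>2 \<le> exp (2 * C3 * t) * (norm (x - y))\<^sup>2"
      by (simp add: solution_start[OF \<omega>])
    then have "norm (\<Phi> t \<omega> x - \<Phi> t \<omega> y) \<le> sqrt (exp (2 * C3 * t) * (norm (x - y))\<^sup>2)"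
      by (rule real_le_rsqrt)
    then show ?thesis by (simp add: real_sqrt_mult)
  qed
  then show ?thesis by blast
qed

text \<open>The case \<open>c = C1\<close>, \<open>b = - C2\<close>: the initial squared distance is
  damped and the constant contributes at most \<open>C1 / C2\<close>, so the bound is uniform in
  time.\<close>

lemma solution_bounded_difference:
  obtains C where "0 \<le> C" "\<And>t \<omega> x y. 0 \<le> t \<Longrightarrow> \<omega> \<in> Bt \<times> BH H \<Longrightarrow> norm (\<Phi> t \<omega> x - \<Phi> t \<omega> y) \<le> norm (x - y) + C"
proof -
  obtain C1 C2 C3 where C: "C1 > 0" "C2 > 0" "C3 > 0"
    "\<And>x x'. (F x' - F x) \<bullet> (x' - x) \<le> C1 + (- C2) * (norm (x' - x))\<^sup>2"
    "\<And>x x'. (F x' - F x) \<bullet> (x' - x) \<le> 0 + C3 * (norm (x' - x))\<^sup>2"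
    using F_dissipative by blast
  have "norm (\<Phi> t \<omega> x - \<Phi> t \<omega> y) \<le> norm (x - y) + sqrt (C1 / C2)" if t: "0 \<le> t" and \<omega>: "\<omega> \<in> Bt \<times> BH H" for t \<omega> x y
  proof -
    have c: "continuous_on {0..t} (\<lambda>s. \<Phi> s \<omega> z)" for z
      by (rule continuous_on_subset[OF solution_cont[OF Bt_pair[OF \<omega>]]]) auto
    have "(norm (\<Phi> t \<omega> x - \<Phi> t \<omega> y))\<^sup>2 + C1 / (- C2)
        \<le> exp (2 * (- C2) * t) * ((norm (\<Phi> 0 \<omega> x - \<Phi> 0 \<omega> y))\<^sup>2 + C1 / (- C2))"
      by (rule solution_difference[OF t F_continuous c c solution_pair_eq[OF \<omega>] C(4)]) (use C(2) in auto)
    \<comment> \<open>On the right-hand side the negative summand \<open>C1 / (- C2)\<close> is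
      dropped; on the left it is kept and becomes the constant of the bound.\<close>
    also have "\<dots> \<le> exp (2 * (- C2) * t) * (norm (x - y))\<^sup>2"
      using C by (intro mult_left_mono) (auto simp: solution_start[OF \<omega>])
    also have "\<dots> \<le> 1 * (norm (x - y))\<^sup>2"
      using C t by (intro mult_right_mono) auto
    finally have "(norm (\<Phi> t \<omega> x - \<Phi> t \<omega> y))\<^sup>2 \<le> (norm (x - y))\<^sup>2 + C1 / C2" by simp
    also have "\<dots> \<le> (norm (x - y) + sqrt (C1 / C2))\<^sup>2"
      using C by (simp add: power2_sum)
    finally show ?thesis by (rule power2_le_imp_le) (use C in auto)
  qed
  then show ?thesis using that[of "sqrt (C1 / C2)"] C by auto
qed


sublocale NP: pair_prob_space N P ..

lemma space_NP: "space (N \<Otimes>\<^sub>M P) = Bt \<times> BH H"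
  by (simp add: space_pair_measure space_N space_P)

lemma solution_compose:
  assumes t: "0 \<le> t" and X: "X \<in> M \<rightarrow>\<^sub>M N \<Otimes>\<^sub>M P" and Y: "Y \<in> borel_measurable M"
  shows "(\<lambda>w. \<Phi> t (X w) (Y w)) \<in> borel_measurable M"
  using measurable_compose[OF measurable_Pair[OF measurable_const[of t borel M] measurable_Pair[OF X Y]] solution_joint] t
  by simp

text \<open>Composition with this retraction extends functions measurable on \<open>N\<close> to all
  of \<open>BH H\<close>, so that they can be integrated against \<open>P\<close> and
  \<open>\<mu>\<close>.\<close>

lemma retract_measurable: "w0 \<in> Bt \<Longrightarrow> (\<lambda>\<omega>. if \<omega> \<in> Bt then \<omega> else w0) \<in> P \<rightarrow>\<^sub>M N"
  unfolding N_def using Bt_sets Bt_BH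
  by (intro measurable_restrict_space2 measurable_If_set) (auto simp: space_P Int_absorb2)

lemma transition_eq:
  assumes "\<omega>m \<in> Bt" "0 \<le> t"
  shows "transition P \<Phi> t (x, \<omega>m) \<Gamma> =
    (\<integral>\<^sup>+\<eta>. indicator \<Gamma> (\<Phi> t (\<omega>m, \<eta>) x, concat_path t (\<omega>m, \<eta>)) \<partial>P)"
  unfolding transition_def by (auto intro!: nn_integral_cong simp: space_P cocycle_concat assms)

section \<open>Stationarity of the noise under concatenation and gluing\<close>

lemma \<mu>_facts: "prob_space \<mu>" "sets \<mu> = sets (borel \<Otimes>\<^sub>M BH_borel H)" "distr \<mu> (BH_borel H) snd = P"
  using invariant by (auto simp: invariant_measure_def)

lemma space_\<mu>: "space \<mu> = UNIV \<times> BH H"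
  using sets_eq_imp_space_eq[OF \<mu>_facts(2)] by (simp add: space_pair_measure space_BH_borel)

lemma snd_\<mu>: "snd \<in> \<mu> \<rightarrow>\<^sub>M BH_borel H"
  using \<mu>_facts(2) by (simp cong: measurable_cong_sets)

lemma nn_integral_\<mu>_snd:
  assumes "q \<in> borel_measurable P"
  shows "(\<integral>\<^sup>+z. q (snd z) \<partial>\<mu>) = (\<integral>\<^sup>+\<omega>. q \<omega> \<partial>P)"
proof -
  have "(\<integral>\<^sup>+\<omega>. q \<omega> \<partial>distr \<mu> (BH_borel H) snd) = (\<integral>\<^sup>+z. q (snd z) \<partial>\<mu>)"
    by (rule nn_integral_distr[OF snd_\<mu>]) (use assms sets_P in \<open>simp cong: measurable_cong_sets\<close>)
  then show ?thesis by (simp add: \<mu>_facts(3))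
qed

lemma AE_\<mu>_Bt: "AE z in \<mu>. snd z \<in> Bt"
proof (rule AE_distrD[OF snd_\<mu>])
  show "AE z in distr \<mu> (BH_borel H) snd. z \<in> Bt" unfolding \<mu>_facts(3) by (rule AE_Bt)
qed

text \<open>This is the path marginal of the invariance of \<open>\<mu>\<close>: tested on
  \<open>UNIV \<times> E\<close>, the state drops out of the transition probability.\<close>

lemma distr_concat:
  assumes t: "0 \<le> t"
  shows "distr (N \<Otimes>\<^sub>M P) N (concat_path t) = N"
proof (rule measure_eqI)
  fix E assume "E \<in> sets (distr (N \<Otimes>\<^sub>M P) N (concat_path t))"
  then have E [measurable]: "E \<in> sets N" by simp
  then have EP: "E \<in> sets P" "E \<subseteq> Bt" by (auto simp: sets_N_iff)
  note [measurable] = concat_measurable[OF t]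
  obtain w0 where w0: "w0 \<in> Bt" using Bt_nonempty by blast
  let ?r = "\<lambda>\<omega>. if \<omega> \<in> Bt then \<omega> else w0"
  define f where "f \<omega> = (\<integral>\<^sup>+\<eta>. indicator E (concat_path t (\<omega>, \<eta>)) \<partial>P)" for \<omega>
  have f [measurable]: "f \<in> borel_measurable N" unfolding f_def by measurable
  have fr: "(\<lambda>\<omega>. f (?r \<omega>)) \<in> borel_measurable P"
    by (rule measurable_compose[OF retract_measurable[OF w0] f])
  have sm: "UNIV \<times> E \<in> sets \<mu>" using EP(1) sets_P \<mu>_facts(2) by auto
  have "emeasure N E = emeasure P E" by (rule emeasure_N[OF E])
  also have "\<dots> = emeasure (distr \<mu> (BH_borel H) snd) E" by (simp add: \<mu>_facts(3))
  also have "\<dots> = emeasure \<mu> (snd -` E \<inter> space \<mu>)"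
    using EP(1) sets_P by (intro emeasure_distr snd_\<mu>) auto
  also have "snd -` E \<inter> space \<mu> = UNIV \<times> E" using EP(2) Bt_BH by (auto simp: space_\<mu>)
  also have "emeasure \<mu> (UNIV \<times> E) = (\<integral>\<^sup>+z. transition P \<Phi> t z (UNIV \<times> E) \<partial>\<mu>)"
    using invariant sm t unfolding invariant_measure_def by blast
  also have "\<dots> = (\<integral>\<^sup>+z. f (?r (snd z)) \<partial>\<mu>)"
  proof (rule nn_integral_cong_AE, use AE_\<mu>_Bt in eventually_elim)
    fix z :: "(real ^ 'd) \<times> 'd hpath" assume z: "snd z \<in> Bt"
    then show "transition P \<Phi> t z (UNIV \<times> E) = f (?r (snd z))"
      using transition_eq[OF z t, of "fst z" "UNIV \<times> E"] by (simp add: f_def indicator_times)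
  qed
  also have "\<dots> = (\<integral>\<^sup>+\<omega>. f (?r \<omega>) \<partial>P)" by (rule nn_integral_\<mu>_snd[OF fr])
  also have "\<dots> = (\<integral>\<^sup>+\<omega>. f (?r \<omega>) \<partial>N)" by (rule nn_integral_N_P[OF fr, symmetric])
  also have "\<dots> = (\<integral>\<^sup>+\<omega>. f \<omega> \<partial>N)" by (intro nn_integral_cong) (simp add: space_N)
  also have "\<dots> = (\<integral>\<^sup>+\<omega>. indicator E (concat_path t \<omega>) \<partial>(N \<Otimes>\<^sub>M P))"
    unfolding f_def by (rule P.nn_integral_fst) measurable
  also have "\<dots> = (\<integral>\<^sup>+\<omega>. indicator E \<omega> \<partial>distr (N \<Otimes>\<^sub>M P) N (concat_path t))"
    by (rule nn_integral_distr[symmetric]) measurable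
  finally show "emeasure (distr (N \<Otimes>\<^sub>M P) N (concat_path t)) E = emeasure N E" by simp
qed simp

lemma id_N_P: "(\<lambda>\<omega>. \<omega>) \<in> N \<rightarrow>\<^sub>M P"
  by (rule measurable_N_P) simp

lemma glue_measurable: "0 \<le> s \<Longrightarrow> glue s \<in> N \<Otimes>\<^sub>M P \<rightarrow>\<^sub>M N"
proof -
  assume s: "0 \<le> s"
  obtain w0 where w0: "w0 \<in> Bt" using Bt_nonempty by blast
  have "(\<lambda>p. concat_path s (w0, snd p)) \<in> N \<Otimes>\<^sub>M P \<rightarrow>\<^sub>M N"
    by (rule measurable_concat) (use s w0 in \<open>auto simp: space_N\<close>)
  then have "(\<lambda>p. concat_path s (w0, snd p)) \<in> N \<Otimes>\<^sub>M P \<rightarrow>\<^sub>M P"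
    by (rule measurable_compose[OF _ id_N_P])
  then have "(\<lambda>p. concat_path s (fst p, concat_path s (w0, snd p))) \<in> N \<Otimes>\<^sub>M P \<rightarrow>\<^sub>M N"
    by (intro measurable_concat) (use s in auto)
  also have "?this \<longleftrightarrow> glue s \<in> N \<Otimes>\<^sub>M P \<rightarrow>\<^sub>M N"
    by (rule measurable_cong) (use glue_eq[OF s] in \<open>auto simp: space_NP\<close>)
  finally show ?thesis .
qed

text \<open>Gluing an independent past onto a path leaves \<open>P\<close> invariant: time reversal turns this into
  the stationarity of \<open>concat_path\<close>, applied twice.\<close>

lemma distr_glue:
  assumes s: "0 \<le> s"
  shows "distr (N \<Otimes>\<^sub>M P) N (glue s) = N"
proof (rule measure_eqI)
  fix E assume "E \<in> sets (distr (N \<Otimes>\<^sub>M P) N (glue s))"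
  then have E [measurable]: "E \<in> sets N" by simp
  note [measurable] = concat_measurable[OF s] glue_measurable[OF s]
  \<comment> \<open>The glued path does not depend on the past \<open>w\<close> inside the inner
    concatenation, so an integration over an independent \<open>w\<close> may be inserted.
    Stationarity under \<open>concat_path\<close> then replaces the inner concatenation by a path of
    law \<open>P\<close>.\<close>
  have inner: "(\<integral>\<^sup>+\<omega>p. indicator E (glue s (\<eta>, \<omega>p)) \<partial>P) = (\<integral>\<^sup>+\<zeta>. indicator E (concat_path s (\<eta>, \<zeta>)) \<partial>P)"
    if \<eta>: "\<eta> \<in> space N" for \<eta>
  proof -
    have c: "(\<lambda>\<zeta>. indicator E (concat_path s (\<eta>, \<zeta>)) :: ennreal) \<in> borel_measurable P"
      using \<eta> by measurable
    have "(\<lambda>p. concat_path s p) \<in> N \<Otimes>\<^sub>M P \<rightarrow>\<^sub>M P"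
      by (rule measurable_compose[OF concat_measurable[OF s] id_N_P])
    from measurable_compose[OF this c]
    have d: "(\<lambda>p. indicator E (concat_path s (\<eta>, concat_path s p)) :: ennreal) \<in> borel_measurable (N \<Otimes>\<^sub>M P)" .
    have "(\<integral>\<^sup>+\<omega>p. indicator E (glue s (\<eta>, \<omega>p)) \<partial>P)
        = (\<integral>\<^sup>+w. (\<integral>\<^sup>+\<omega>p. indicator E (glue s (\<eta>, \<omega>p)) \<partial>P) \<partial>N)"
      by (simp add: N.emeasure_space_1)
    also have "\<dots> = (\<integral>\<^sup>+w. (\<integral>\<^sup>+\<omega>p. indicator E (concat_path s (\<eta>, concat_path s (w, \<omega>p))) \<partial>P) \<partial>N)"
    proof (intro nn_integral_cong)
      fix w \<omega>p :: "'d hpath" assume "\<omega>p \<in> space P"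
      then show "indicator E (glue s (\<eta>, \<omega>p)) = (indicator E (concat_path s (\<eta>, concat_path s (w, \<omega>p))) :: ennreal)"
        using glue_eq[OF s, of \<omega>p \<eta> w] by (simp add: space_P)
    qed
    also have "\<dots> = (\<integral>\<^sup>+p. indicator E (concat_path s (\<eta>, concat_path s p)) \<partial>(N \<Otimes>\<^sub>M P))"
      by (rule P.nn_integral_fst[OF d])
    also have "\<dots> = (\<integral>\<^sup>+\<zeta>. indicator E (concat_path s (\<eta>, \<zeta>)) \<partial>distr (N \<Otimes>\<^sub>M P) N (concat_path s))"
      by (rule nn_integral_distr[symmetric]) (use measurable_N_P[OF c] in auto)
    also have "\<dots> = (\<integral>\<^sup>+\<zeta>. indicator E (concat_path s (\<eta>, \<zeta>)) \<partial>P)"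
      unfolding distr_concat[OF s] by (rule nn_integral_N_P[OF c])
    finally show ?thesis .
  qed
  have "emeasure (distr (N \<Otimes>\<^sub>M P) N (glue s)) E = (\<integral>\<^sup>+\<omega>. indicator E \<omega> \<partial>distr (N \<Otimes>\<^sub>M P) N (glue s))"
    by simp
  also have "\<dots> = (\<integral>\<^sup>+p. indicator E (glue s p) \<partial>(N \<Otimes>\<^sub>M P))"
    by (rule nn_integral_distr) measurable
  also have "\<dots> = (\<integral>\<^sup>+\<eta>. (\<integral>\<^sup>+\<omega>p. indicator E (glue s (\<eta>, \<omega>p)) \<partial>P) \<partial>N)"
    by (rule P.nn_integral_fst[symmetric]) measurable
  also have "\<dots> = (\<integral>\<^sup>+\<eta>. (\<integral>\<^sup>+\<zeta>. indicator E (concat_path s (\<eta>, \<zeta>)) \<partial>P) \<partial>N)"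
    by (rule nn_integral_cong[OF inner])
  also have "\<dots> = (\<integral>\<^sup>+p. indicator E (concat_path s p) \<partial>(N \<Otimes>\<^sub>M P))"
    by (rule P.nn_integral_fst) measurable
  also have "\<dots> = (\<integral>\<^sup>+\<omega>. indicator E \<omega> \<partial>distr (N \<Otimes>\<^sub>M P) N (concat_path s))"
    by (rule nn_integral_distr[symmetric]) measurable
  also have "\<dots> = emeasure N E" by (simp add: distr_concat[OF s])
  finally show "emeasure (distr (N \<Otimes>\<^sub>M P) N (glue s)) E = emeasure N E" .
qed simp

text \<open>By \<open>flow_glue\<close> the restarted flow is the flow driven by the glued path, and
  by \<open>distr_glue\<close> the glued path of two independent ones has the law of a single one.
  Fubini combines the two facts for each fixed past.\<close>

lemma markov_property:
  fixes f :: "(real ^ 'd) \<times> 'd hpath \<Rightarrow> real"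
  assumes s: "0 \<le> s" and t: "0 \<le> t" and f: "f \<in> borel_measurable (borel \<Otimes>\<^sub>M N)" and B: "\<And>p. \<bar>f p\<bar> \<le> 1"
  shows "(\<integral>\<omega>. (\<integral>\<eta>. f (\<Phi> t (concat_path s \<omega>, \<eta>) (\<Phi> s \<omega> x0), concat_path t (concat_path s \<omega>, \<eta>)) \<partial>P) \<partial>(N \<Otimes>\<^sub>M P))
    = (\<integral>\<omega>. f (\<Phi> (s + t) \<omega> x0, concat_path (s + t) \<omega>) \<partial>(N \<Otimes>\<^sub>M P))"
proof -
  have st: "0 \<le> s + t" using s t by simp
  note [measurable] = f concat_measurable[OF s] concat_measurable[OF t] concat_measurable[OF st] glue_measurable[OF s]
  define g where "g \<omega> = f (\<Phi> (s + t) \<omega> x0, concat_path (s + t) \<omega>)" for \<omega>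
  have [measurable]: "(\<lambda>\<omega>. \<Phi> (s + t) \<omega> x0) \<in> borel_measurable (N \<Otimes>\<^sub>M P)"
    by (rule solution_compose[OF st]) auto
  have g [measurable]: "g \<in> borel_measurable (N \<Otimes>\<^sub>M P)" unfolding g_def by measurable
  have gB: "\<bar>g \<omega>\<bar> \<le> 1" for \<omega> by (simp add: g_def B)
  have glueP: "glue s \<in> N \<Otimes>\<^sub>M P \<rightarrow>\<^sub>M P" by (rule measurable_compose[OF glue_measurable[OF s] id_N_P])
  have inner: "(\<integral>\<eta>. f (\<Phi> t (concat_path s \<omega>, \<eta>) (\<Phi> s \<omega> x0), concat_path t (concat_path s \<omega>, \<eta>)) \<partial>P)
      = (\<integral>\<eta>. g (fst \<omega>, glue s (\<eta>, snd \<omega>)) \<partial>N)" if \<omega>: "\<omega> \<in> space (N \<Otimes>\<^sub>M P)" for \<omega>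
  proof -
    have \<xi>: "concat_path s \<omega> \<in> space N" using measurable_space[OF concat_measurable[OF s] \<omega>] .
    have "(\<lambda>\<eta>. \<Phi> t (concat_path s \<omega>, \<eta>) (\<Phi> s \<omega> x0)) \<in> borel_measurable P"
      by (rule solution_compose[OF t]) (use \<xi> in auto)
    moreover have "(\<lambda>\<eta>. concat_path t (concat_path s \<omega>, \<eta>)) \<in> P \<rightarrow>\<^sub>M N"
      using \<xi> by measurable
    ultimately have "(\<lambda>\<eta>. f (\<Phi> t (concat_path s \<omega>, \<eta>) (\<Phi> s \<omega> x0), concat_path t (concat_path s \<omega>, \<eta>))) \<in> borel_measurable P"
      by measurable
    \<comment> \<open>\<open>flow_glue\<close> asks for fresh noise in \<open>Bt\<close>; replacing
      \<open>P\<close> by \<open>N\<close> changes the integral only on a null set.\<close>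
    then have "(\<integral>\<eta>. f (\<Phi> t (concat_path s \<omega>, \<eta>) (\<Phi> s \<omega> x0), concat_path t (concat_path s \<omega>, \<eta>)) \<partial>P)
      = (\<integral>\<eta>. f (\<Phi> t (concat_path s \<omega>, \<eta>) (\<Phi> s \<omega> x0), concat_path t (concat_path s \<omega>, \<eta>)) \<partial>N)"
      by (rule integral_N_P[symmetric])
    also have "\<dots> = (\<integral>\<eta>. g (fst \<omega>, glue s (\<eta>, snd \<omega>)) \<partial>N)"
    proof (rule Bochner_Integration.integral_cong[OF refl])
      fix \<eta> assume "\<eta> \<in> space N"
      then have \<eta>: "\<eta> \<in> Bt" "\<eta> \<in> BH H" using Bt_BH by (auto simp: space_N)
      obtain \<omega>m \<omega>p where m: "\<omega> = (\<omega>m, \<omega>p)" "\<omega>m \<in> Bt" "\<omega>p \<in> BH H" using \<omega> by (auto simp: space_NP)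
      show "f (\<Phi> t (concat_path s \<omega>, \<eta>) (\<Phi> s \<omega> x0), concat_path t (concat_path s \<omega>, \<eta>)) = g (fst \<omega>, glue s (\<eta>, snd \<omega>))"
        unfolding m(1) g_def flow_glue[OF m(2,3) \<eta>(1) s t] concat_glue[OF s t \<eta>(2)] by simp
    qed
    finally show ?thesis .
  qed
  have gm: "(\<lambda>q. g (fst (fst q), glue s (snd q, snd (fst q)))) \<in> borel_measurable ((N \<Otimes>\<^sub>M P) \<Otimes>\<^sub>M N)"
    using glueP by measurable
  have hm: "(\<lambda>\<omega>. \<integral>\<eta>. g (fst \<omega>, glue s (\<eta>, snd \<omega>)) \<partial>N) \<in> borel_measurable (N \<Otimes>\<^sub>M P)"
    by (rule N.borel_measurable_lebesgue_integral) (use gm in \<open>simp add: split_beta'\<close>)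
  have sec: "(\<lambda>p. g (\<omega>m, glue s p)) \<in> borel_measurable (N \<Otimes>\<^sub>M P)" if "\<omega>m \<in> space N" for \<omega>m
    using that glueP by measurable
  have hB: "\<bar>\<integral>\<eta>. g (fst \<omega>, glue s (\<eta>, snd \<omega>)) \<partial>N\<bar> \<le> 1" if "\<omega> \<in> space (N \<Otimes>\<^sub>M P)" for \<omega>
  proof (rule N.abs_integral_le_bound[OF _ gB])
    have 1: "fst \<omega> \<in> space N" "snd \<omega> \<in> space P" using that by (auto simp: space_pair_measure)
    show "(\<lambda>\<eta>. g (fst \<omega>, glue s (\<eta>, snd \<omega>))) \<in> borel_measurable N"
      by (rule measurable_compose[OF measurable_Pair2'[OF 1(2)] sec[OF 1(1)]])
  qed
  have inner2: "(\<integral>\<omega>p. (\<integral>\<eta>. g (\<omega>m, glue s (\<eta>, \<omega>p)) \<partial>N) \<partial>P) = (\<integral>\<zeta>. g (\<omega>m, \<zeta>) \<partial>P)" if m: "\<omega>m \<in> space N" for \<omega>m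
  proof -
    have i: "integrable (N \<Otimes>\<^sub>M P) (\<lambda>p. g (\<omega>m, glue s p))"
      by (rule NP.integrable_bounded_function[OF sec[OF m] gB])
    have gP: "(\<lambda>\<zeta>. g (\<omega>m, \<zeta>)) \<in> borel_measurable P" using m by measurable
    have "(\<integral>\<omega>p. (\<integral>\<eta>. g (\<omega>m, glue s (\<eta>, \<omega>p)) \<partial>N) \<partial>P) = (\<integral>\<eta>. (\<integral>\<omega>p. g (\<omega>m, glue s (\<eta>, \<omega>p)) \<partial>P) \<partial>N)"
      by (rule NP.Fubini_integral) (use i in \<open>simp add: split_beta'\<close>)
    also have "\<dots> = (\<integral>p. g (\<omega>m, glue s p) \<partial>(N \<Otimes>\<^sub>M P))" by (rule NP.integral_fst'[OF i])
    also have "\<dots> = (\<integral>\<zeta>. g (\<omega>m, \<zeta>) \<partial>distr (N \<Otimes>\<^sub>M P) N (glue s))"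
      by (rule integral_distr[symmetric]) (use measurable_N_P[OF gP] in auto)
    also have "\<dots> = (\<integral>\<zeta>. g (\<omega>m, \<zeta>) \<partial>P)" unfolding distr_glue[OF s] by (rule integral_N_P[OF gP])
    finally show ?thesis .
  qed
  have "(\<integral>\<omega>. (\<integral>\<eta>. f (\<Phi> t (concat_path s \<omega>, \<eta>) (\<Phi> s \<omega> x0), concat_path t (concat_path s \<omega>, \<eta>)) \<partial>P) \<partial>(N \<Otimes>\<^sub>M P))
      = (\<integral>\<omega>. (\<integral>\<eta>. g (fst \<omega>, glue s (\<eta>, snd \<omega>)) \<partial>N) \<partial>(N \<Otimes>\<^sub>M P))"
    by (rule Bochner_Integration.integral_cong[OF refl inner])
  also have "\<dots> = (\<integral>\<omega>m. (\<integral>\<omega>p. (\<integral>\<eta>. g (\<omega>m, glue s (\<eta>, \<omega>p)) \<partial>N) \<partial>P) \<partial>N)"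
    using NP.integral_fst'[OF NP.integrable_bounded_function[OF hm hB]] by simp
  also have "\<dots> = (\<integral>\<omega>m. (\<integral>\<zeta>. g (\<omega>m, \<zeta>) \<partial>P) \<partial>N)"
    by (rule Bochner_Integration.integral_cong[OF refl inner2])
  also have "\<dots> = (\<integral>\<omega>. g \<omega> \<partial>(N \<Otimes>\<^sub>M P))"
    by (rule NP.integral_fst'[OF NP.integrable_bounded_function[OF g gB]])
  finally show ?thesis by (simp add: g_def)
qed

section \<open>The fibre measures and tightness of trajectories\<close>

lemma \<nu>_facts: "\<omega> \<in> BH H \<Longrightarrow> prob_space (\<nu> \<omega>)" "\<omega> \<in> BH H \<Longrightarrow> sets (\<nu> \<omega>) = sets borel"
  and \<nu>_measurable: "A \<in> sets borel \<Longrightarrow> (\<lambda>\<omega>. emeasure (\<nu> \<omega>) A) \<in> borel_measurable P"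
  and \<mu>_rectangle: "A \<in> sets borel \<Longrightarrow> E \<in> sets P \<Longrightarrow> emeasure \<mu> (A \<times> E) = (\<integral>\<^sup>+\<omega>\<in>E. emeasure (\<nu> \<omega>) A \<partial>P)"
  using disint unfolding disintegration_def by blast+

lemma solution_borel_measurable:
  assumes "0 \<le> t" "\<omega> \<in> Bt \<times> BH H"
  shows "\<Phi> t \<omega> \<in> borel_measurable borel"
  using solution_compose[OF assms(1), of "\<lambda>_. \<omega>" borel "\<lambda>x. x"] assms(2) by (simp add: space_NP)

text \<open>A trajectory started at a \<open>\<nu> \<omega>\<close>-distributed point is stationary, and the one started at
  \<open>x0\<close> stays within bounded distance of it.\<close>

lemma solution_tight:
  assumes e: "e > 0"
  shows "\<exists>R. \<forall>s\<ge>0. measure (N \<Otimes>\<^sub>M P) {\<omega> \<in> space (N \<Otimes>\<^sub>M P). norm (\<Phi> s \<omega> x0) > R} \<le> e"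
proof -
  interpret \<mu>: prob_space \<mu> by (rule \<mu>_facts)
  define A where "A n = {x :: real ^ 'd. norm x > real n}" for n :: nat
  have A [measurable]: "A n \<in> sets borel" for n unfolding A_def by measurable
  have BHP: "BH H \<in> sets P" using sets.top[of P] by (simp add: space_P)
  have "(\<lambda>n. measure \<mu> (A n \<times> BH H)) \<longlonglongrightarrow> measure \<mu> (\<Inter>n. A n \<times> BH H)"
  proof (rule \<mu>.finite_Lim_measure_decseq)
    show "range (\<lambda>n. A n \<times> BH H) \<subseteq> sets \<mu>" using A BHP \<mu>_facts(2) sets_P by auto
    show "decseq (\<lambda>n. A n \<times> BH H)" by (auto simp: decseq_def A_def)
  qed
  moreover have "(\<Inter>n. A n \<times> (BH H :: 'd hpath set)) = {}"
  proof -
    have "x \<notin> (\<Inter>n. A n)" for x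
      using real_arch_simple[of "norm x"] by (auto simp: A_def not_less)
    then show ?thesis by auto
  qed
  ultimately have "(\<lambda>n. measure \<mu> (A n \<times> BH H)) \<longlonglongrightarrow> 0" by (simp only: measure_empty)
  then have "eventually (\<lambda>n. measure \<mu> (A n \<times> BH H) < e / 2) sequentially"
    using e by (intro order_tendstoD) auto
  then obtain n where n: "measure \<mu> (A n \<times> BH H) < e / 2" by (auto simp: eventually_sequentially)
  \<comment> \<open>The mean of \<open>k\<close> under \<open>N\<close> is the mass that
    \<open>\<mu>\<close> puts outside the ball of radius \<open>n\<close>. It will be counted at the
    old and at the new past, hence the bound \<open>e / 2\<close>.\<close>
  define k where "k \<omega> = emeasure (\<nu> \<omega>) (A n)" for \<omega>
  have kP: "k \<in> borel_measurable P" unfolding k_def by (rule \<nu>_measurable[OF A])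
  have kN [measurable]: "k \<in> borel_measurable N" by (rule measurable_N_P[OF kP])
  have "(\<integral>\<^sup>+\<omega>. k \<omega> \<partial>N) = (\<integral>\<^sup>+\<omega>. k \<omega> \<partial>P)" by (rule nn_integral_N_P[OF kP])
  also have "\<dots> = (\<integral>\<^sup>+\<omega>\<in>BH H. k \<omega> \<partial>P)" by (intro nn_integral_cong) (simp add: space_P)
  also have "\<dots> = emeasure \<mu> (A n \<times> BH H)" unfolding k_def by (rule \<mu>_rectangle[OF A BHP, symmetric])
  also have "\<dots> \<le> ennreal (e / 2)" using n by (simp add: \<mu>.emeasure_eq_measure ennreal_leI)
  finally have kI: "(\<integral>\<^sup>+\<omega>. k \<omega> \<partial>N) \<le> ennreal (e / 2)" .
  obtain C where C: "0 \<le> C"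
    "\<And>t \<omega> x y. 0 \<le> t \<Longrightarrow> \<omega> \<in> Bt \<times> BH H \<Longrightarrow> norm (\<Phi> t \<omega> x - \<Phi> t \<omega> y) \<le> norm (x - y) + C"
    using solution_bounded_difference by metis
  \<comment> \<open>The first \<open>n\<close> bounds the end point of a companion trajectory inside
    the ball; \<open>n + norm x0 + C\<close> bounds its distance to the trajectory of
    \<open>x0\<close> when it also starts inside.\<close>
  define R where "R = real n + (real n + norm x0 + C)"
  have "measure (N \<Otimes>\<^sub>M P) {\<omega> \<in> space (N \<Otimes>\<^sub>M P). norm (\<Phi> s \<omega> x0) > R} \<le> e" if s: "0 \<le> s" for s
  proof -
    note [measurable] = concat_measurable[OF s]
    have [measurable]: "(\<lambda>\<omega>. \<Phi> s \<omega> x0) \<in> borel_measurable (N \<Otimes>\<^sub>M P)"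
      by (rule solution_compose[OF s]) auto
    let ?X = "{\<omega> \<in> space (N \<Otimes>\<^sub>M P). norm (\<Phi> s \<omega> x0) > R}"
    have le: "indicator ?X \<omega> \<le> k (fst \<omega>) + k (concat_path s \<omega>)" if \<omega>: "\<omega> \<in> space (N \<Otimes>\<^sub>M P)" for \<omega>
    proof (cases "\<omega> \<in> ?X")
      case True
      have \<omega>': "\<omega> \<in> Bt \<times> BH H" using \<omega> by (simp add: space_NP)
      then have f: "fst \<omega> \<in> Bt" "fst \<omega> \<in> BH H" "snd \<omega> \<in> BH H" using Bt_BH by auto
      interpret \<nu>: prob_space "\<nu> (fst \<omega>)" by (rule \<nu>_facts(1)[OF f(2)])
      have sp: "space (\<nu> (fst \<omega>)) = UNIV" using sets_eq_imp_space_eq[OF \<nu>_facts(2)[OF f(2)]] by simp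
      have m: "\<Phi> s \<omega> \<in> \<nu> (fst \<omega>) \<rightarrow>\<^sub>M borel"
        using solution_borel_measurable[OF s \<omega>'] \<nu>_facts(2)[OF f(2)] by (simp cong: measurable_cong_sets)
      have pre: "\<Phi> s \<omega> -` A n \<in> sets (\<nu> (fst \<omega>))" using measurable_sets[OF m A, of n] by (simp add: sp)
      \<comment> \<open>A companion that starts and ends inside the ball would keep the trajectory
        of \<open>x0\<close> within \<open>R\<close>. The two exceptional sets therefore cover the
        whole state space, and their masses \<open>k (fst \<omega>)\<close> and
        \<open>k (concat_path s \<omega>)\<close> add up to at least 1.\<close>
      have "x \<in> A n \<or> \<Phi> s \<omega> x \<in> A n" for x
      proof (rule ccontr)
        assume "\<not> (x \<in> A n \<or> \<Phi> s \<omega> x \<in> A n)"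
        then have x: "norm x \<le> real n" "norm (\<Phi> s \<omega> x) \<le> real n" by (auto simp: A_def)
        have "norm (\<Phi> s \<omega> x0) \<le> norm (\<Phi> s \<omega> x) + norm (\<Phi> s \<omega> x0 - \<Phi> s \<omega> x)"
          by (rule norm_triangle_sub)
        also have "\<dots> \<le> real n + (norm (x0 - x) + C)" using x C(2)[OF s \<omega>', of x0 x] by simp
        also have "\<dots> \<le> R" using norm_triangle_ineq4[of x0 x] x(1) by (simp add: R_def)
        finally show False using True by simp
      qed
      then have "UNIV = A n \<union> \<Phi> s \<omega> -` A n" by auto
      then have "1 = emeasure (\<nu> (fst \<omega>)) (A n \<union> \<Phi> s \<omega> -` A n)" using \<nu>.emeasure_space_1 by (simp add: sp)
      also have "\<dots> \<le> emeasure (\<nu> (fst \<omega>)) (A n) + emeasure (\<nu> (fst \<omega>)) (\<Phi> s \<omega> -` A n)"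
        using pre \<nu>_facts(2)[OF f(2)] by (intro emeasure_subadditive) auto
      also have "emeasure (\<nu> (fst \<omega>)) (\<Phi> s \<omega> -` A n) = emeasure (distr (\<nu> (fst \<omega>)) borel (\<Phi> s \<omega>)) (A n)"
        using m by (simp add: emeasure_distr sp)
      also have "distr (\<nu> (fst \<omega>)) borel (\<Phi> s \<omega>) = \<nu> (concat_path s \<omega>)"
        using distr_disint[OF f(1,3) s] by simp
      finally show ?thesis using True by (simp add: k_def)
    qed simp
    have "emeasure (N \<Otimes>\<^sub>M P) ?X = (\<integral>\<^sup>+\<omega>. indicator ?X \<omega> \<partial>(N \<Otimes>\<^sub>M P))" by simp
    also have "\<dots> \<le> (\<integral>\<^sup>+\<omega>. k (fst \<omega>) + k (concat_path s \<omega>) \<partial>(N \<Otimes>\<^sub>M P))"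
      by (rule nn_integral_mono[OF le])
    also have "\<dots> = (\<integral>\<^sup>+\<omega>. k (fst \<omega>) \<partial>(N \<Otimes>\<^sub>M P)) + (\<integral>\<^sup>+\<omega>. k (concat_path s \<omega>) \<partial>(N \<Otimes>\<^sub>M P))"
      by (rule nn_integral_add) measurable
    also have "(\<integral>\<^sup>+\<omega>. k (fst \<omega>) \<partial>(N \<Otimes>\<^sub>M P)) = (\<integral>\<^sup>+\<omega>. k \<omega> \<partial>N)"
      by (subst P.nn_integral_fst[symmetric]) (auto simp: P.emeasure_space_1)
    also have "(\<integral>\<^sup>+\<omega>. k (concat_path s \<omega>) \<partial>(N \<Otimes>\<^sub>M P)) = (\<integral>\<^sup>+\<omega>. k \<omega> \<partial>distr (N \<Otimes>\<^sub>M P) N (concat_path s))"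
      by (rule nn_integral_distr[symmetric]) measurable
    also have "\<dots> = (\<integral>\<^sup>+\<omega>. k \<omega> \<partial>N)" by (simp only: distr_concat[OF s])
    also have "(\<integral>\<^sup>+\<omega>. k \<omega> \<partial>N) + (\<integral>\<^sup>+\<omega>. k \<omega> \<partial>N) \<le> ennreal (e / 2) + ennreal (e / 2)"
      by (rule add_mono[OF kI kI])
    also have "\<dots> = ennreal e" using e by (simp flip: ennreal_plus)
    finally show ?thesis using e by (simp add: NP.emeasure_eq_measure)
  qed
  then show ?thesis by blast
qed

lemma random_flow: "random_flow N P concat_path \<Phi> x0"
proof
  show "(\<lambda>(t, \<omega>). concat_path (max 0 t) \<omega>) \<in> borel \<Otimes>\<^sub>M (N \<Otimes>\<^sub>M P) \<rightarrow>\<^sub>M N" by (rule concat_joint)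
  show "(\<lambda>(t, \<omega>, x). \<Phi> (max 0 t) \<omega> x) \<in> borel \<Otimes>\<^sub>M ((N \<Otimes>\<^sub>M P) \<Otimes>\<^sub>M borel) \<rightarrow>\<^sub>M borel" by (rule solution_joint)
  show "distr (N \<Otimes>\<^sub>M P) N (concat_path t) = N" if "0 \<le> t" for t by (rule distr_concat[OF that])
  show "\<exists>K. \<forall>\<omega>\<in>space (N \<Otimes>\<^sub>M P). \<forall>x y. norm (\<Phi> t \<omega> x - \<Phi> t \<omega> y) \<le> K * norm (x - y)" if "0 \<le> t" for t
    using solution_lipschitz[OF that] by (simp add: space_NP)
qed (use markov_property solution_tight in auto)

end

section \<open>Convergence to the attractor\<close>

text \<open>The countable family is a base of the topology and does not depend on the measure. It
  can serve all fibres \<open>\<nu> \<omega>\<close> simultaneously.\<close>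

lemma countable_cover_off_measure_supp:
  obtains B :: "('a::second_countable_topology) set set" where "countable B" "\<And>b. b \<in> B \<Longrightarrow> open b"
    "\<And>(M :: 'a measure) x. sets M = sets borel \<Longrightarrow> x \<notin> measure_supp M \<Longrightarrow> \<exists>b\<in>B. x \<in> b \<and> emeasure M b = 0"
proof -
  obtain B :: "'a set set" where B: "countable B" "topological_basis B"
    using ex_countable_basis by blast
  show ?thesis
  proof (rule that[OF B(1)])
    show "open b" if "b \<in> B" for b using topological_basis_open[OF B(2) that] .
    fix M :: "'a measure" and x assume S: "sets M = sets borel" and "x \<notin> measure_supp M"
    then obtain U where U: "open U" "x \<in> U" "emeasure M U = 0"
      by (auto simp: measure_supp_def not_gr_zero)
    obtain b where b: "b \<in> B" "x \<in> b" "b \<subseteq> U"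
      using topological_basisE[OF B(2) U(1,2)] by metis
    have "emeasure M b \<le> emeasure M U" using b U S by (intro emeasure_mono) auto
    then show "\<exists>b\<in>B. x \<in> b \<and> emeasure M b = 0" using b U(3) by auto
  qed
qed

text \<open>By second countability the complement of the support is a null set, so a ball of
  positive mass meets the support. The distance is thus expressed by masses of balls, which depend
  measurably on a parameter.\<close>

lemma infdist_measure_supp_less_iff:
  fixes M :: "('a::{metric_space, second_countable_topology}) measure"
  assumes M: "prob_space M" "sets M = sets borel"
  shows "infdist x (measure_supp M) < r \<longleftrightarrow> emeasure M (ball x r) > 0"
proof -
  interpret prob_space M by fact
  have sp: "space M = UNIV" using sets_eq_imp_space_eq[OF M(2)] by simp
  obtain B where B: "countable B" "\<And>b. b \<in> B \<Longrightarrow> open b"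
    "\<And>x. x \<notin> measure_supp M \<Longrightarrow> \<exists>b\<in>B. x \<in> b \<and> emeasure M b = 0"
    using countable_cover_off_measure_supp M(2) by metis
  define B0 where "B0 = {b \<in> B. emeasure M b = 0}"
  have n: "(\<Union>b\<in>B0. b) \<in> null_sets M"
  proof (rule null_sets_UN')
    show "countable B0" unfolding B0_def using B(1) by (rule countable_subset[rotated]) auto
    show "b \<in> null_sets M" if "b \<in> B0" for b
      using that B(2)[of b] M(2) by (auto simp: B0_def null_sets_def)
  qed
  have c: "- measure_supp M \<subseteq> (\<Union>b\<in>B0. b)" using B(3) unfolding B0_def by blast
  \<comment> \<open>For an empty support \<open>infdist\<close> would have the default value 0 and
    say nothing about masses of balls; total mass 1 excludes this case.\<close>
  have ne: "measure_supp M \<noteq> {}"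
  proof
    assume "measure_supp M = {}"
    then have "space M \<subseteq> (\<Union>b\<in>B0. b)" using c by auto
    then have "emeasure M (space M) \<le> emeasure M (\<Union>b\<in>B0. b)" using n by (intro emeasure_mono) auto
    then show False using n emeasure_space_1 by (simp add: null_sets_def)
  qed
  show ?thesis
  proof
    assume "infdist x (measure_supp M) < r"
    moreover have "r \<le> infdist x (measure_supp M)" if "\<And>y. y \<in> measure_supp M \<Longrightarrow> r \<le> dist x y"
      unfolding infdist_notempty[OF ne] using ne that by (rule cINF_greatest)
    ultimately obtain y where "y \<in> measure_supp M" "dist x y < r" by (meson not_less)
    then show "emeasure M (ball x r) > 0" by (auto simp: measure_supp_def)
  next
    assume pos: "emeasure M (ball x r) > 0"
    have "\<not> ball x r \<subseteq> (\<Union>b\<in>B0. b)"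
    proof
      assume "ball x r \<subseteq> (\<Union>b\<in>B0. b)"
      then have "emeasure M (ball x r) \<le> emeasure M (\<Union>b\<in>B0. b)" using n by (intro emeasure_mono) auto
      then show False using n pos by (simp add: null_sets_def)
    qed
    then obtain y where "y \<in> ball x r" "y \<in> measure_supp M" using c by blast
    then show "infdist x (measure_supp M) < r" using infdist_le[of y "measure_supp M" x] by simp
  qed
qed

context fractional_sde
begin

text \<open>The distance is continuous in \<open>x\<close>, and for fixed \<open>x\<close> its
  sublevel sets are given by positivity of
  \<open>emeasure (\<nu> \<omega>) (ball x r)\<close>.\<close>

lemma infdist_attractor_measurable:
  "(\<lambda>(x, \<omega>). infdist x (attractor Bt \<nu> \<omega>)) \<in> borel_measurable (borel \<Otimes>\<^sub>M N)"
proof (rule caratheodory_measurable)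
  show "continuous_on UNIV (\<lambda>x. infdist x (attractor Bt \<nu> \<omega>))" for \<omega>
    by (intro continuous_intros)
  show "(\<lambda>\<omega>. infdist x (attractor Bt \<nu> \<omega>)) \<in> borel_measurable N" for x
  proof (rule borel_measurableI_less)
    fix r :: real
    have [measurable]: "(\<lambda>\<omega>. emeasure (\<nu> \<omega>) (ball x r)) \<in> borel_measurable N"
      by (rule measurable_N_P[OF \<nu>_measurable]) simp
    have "{\<omega> \<in> space N. infdist x (attractor Bt \<nu> \<omega>) < r} = {\<omega> \<in> space N. 0 < emeasure (\<nu> \<omega>) (ball x r)}"
      using infdist_measure_supp_less_iff[OF \<nu>_facts] Bt_BH by (auto simp: space_N attractor_def)
    also have "\<dots> \<in> sets N" by measurable
    finally show "{\<omega> \<in> space N. infdist x (attractor Bt \<nu> \<omega>) < r} \<in> sets N" .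
  qed
qed

text \<open>As a map this is the identity; it marks the change from the measurable space over
  \<open>Bt\<close> to the one over \<open>BH H\<close>.\<close>

definition inclusion :: "(real ^ 'd) \<times> 'd hpath \<Rightarrow> (real ^ 'd) \<times> 'd hpath" where
  "inclusion = (\<lambda>p. (fst p, snd p))"

lemma N_BH_borel: "(\<lambda>\<omega>. \<omega>) \<in> N \<rightarrow>\<^sub>M BH_borel H"
  using id_N_P sets_P by (simp cong: measurable_cong_sets)

lemma inclusion_measurable: "inclusion \<in> borel \<Otimes>\<^sub>M N \<rightarrow>\<^sub>M borel \<Otimes>\<^sub>M BH_borel H"
  unfolding inclusion_def using N_BH_borel by measurable

text \<open>Limit points are found over \<open>N\<close>, whereas uniqueness of \<open>\<mu>\<close>
  concerns measures over \<open>BH_borel H\<close>. The image charges no past outside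
  \<open>Bt\<close>, so the two invariance statements agree up to null sets.\<close>

lemma embedded_invariant:
  assumes \<mu>': "prob_space \<mu>'" "sets \<mu>' = sets (borel \<Otimes>\<^sub>M N)" "distr \<mu>' N snd = N"
    and inv: "\<And>t. 0 \<le> t \<Longrightarrow> random_flow.average N P concat_path \<Phi> t \<mu>' = \<mu>'"
  shows "invariant_measure H P \<Phi> (distr \<mu>' (borel \<Otimes>\<^sub>M BH_borel H) inclusion)"
proof -
  interpret \<mu>': prob_space \<mu>' by fact
  interpret rf: random_flow N P concat_path \<Phi> "0 :: real ^ 'd" by (rule random_flow)
  let ?\<mu> = "distr \<mu>' (borel \<Otimes>\<^sub>M BH_borel H) inclusion"
  have em: "inclusion \<in> \<mu>' \<rightarrow>\<^sub>M borel \<Otimes>\<^sub>M BH_borel H"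
    using inclusion_measurable \<mu>'(2) by (simp cong: measurable_cong_sets)
  have snd': "snd \<in> \<mu>' \<rightarrow>\<^sub>M N" using \<mu>'(2) by (simp cong: measurable_cong_sets)
  have sp: "space \<mu>' = UNIV \<times> Bt" using sets_eq_imp_space_eq[OF \<mu>'(2)] by (simp add: space_pair_measure space_N)
  show ?thesis unfolding invariant_measure_def
  proof (intro conjI allI impI ballI)
    show "prob_space ?\<mu>" by (rule \<mu>'.prob_space_distr[OF em])
    show "sets ?\<mu> = sets (borel \<Otimes>\<^sub>M BH_borel H)" by simp
    show "distr ?\<mu> (BH_borel H) snd = P"
    proof (rule measure_eqI)
      fix E assume "E \<in> sets (distr ?\<mu> (BH_borel H) snd)"
      then have E: "E \<in> sets (BH_borel H)" "E \<in> sets P" using sets_P by auto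
      then have EB: "E \<inter> Bt \<in> sets N" using Bt_sets by (auto simp: sets_N_iff)
      have "emeasure (distr ?\<mu> (BH_borel H) snd) E = emeasure ?\<mu> (snd -` E \<inter> space ?\<mu>)"
        by (rule emeasure_distr) (use E in auto)
      also have "\<dots> = emeasure \<mu>' (inclusion -` (snd -` E \<inter> space ?\<mu>) \<inter> space \<mu>')"
        by (rule emeasure_distr[OF em]) (use measurable_sets[OF measurable_snd E(1)] in simp)
      also have "inclusion -` (snd -` E \<inter> space ?\<mu>) \<inter> space \<mu>' = snd -` (E \<inter> Bt) \<inter> space \<mu>'"
        using Bt_BH by (auto simp: inclusion_def sp space_pair_measure space_BH_borel)
      also have "emeasure \<mu>' \<dots> = emeasure (distr \<mu>' N snd) (E \<inter> Bt)"
        by (rule emeasure_distr[OF snd' EB, symmetric])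
      also have "\<dots> = emeasure P (E \<inter> Bt)" using emeasure_N[OF EB] by (simp add: \<mu>'(3))
      also have "\<dots> = emeasure P E"
        using AE_Bt E(2) Bt_sets by (intro emeasure_eq_AE) auto
      finally show "emeasure (distr ?\<mu> (BH_borel H) snd) E = emeasure P E" .
    qed (simp add: sets_P)
    fix t :: real and \<Gamma> assume t: "0 \<le> t" and "\<Gamma> \<in> sets ?\<mu>"
    then have \<Gamma>: "\<Gamma> \<in> sets (borel \<Otimes>\<^sub>M BH_borel H)" by simp
    define \<Gamma>' where "\<Gamma>' = inclusion -` \<Gamma> \<inter> space (borel \<Otimes>\<^sub>M N)"
    have \<Gamma>' [measurable]: "\<Gamma>' \<in> sets (borel \<Otimes>\<^sub>M N)" unfolding \<Gamma>'_def by (rule measurable_sets[OF inclusion_measurable \<Gamma>])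
    have \<Gamma>'_iff: "p \<in> \<Gamma>' \<longleftrightarrow> p \<in> \<Gamma> \<and> snd p \<in> Bt" for p
      by (cases p) (auto simp: \<Gamma>'_def inclusion_def space_pair_measure space_N)
    define q where "q p = (\<integral>\<^sup>+\<eta>. indicator \<Gamma>' (rf.step t (p, \<eta>)) \<partial>P)" for p
    note [measurable] = rf.measurable_step[OF t]
    have q: "q \<in> borel_measurable (borel \<Otimes>\<^sub>M N)" unfolding q_def by measurable
    have qt: "transition P \<Phi> t (x, \<omega>m) \<Gamma> = q (x, \<omega>m)" if \<omega>m: "\<omega>m \<in> Bt" for x \<omega>m
      unfolding transition_eq[OF \<omega>m t] q_def rf.step_def
      by (intro nn_integral_cong) (simp add: \<Gamma>'_iff indicator_def concat_Bt[OF \<omega>m _ t] space_P)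
    obtain w0 where w0: "w0 \<in> Bt" using Bt_nonempty by blast
    \<comment> \<open>\<open>transition\<close> is identified with \<open>q\<close> over
      \<open>Bt\<close> only; the retraction provides a function measurable on the whole space that
      agrees with it almost everywhere.\<close>
    define r where "r p = (fst p, if snd p \<in> Bt then snd p else w0)" for p :: "(real ^ 'd) \<times> 'd hpath"
    have r: "r \<in> borel \<Otimes>\<^sub>M BH_borel H \<rightarrow>\<^sub>M borel \<Otimes>\<^sub>M N"
    proof -
      have "(\<lambda>\<omega>. if \<omega> \<in> Bt then \<omega> else w0) \<in> BH_borel H \<rightarrow>\<^sub>M N"
        using retract_measurable[OF w0] sets_P by (simp cong: measurable_cong_sets)
      from measurable_compose[OF measurable_snd this]
      show ?thesis unfolding r_def by (intro measurable_Pair) auto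
    qed
    have qr: "(\<lambda>p. q (r p)) \<in> borel_measurable (borel \<Otimes>\<^sub>M BH_borel H)" by (rule measurable_compose[OF r q])
    have "emeasure ?\<mu> \<Gamma> = emeasure \<mu>' \<Gamma>'"
      unfolding \<Gamma>'_def by (subst emeasure_distr[OF em \<Gamma>]) (simp add: sp space_pair_measure space_N)
    also have "\<dots> = emeasure (rf.average t \<mu>') \<Gamma>'" by (simp add: inv[OF t])
    also have "\<dots> = (\<integral>\<^sup>+p. q p \<partial>\<mu>')" unfolding q_def by (rule rf.average(4)[OF t \<mu>'(1,2) \<Gamma>'])
    also have "\<dots> = (\<integral>\<^sup>+p. q (r (inclusion p)) \<partial>\<mu>')"
      by (intro nn_integral_cong) (auto simp: sp r_def inclusion_def)
    also have "\<dots> = (\<integral>\<^sup>+z. q (r z) \<partial>?\<mu>)"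
      by (rule nn_integral_distr[OF em, symmetric]) (use qr in simp)
    also have "\<dots> = (\<integral>\<^sup>+z. transition P \<Phi> t z \<Gamma> \<partial>?\<mu>)"
    proof (rule nn_integral_cong_AE)
      have "AE p in \<mu>'. snd (inclusion p) \<in> Bt" by (rule AE_I2) (auto simp: sp inclusion_def)
      moreover have "snd -` Bt \<inter> space (borel \<Otimes>\<^sub>M BH_borel H :: ((real ^ 'd) \<times> 'd hpath) measure)
          \<in> sets (borel \<Otimes>\<^sub>M BH_borel H)"
        by (rule measurable_sets[OF measurable_snd]) (use Bt_sets sets_P in simp)
      ultimately have "AE z in ?\<mu>. snd z \<in> Bt"
        by (subst AE_distr_iff[OF em]) (auto simp: vimage_def Int_def conj_commute)
      then show "AE z in ?\<mu>. q (r z) = transition P \<Phi> t z \<Gamma>"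
        by eventually_elim (use qt in \<open>auto simp: r_def\<close>)
    qed
    finally show "emeasure ?\<mu> \<Gamma> = (\<integral>\<^sup>+z. transition P \<Phi> t z \<Gamma> \<partial>?\<mu>)" .
  qed
qed

text \<open>Off the attractor a point lies in a base set \<open>b\<close> that is null for its
  fibre. The rectangles \<open>b \<times> E b\<close> are countably many and null by the
  disintegration formula, so their union is a measurable null cover.\<close>

lemma attractor_null:
  obtains X where "X \<in> null_sets \<mu>" "\<And>x \<omega>. \<omega> \<in> Bt \<Longrightarrow> x \<notin> attractor Bt \<nu> \<omega> \<Longrightarrow> (x, \<omega>) \<in> X"
proof -
  obtain B :: "(real ^ 'd) set set" where B: "countable B" "\<And>b. b \<in> B \<Longrightarrow> open b"
    "\<And>(M :: (real ^ 'd) measure) x. sets M = sets borel \<Longrightarrow> x \<notin> measure_supp M \<Longrightarrow> \<exists>b\<in>B. x \<in> b \<and> emeasure M b = 0"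
    using countable_cover_off_measure_supp by metis
  define E where "E b = {\<omega> \<in> Bt. emeasure (\<nu> \<omega>) b = 0}" for b
  have E: "E b \<in> sets P" if b: "b \<in> B" for b
  proof -
    have [measurable]: "(\<lambda>\<omega>. emeasure (\<nu> \<omega>) b) \<in> borel_measurable P"
      using B(2)[OF b] by (intro \<nu>_measurable) auto
    have "{\<omega> \<in> space P. emeasure (\<nu> \<omega>) b = 0} \<inter> Bt \<in> sets P" using Bt_sets by measurable
    also have "{\<omega> \<in> space P. emeasure (\<nu> \<omega>) b = 0} \<inter> Bt = E b" using Bt_BH by (auto simp: E_def space_P)
    finally show ?thesis .
  qed
  have "b \<times> E b \<in> null_sets \<mu>" if b: "b \<in> B" for b
  proof (rule null_setsI)
    show "b \<times> E b \<in> sets \<mu>" using B(2)[OF b] E[OF b] \<mu>_facts(2) sets_P by auto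
    have "emeasure \<mu> (b \<times> E b) = (\<integral>\<^sup>+\<omega>\<in>E b. emeasure (\<nu> \<omega>) b \<partial>P)"
      using B(2)[OF b] E[OF b] by (intro \<mu>_rectangle) auto
    also have "\<dots> = (\<integral>\<^sup>+\<omega>. 0 \<partial>P)" by (intro nn_integral_cong) (auto simp: E_def indicator_def)
    finally show "emeasure \<mu> (b \<times> E b) = 0" by simp
  qed
  then have "(\<Union>b\<in>B. b \<times> E b) \<in> null_sets \<mu>" by (rule null_sets_UN'[OF B(1)])
  moreover have "(x, \<omega>) \<in> (\<Union>b\<in>B. b \<times> E b)" if "\<omega> \<in> Bt" "x \<notin> attractor Bt \<nu> \<omega>" for x \<omega>
  proof -
    have "sets (\<nu> \<omega>) = sets borel" "x \<notin> measure_supp (\<nu> \<omega>)"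
      using that \<nu>_facts(2) Bt_BH by (auto simp: attractor_def)
    from B(3)[OF this] show ?thesis using that(1) by (auto simp: E_def)
  qed
  ultimately show ?thesis by (rule that)
qed

lemma attraction_in_mean:
  assumes unique: "\<And>\<mu>'. invariant_measure H P \<Phi> \<mu>' \<Longrightarrow> \<mu>' = \<mu>" and \<epsilon>: "\<epsilon> > 0"
  shows "((\<lambda>t. (1 / t) * (LINT s:{0..t}|lborel.
        measure P {\<omega>m \<in> BH H. infdist (cocycle \<Phi> s \<omega>m x0) (attractor Bt \<nu> \<omega>m) \<ge> \<epsilon>}))
      \<longlongrightarrow> 0) at_top"
proof -
  interpret rf: random_flow N P concat_path \<Phi> x0 by (rule random_flow)
  define \<psi> where "\<psi> p = min 1 (infdist (fst p) (attractor Bt \<nu> (snd p)) / \<epsilon>)" for p :: "(real ^ 'd) \<times> 'd hpath"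
  have [measurable]: "(\<lambda>p. infdist (fst p) (attractor Bt \<nu> (snd p))) \<in> borel_measurable (borel \<Otimes>\<^sub>M N)"
    using infdist_attractor_measurable by (simp add: split_beta')
  have \<psi>m: "\<psi> \<in> borel_measurable (borel \<Otimes>\<^sub>M N)" unfolding \<psi>_def by measurable
  have \<psi>01: "0 \<le> \<psi> p" "\<psi> p \<le> 1" for p using \<epsilon> by (auto simp: \<psi>_def infdist_nonneg)
  have \<psi>B: "\<bar>\<psi> p\<bar> \<le> 1" for p using \<psi>01[of p] by simp
  have \<psi>L: "\<bar>\<psi> (x, \<omega>) - \<psi> (y, \<omega>)\<bar> \<le> (1 / \<epsilon>) * norm (x - y)" for x y \<omega>
  proof -
    have "\<bar>infdist x (attractor Bt \<nu> \<omega>) - infdist y (attractor Bt \<nu> \<omega>)\<bar> \<le> norm (x - y)"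
      using infdist_triangle[of x "attractor Bt \<nu> \<omega>" y] infdist_triangle[of y "attractor Bt \<nu> \<omega>" x]
      by (simp add: dist_norm norm_minus_commute abs_le_iff)
    then have "\<bar>infdist x (attractor Bt \<nu> \<omega>) - infdist y (attractor Bt \<nu> \<omega>)\<bar> / \<epsilon> \<le> norm (x - y) / \<epsilon>"
      using \<epsilon> by (intro divide_right_mono) auto
    then have "\<bar>infdist x (attractor Bt \<nu> \<omega>) / \<epsilon> - infdist y (attractor Bt \<nu> \<omega>) / \<epsilon>\<bar> \<le> norm (x - y) / \<epsilon>"
      using \<epsilon> by (simp add: abs_divide diff_divide_distrib[symmetric])
    then show ?thesis unfolding \<psi>_def by simp
  qed
  define I where "I T = (\<integral>p. \<psi> p \<partial>rf.occupation T)" for T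
  have I_eq: "I T = (1 / max 1 T) * (LINT s:{0..max 1 T}|lborel. (\<integral>\<omega>. \<psi> (rf.orbit (s, \<omega>)) \<partial>(N \<Otimes>\<^sub>M P)))" for T
    unfolding I_def by (rule rf.integral_occupation(1)[OF \<psi>m \<psi>B])
  define b where "b s = (\<integral>\<omega>. \<psi> (rf.orbit (s, \<omega>)) \<partial>(N \<Otimes>\<^sub>M P))" for s
  have bm [measurable]: "b \<in> borel_measurable borel" and bB: "\<bar>b s\<bar> \<le> 1" and b0: "0 \<le> b s" for s
    using rf.integral_occupation(2,3)[OF \<psi>m \<psi>B] \<psi>01(1) unfolding b_def by (auto intro!: integral_nonneg_AE)
  define a where "a s = measure P {\<omega>m \<in> BH H. infdist (cocycle \<Phi> s \<omega>m x0) (attractor Bt \<nu> \<omega>m) \<ge> \<epsilon>}" for s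
  \<comment> \<open>The event need not be measurable, nor \<open>a\<close> integrable. As \<open>measure\<close> and the integral
    are then 0, an inequality is enough.\<close>
  have ab: "a s \<le> b s" if s: "0 \<le> s" for s
  proof -
    let ?S = "{\<omega>m \<in> BH H. infdist (cocycle \<Phi> s \<omega>m x0) (attractor Bt \<nu> \<omega>m) \<ge> \<epsilon>}"
    show ?thesis
    proof (cases "?S \<in> sets P")
      case True
      then have SB: "?S \<inter> Bt \<in> sets N" using Bt_sets by (auto simp: sets_N_iff)
      note c = concat_measurable[OF s]
      have pre: "concat_path s -` (?S \<inter> Bt) \<inter> space (N \<Otimes>\<^sub>M P) \<in> sets (N \<Otimes>\<^sub>M P)"
        by (rule measurable_sets[OF c SB])
      have "emeasure P ?S = emeasure P (?S \<inter> Bt)"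
        using AE_Bt True Bt_sets by (intro emeasure_eq_AE) auto
      \<comment> \<open>Stationarity replaces the past by \<open>concat_path s \<omega>\<close>, at
        which \<open>cocycle\<close> becomes the forward flow
        \<open>\<Phi> s \<omega>\<close>.\<close>
      then have "a s = measure N (?S \<inter> Bt)" using emeasure_N[OF SB] by (simp add: a_def measure_def)
      also have "\<dots> = measure (distr (N \<Otimes>\<^sub>M P) N (concat_path s)) (?S \<inter> Bt)" by (simp add: distr_concat[OF s])
      also have "\<dots> = measure (N \<Otimes>\<^sub>M P) (concat_path s -` (?S \<inter> Bt) \<inter> space (N \<Otimes>\<^sub>M P))"
        by (rule measure_distr[OF c SB])
      also have "\<dots> = (\<integral>\<omega>. indicator (concat_path s -` (?S \<inter> Bt) \<inter> space (N \<Otimes>\<^sub>M P)) \<omega> \<partial>(N \<Otimes>\<^sub>M P))"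
        by (simp add: Int_absorb2)
      also have "\<dots> \<le> b s" unfolding b_def
      proof (rule integral_mono)
        show "integrable (N \<Otimes>\<^sub>M P) (indicat_real (concat_path s -` (?S \<inter> Bt) \<inter> space (N \<Otimes>\<^sub>M P)))"
          using pre by (intro integrable_real_indicator) (auto simp: NP.emeasure_eq_measure)
        have "(\<lambda>\<omega>. \<psi> (rf.orbit (s, \<omega>))) \<in> borel_measurable (N \<Otimes>\<^sub>M P)"
          by (rule measurable_compose[OF _ measurable_compose[OF rf.measurable_orbit \<psi>m]]) simp
        then show "integrable (N \<Otimes>\<^sub>M P) (\<lambda>\<omega>. \<psi> (rf.orbit (s, \<omega>)))"
          by (rule NP.integrable_bounded_function[OF _ \<psi>B])
        fix \<omega> assume \<omega>: "\<omega> \<in> space (N \<Otimes>\<^sub>M P)"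
        show "indicat_real (concat_path s -` (?S \<inter> Bt) \<inter> space (N \<Otimes>\<^sub>M P)) \<omega> \<le> \<psi> (rf.orbit (s, \<omega>))"
        proof (cases "concat_path s \<omega> \<in> ?S \<inter> Bt")
          case True
          obtain \<omega>m \<omega>p where m: "\<omega> = (\<omega>m, \<omega>p)" "\<omega>m \<in> Bt" "\<omega>p \<in> BH H" using \<omega> by (auto simp: space_NP)
          have "\<epsilon> \<le> infdist (\<Phi> s \<omega> x0) (attractor Bt \<nu> (concat_path s \<omega>))"
            using True cocycle_concat[OF m(2,3) s, of x0] by (simp add: m(1))
          then have "\<psi> (rf.orbit (s, \<omega>)) = 1" using \<epsilon> s by (simp add: \<psi>_def rf.orbit_def)
          then show ?thesis by (simp add: indicator_def)
        next
          case False
          then have "\<omega> \<notin> concat_path s -` (?S \<inter> Bt) \<inter> space (N \<Otimes>\<^sub>M P)" by blast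
          then show ?thesis by (subst indicator_simps(2)) (assumption, rule \<psi>01(1))
        qed
      qed
      finally show ?thesis .
    next
      case False
      then show ?thesis using b0[of s] by (simp add: a_def measure_notin_sets)
    qed
  qed
  have bi: "set_integrable lborel {0..T} b" for T
    unfolding set_integrable_def
  proof (rule Bochner_Integration.integrable_bound)
    show "integrable lborel (indicat_real {0..T})"
      by (intro integrable_real_indicator) (auto simp: emeasure_lborel_Icc_eq)
    show "AE s in lborel. norm (indicat_real {0..T} s *\<^sub>R b s) \<le> norm (indicat_real {0..T} s)"
      using bB by (auto simp: indicator_def)
  qed measurable
  have avg: "0 \<le> (1 / T) * (LINT s:{0..T}|lborel. a s)" "(1 / T) * (LINT s:{0..T}|lborel. a s) \<le> I T" if T: "1 \<le> T" for T
  proof -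
    have "0 \<le> (LINT s:{0..T}|lborel. a s)"
      unfolding set_lebesgue_integral_def by (intro integral_nonneg_AE AE_I2) (simp add: a_def)
    then show "0 \<le> (1 / T) * (LINT s:{0..T}|lborel. a s)" using T by simp
    have "(LINT s:{0..T}|lborel. a s) \<le> (LINT s:{0..T}|lborel. b s)"
    proof (cases "set_integrable lborel {0..T} a")
      case True
      then show ?thesis using bi ab by (intro set_integral_mono) auto
    next
      case False
      then have "(LINT s:{0..T}|lborel. a s) = 0"
        unfolding set_lebesgue_integral_def set_integrable_def by (rule not_integrable_integral_eq)
      also have "0 \<le> (LINT s:{0..T}|lborel. b s)"
        unfolding set_lebesgue_integral_def using b0 by (intro integral_nonneg_AE AE_I2) simp
      finally show ?thesis .
    qed
    then show "(1 / T) * (LINT s:{0..T}|lborel. a s) \<le> I T"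
      using T unfolding I_eq b_def[symmetric] by (simp add: max_def divide_right_mono)
  qed
  have "(I \<longlongrightarrow> 0) at_top"
  proof (rule tendstoI, rule ccontr)
    fix e :: real assume e: "e > 0" and neg: "\<not> eventually (\<lambda>T. dist (I T) 0 < e) at_top"
    \<comment> \<open>A filter finer than \<open>at_top\<close> that lives on the times at which
      \<open>I\<close> stays away from 0. Along a refinement of it a limit point exists, equals
      \<open>\<mu>\<close> by uniqueness, and forces \<open>I\<close> to 0.\<close>
    define F where "F = inf at_top (principal {T. \<not> dist (I T) 0 < e})"
    have F: "F \<noteq> bot" "F \<le> at_top"
    proof -
      show "F \<noteq> bot"
        using neg unfolding F_def trivial_limit_def eventually_inf_principal by simp
    qed (simp add: F_def)
    obtain G \<mu>' where G: "G \<le> F" "G \<noteq> bot"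
      and \<mu>': "prob_space \<mu>'" "sets \<mu>' = sets (borel \<Otimes>\<^sub>M N)" "distr \<mu>' N snd = N"
      and inv: "\<And>t. 0 \<le> t \<Longrightarrow> rf.average t \<mu>' = \<mu>'"
      and lim: "(I \<longlongrightarrow> (\<integral>p. \<psi> p \<partial>\<mu>')) G"
    proof (rule rf.occupation_limit_invariant[OF F], goal_cases)
      case (1 G \<mu>')
      show ?case
        by (rule 1(1)[OF 1(2-6) 1(7)], assumption, unfold I_def, rule 1(8)[OF \<psi>m \<psi>B \<psi>L])
    qed
    interpret \<mu>': prob_space \<mu>' by fact
    have em: "inclusion \<in> \<mu>' \<rightarrow>\<^sub>M borel \<Otimes>\<^sub>M BH_borel H"
      using inclusion_measurable \<mu>'(2) by (simp cong: measurable_cong_sets)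
    have sp: "space \<mu>' = UNIV \<times> Bt" using sets_eq_imp_space_eq[OF \<mu>'(2)] by (simp add: space_pair_measure space_N)
    have eq: "distr \<mu>' (borel \<Otimes>\<^sub>M BH_borel H) inclusion = \<mu>"
      by (rule unique[OF embedded_invariant[OF \<mu>' inv]])
    obtain X where X: "X \<in> null_sets \<mu>" "\<And>x \<omega>. \<omega> \<in> Bt \<Longrightarrow> x \<notin> attractor Bt \<nu> \<omega> \<Longrightarrow> (x, \<omega>) \<in> X"
      using attractor_null by metis
    have "AE z in distr \<mu>' (borel \<Otimes>\<^sub>M BH_borel H) inclusion. z \<notin> X"
      unfolding eq by (rule AE_not_in[OF X(1)])
    then have "AE p in \<mu>'. inclusion p \<notin> X" by (rule AE_distrD[OF em])
    then have "AE p in \<mu>'. \<psi> p = 0"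
    proof (rule AE_mp, intro AE_I2 impI)
      fix p assume p: "p \<in> space \<mu>'" "inclusion p \<notin> X"
      then have "snd p \<in> Bt" "(fst p, snd p) \<notin> X" by (auto simp: sp inclusion_def)
      then have "fst p \<in> attractor Bt \<nu> (snd p)" using X(2) by blast
      then show "\<psi> p = 0" by (simp add: \<psi>_def)
    qed
    then have "(\<integral>p. \<psi> p \<partial>\<mu>') = 0" by (simp add: integral_eq_zero_AE)
    with lim have "eventually (\<lambda>T. dist (I T) 0 < e) G" using e by (auto dest: tendstoD)
    moreover have "eventually (\<lambda>T. \<not> dist (I T) 0 < e) G"
      using G(1) by (rule filter_leD) (simp add: F_def eventually_inf_principal)
    ultimately have "eventually (\<lambda>T. False) G" by eventually_elim simp
    with G(2) show False by (simp add: trivial_limit_def)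
  qed
  then have "((\<lambda>T. (1 / T) * (LINT s:{0..T}|lborel. a s)) \<longlongrightarrow> 0) at_top"
    by (rule tendsto_sandwich[OF _ _ tendsto_const, rotated 2])
      (use avg in \<open>auto simp: eventually_at_top_linorder intro!: exI[of _ 1]\<close>)
  then show ?thesis by (simp add: a_def)
qed

end

theorem proposition4p7:
  fixes H \<alpha> :: real
    and P :: "('d::finite) hpath measure"
    and D :: "'d hpath \<Rightarrow> 'd hpath"
    and F :: "real ^ 'd \<Rightarrow> real ^ 'd"
    and \<sigma> :: "real ^ 'd ^ 'd"
    and \<Phi> :: "real \<Rightarrow> 'd hpath \<times> 'd hpath \<Rightarrow> real ^ 'd \<Rightarrow> real ^ 'd"
    and \<mu> :: "((real ^ 'd) \<times> 'd hpath) measure"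
    and Bt :: "'d hpath set"
    and \<nu> :: "'d hpath \<Rightarrow> (real ^ 'd) measure"
  assumes "0 < H" and "H < 1"
    and "wiener_measure H P"
    and "frac_operator H P \<alpha> D"
    and "invertible \<sigma>"
    and "drift_conditions H F"
    and "sde_solution H D F \<sigma> \<Phi>"
    and "invariant_measure H P \<Phi> \<mu>"
    and "\<And>\<mu>'. invariant_measure H P \<Phi> \<mu>' \<Longrightarrow> \<mu>' = \<mu>"
    and "disintegration H P \<Phi> \<mu> Bt \<nu>"
  shows "\<forall>\<epsilon>>0. \<forall>x0 :: real ^ 'd.
    ((\<lambda>t. (1 / t) * (LINT s:{0..t}|lborel.
        measure P {\<omega>m \<in> BH H. infdist (cocycle \<Phi> s \<omega>m x0) (attractor Bt \<nu> \<omega>m) \<ge> \<epsilon>}))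
      \<longlongrightarrow> 0) at_top"
proof -
  interpret fractional_sde H \<alpha> P D F \<sigma> \<Phi> \<mu> Bt \<nu>
    by (rule fractional_sde.intro[OF assms(1-4,6-8,10)])
  show ?thesis
    by (intro allI impI attraction_in_mean[OF assms(9)])
qed

end
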